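(* There exists a separable (infinite-dimensional, real) Banach space $\mathbf{X}$ of finite cotype with $D_{\mathbf{X}}(k)=\Theta(k)$ as $k\to\infty$.
   Context: For two $k$-dimensional normed spaces $E,F$, the Banach–Mazur distance is $d_{BM}(E,F)=\inf_T\|T\|_{E\to F}\cdot\|T^{-1}\|_{F\to E}$, the infimum being over all invertible linear operators $T:E\to F$. For a normed space $\mathbf{X}$ and an integer $1\le k\le\dim\mathbf{X}$, $$D_{\mathbf{X}}(k):=\sup\{d_{BM}(E,F):\ \dim E=\dim F=k;\ E,F\subset\mathbf{X}\},$$ where $E,F$ are linear subspaces with the induced norm. $D_{\mathbf{X}}(k)=\Theta(k)$ means that there are constants $c,C>0$ independent of $k$ with $ck\le D_{\mathbf{X}}(k)\le Ck$. $\mathbf{X}$ has cotype $q\in[2,\infty)$ with constant $C_q<\infty$ if $\mathbb{E}_\sigma\|\sum_{i=1}^k\sigma_iy_i\|_{\mathbf{X}}^q\ge C_q^{-q}\sum_{i=1}^k\|y_i\|_{\mathbf{X}}^q$ for every $k\ge1$ and every $y_1,\dots,y_k\in\mathbf{X}$, where $\sigma$ is uniform on $\{-1,1\}^k$. $\mathbf{X}$ has finite cotype if it has cotype $q$ with constant $C_q$ for some finite $q\in[2,\infty)$ and some $C_q<\infty$. *)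

theory Defs
  imports "HOL-Probability.Probability" "HOL-Library.Function_Algebras"
begin

instantiation "fun" :: (type, real_vector) real_vector
begin

definition scaleR_fun :: "real \<Rightarrow> ('a \<Rightarrow> 'b) \<Rightarrow> 'a \<Rightarrow> 'b"
  where "scaleR_fun c f = (\<lambda>x. c *\<^sub>R f x)"

instance
  by standard (auto simp: scaleR_fun_def fun_eq_iff algebra_simps)

end

text \<open>
  A normed space is a pair (V, N): a linear subspace V of an ambient real vector space together
  with a norm N on V. The values of N outside V are irrelevant.
  Only the linear structure of the ambient type is used. Every real vector space of algebraic
  dimension at most the continuum, in particular every separable Banach space, is linearly
  isomorphic to a subspace of \<^typ>\<open>nat \<Rightarrow> real\<close>; as N is an arbitrary norm on the subspace,
  every separable Banach space is represented on that ambient type up to isometry.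
\<close>

locale normed_space_on =
  fixes V :: "'a::real_vector set" and N :: "'a \<Rightarrow> real"
  assumes subspace_carrier: "subspace V"
    and norm_nonneg: "x \<in> V \<Longrightarrow> 0 \<le> N x"
    and norm_eq_zero_iff: "x \<in> V \<Longrightarrow> N x = 0 \<longleftrightarrow> x = 0"
    and norm_triangle: "x \<in> V \<Longrightarrow> y \<in> V \<Longrightarrow> N (x + y) \<le> N x + N y"
    and norm_scale: "x \<in> V \<Longrightarrow> N (c *\<^sub>R x) = \<bar>c\<bar> * N x"

text \<open>
  The library locale of metric spaces requires nonnegativity and symmetry on the whole
  ambient type, hence the default value 0.
\<close>

definition norm_dist :: "'a::real_vector set \<Rightarrow> ('a \<Rightarrow> real) \<Rightarrow> 'a \<Rightarrow> 'a \<Rightarrow> real"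
  where "norm_dist V N x y = (if x \<in> V \<and> y \<in> V then N (x - y) else 0)"

lemma (in normed_space_on) Metric_space_norm_dist: "Metric_space V (norm_dist V N)"
proof
  have diff: "x - y \<in> V" if "x \<in> V" "y \<in> V" for x y
    using that subspace_carrier by (simp add: subspace_diff)
  show "0 \<le> norm_dist V N x y" for x y
    by (simp add: norm_dist_def norm_nonneg diff)
  have "N (x - y) = N (y - x)" if "x \<in> V" "y \<in> V" for x y
    using norm_scale[OF diff[OF that], of "- 1"] by simp
  then show "norm_dist V N x y = norm_dist V N y x" for x y
    by (simp add: norm_dist_def)
  show "norm_dist V N x y = 0 \<longleftrightarrow> x = y" if "x \<in> V" "y \<in> V" for x y
    using that by (simp add: norm_dist_def norm_eq_zero_iff diff)
  show "norm_dist V N x z \<le> norm_dist V N x y + norm_dist V N y z"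
    if "x \<in> V" "y \<in> V" "z \<in> V" for x y z
    using that norm_triangle[OF diff diff, of x y y z] by (simp add: norm_dist_def)
qed

locale banach_space_on = normed_space_on +
  assumes complete: "Metric_space.mcomplete V (norm_dist V N)"

definition separable_norm :: "'a::real_vector set \<Rightarrow> ('a \<Rightarrow> real) \<Rightarrow> bool"
  where "separable_norm V N \<longleftrightarrow> separable_space (Metric_space.mtopology V (norm_dist V N))"

definition infinite_dim :: "'a::real_vector set \<Rightarrow> bool"
  where "infinite_dim V \<longleftrightarrow> \<not> (\<exists>B. finite B \<and> V \<subseteq> span B)"

text \<open>Operators between subspaces are represented by functions on the ambient type whose
  values outside the domain are irrelevant.\<close>

definition linear_between :: "'a::real_vector set \<Rightarrow> 'a set \<Rightarrow> ('a \<Rightarrow> 'a) \<Rightarrow> bool"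
  where "linear_between E F T \<longleftrightarrow>
    T ` E \<subseteq> F \<and>
    (\<forall>x\<in>E. \<forall>y\<in>E. T (x + y) = T x + T y) \<and>
    (\<forall>c. \<forall>x\<in>E. T (c *\<^sub>R x) = c *\<^sub>R T x)"

text \<open>The norm of an operator defined on E, where the domain and the target both carry (the
  restriction of) N. Suprema and infima are taken in \<^typ>\<open>ereal\<close>, so that unbounded or empty
  families do not produce unspecified values.\<close>

definition op_norm :: "('a::real_vector \<Rightarrow> real) \<Rightarrow> 'a set \<Rightarrow> ('a \<Rightarrow> 'a) \<Rightarrow> ereal"
  where "op_norm N E T = (SUP x\<in>{x \<in> E. N x \<le> 1}. ereal (N (T x)))"

definition banach_mazur_dist :: "('a::real_vector \<Rightarrow> real) \<Rightarrow> 'a set \<Rightarrow> 'a set \<Rightarrow> ereal"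
  where "banach_mazur_dist N E F =
    (INF T\<in>{T. linear_between E F T \<and> bij_betw T E F}.
       op_norm N E T * op_norm N F (inv_into E T))"

text \<open>The library's \<^const>\<open>dim\<close> is 0 on infinite-dimensional spaces, so for k at least 1 the
  condition dim E = k means that E is finite-dimensional of dimension k.\<close>

definition subspace_diameter :: "'a::real_vector set \<Rightarrow> ('a \<Rightarrow> real) \<Rightarrow> nat \<Rightarrow> ereal"
  where "subspace_diameter V N k =
    (SUP (E, F)\<in>{(E, F). subspace E \<and> E \<subseteq> V \<and> dim E = k \<and> subspace F \<and> F \<subseteq> V \<and> dim F = k}.
       banach_mazur_dist N E F)"

text \<open>Positivity of C matters: in HOL, 0 powr (- q) = 0.\<close>

definition has_cotype :: "'a::real_vector set \<Rightarrow> ('a \<Rightarrow> real) \<Rightarrow> real \<Rightarrow> real \<Rightarrow> bool"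
  where "has_cotype V N q C \<longleftrightarrow> 2 \<le> q \<and> 0 < C \<and>
    (\<forall>k::nat\<ge>1. \<forall>y. (\<forall>i<k. y i \<in> V) \<longrightarrow>
       measure_pmf.expectation (pmf_of_set ({..<k} \<rightarrow>\<^sub>E {-1, 1}))
         (\<lambda>\<sigma>. N (\<Sum>i<k. \<sigma> i *\<^sub>R y i) powr q)
       \<ge> C powr (- q) * (\<Sum>i<k. N (y i) powr q))"

definition finite_cotype :: "'a::real_vector set \<Rightarrow> ('a \<Rightarrow> real) \<Rightarrow> bool"
  where "finite_cotype V N \<longleftrightarrow> (\<exists>q C. has_cotype V N q C)"

end

theory Submission
  imports Defs "Jordan_Normal_Form.Determinant"
begin

text \<open>
  For a \<open>k \<times> l\<close> matrix \<open>G\<close> with \<open>l\<close> a small multiple of \<open>k\<close>, take the quotient of \<open>\<ell>\<^sub>1\<close> of dimension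
  \<open>k + l\<close> whose unit ball is the absolutely convex hull of the vectors \<open>\<surd>k e\<^sub>i\<close> and the columns of \<open>G\<close>.
  The space is the \<open>\<ell>\<^sub>2\<close>-sum of two such quotients for every \<open>k\<close>.

  If the \<open>\<ell>\<^sub>1\<close>-norm of \<open>G y\<close> is comparable to \<open>k\<close> times the Euclidean norm of \<open>y\<close>, then the kernel of
  the quotient map is uniformly Hilbertian, and by Pisier's argument for quotients of \<open>L\<^sub>1\<close> by
  K-convex subspaces the quotient has cotype 2 with a uniform constant. Most matrices with entries
  in a fine grid have this property.

  By Gluskin's argument two such random quotients have Banach--Mazur distance at least a multiple of
  \<open>k\<close>. An operator or its inverse does not shrink volume. If \<open>T\<close> does not, then only a fraction
  \<open>(C c)\<^sup>k\<close> of the grid vectors is mapped by \<open>T\<close> into \<open>c \<surd>k\<close> times the unit ball of the target, because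
  that ball is covered by \<open>C\<^sup>k\<close> cubes of side \<open>1 / \<surd>k\<close>. All \<open>l\<close> columns are mapped there for a fraction
  \<open>(C c)\<close> to the power \<open>k l\<close> of the matrices, while up to rounding there are only \<open>C\<close> to the power
  \<open>k\<^sup>2\<close> operators to consider.

  The upper bound holds in every normed space by John's theorem.
\<close>

section \<open>Rademacher sums\<close>

text \<open>Two demands pull on \<open>l\<close>. The lower bound wants \<open>l\<close> comparable
  to \<open>k\<close>, so that the \<open>k * l\<close> constraints on columns can beat the
  \<open>k * k\<close> parameters of an operator. Cotype wants \<open>l\<close> small against
  \<open>k\<close>, so that \<open>k\<close> independent rows beat a net in dimension
  \<open>l\<close> and \<open>G\<close> embeds Euclidean space into l1. Both hold for
  \<open>l = k div M\<close> with a fixed \<open>M\<close>: the exponent \<open>k * l\<close>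
  carries the constant \<open>c\<close>, which is chosen last. Cotype needs a special kernel because
  it does not pass to quotients in general: every separable Banach space is a quotient of l1. The
  upper l1 estimate on \<open>G\<close> serves a second time, in the entropy bound for the unit
  ball. Counting operators depends on how they are rounded. Careless rounding of a matrix to
  integers may have an error of order k^2 from l-infinity to l1, a factor sqrt k too much; a
  rounding with cancellations achieves k * sqrt k, and such an error can be absorbed into the
  integer points near the dilated ball. Uniform choice from a finite grid makes every probability a
  ratio of cardinalities, and grid cells turn cardinalities into volumes.\<close>

lemma one_minus_cos_le_abs: "1 - cos x \<le> \<bar>x\<bar>" for x :: real
proof -
  have "1 - cos x = 2 * (sin (x/2))\<^sup>2"
    using cos_double_sin[of "x/2"] by simp
  also have "\<dots> = 2 * (\<bar>sin (x/2)\<bar> * \<bar>sin (x/2)\<bar>)"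
    by (simp add: power2_eq_square)
  also have "\<dots> \<le> 2 * (\<bar>x/2\<bar> * 1)"
    by (intro mult_left_mono mult_mono abs_sin_x_le_abs_x) auto
  finally show ?thesis by simp
qed

lemma one_minus_cos_le_square: "1 - cos x \<le> x\<^sup>2 / 2" for x :: real
proof -
  have "1 - cos x = 2 * (sin (x/2))\<^sup>2"
    using cos_double_sin[of "x/2"] by simp
  also have "(sin (x/2))\<^sup>2 \<le> (x/2)\<^sup>2"
    using abs_sin_x_le_abs_x[of "x/2"] abs_le_square_iff by blast
  finally show ?thesis by (simp add: power_divide)
qed

lemma cos_le_quadratic:
  fixes u :: real assumes "\<bar>u\<bar> \<le> 1" shows "cos u \<le> 1 - u\<^sup>2 / 4"
proof -
  define v where "v = \<bar>u\<bar> / 2"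
  have v: "0 \<le> v" "v \<le> 1/2" using assms by (auto simp: v_def)
  \<comment> \<open>Mean value theorem with cos at least 7/8 on [0, 1/2]. Twice the square of
    \<open>7/8 * v\<close> is 49/128 * u^2, which exceeds u^2 / 4.\<close>
  have s: "7/8 * v \<le> sin v"
  proof (cases "v = 0")
    case False
    then have "\<exists>z>0. z < v \<and> sin v - sin 0 = (v - 0) * cos z"
      using v by (intro MVT2) (auto intro!: derivative_eq_intros)
    then obtain z where z: "0 < z" "z < v" "sin v = v * cos z" by auto
    have "z\<^sup>2 \<le> (1/2)\<^sup>2" using z v by (intro power_mono) auto
    then have "7/8 \<le> cos z" using one_minus_cos_le_square[of z] by (simp add: power2_eq_square)
    then show ?thesis using z(3) v(1) mult_left_mono[of "7/8" "cos z" v] by (simp add: mult.commute)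
  qed auto
  have "(7/8 * v)\<^sup>2 \<le> (sin v)\<^sup>2" using s v by (intro power_mono) auto
  moreover have "cos u = 1 - 2 * (sin v)\<^sup>2"
    using cos_double_sin[of v] by (simp add: v_def)
  moreover have "(7/8 * v)\<^sup>2 = 49/256 * u\<^sup>2" by (simp add: v_def power_mult_distrib power_divide)
  ultimately show ?thesis using zero_le_power2[of u] by linarith
qed

lemma exp_le_quadratic:
  fixes u :: real assumes "\<bar>u\<bar> \<le> 1" shows "exp u \<le> 1 + u + u\<^sup>2"
proof (cases "0 \<le> u")
  case True then show ?thesis using exp_bound assms by auto
next
  case False
  define v where "v = - u"
  have v: "0 < v" using False by (simp add: v_def)
  \<comment> \<open>The first factor is a lower bound of \<open>exp v\<close>, so the second one
    dominates the reciprocal \<open>exp (- v)\<close>.\<close>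
  have "1 \<le> (1 + v + v\<^sup>2/2) * (1 - v + v\<^sup>2)"
  proof -
    have "(1 + v + v\<^sup>2/2) * (1 - v + v\<^sup>2) = 1 + (v\<^sup>2 + v ^ 3 + v ^ 4) / 2"
      by (simp add: field_simps power2_eq_square power3_eq_cube power4_eq_xxxx)
    then show ?thesis using v by simp
  qed
  also have "\<dots> \<le> exp v * (1 - v + v\<^sup>2)"
  proof (rule mult_right_mono)
    show "1 + v + v\<^sup>2 / 2 \<le> exp v" using exp_lower_Taylor_quadratic[of v] v by simp
    have "(1 - v/2)\<^sup>2 + 3/4 * v\<^sup>2 = 1 - v + v\<^sup>2" by (simp add: power2_eq_square algebra_simps)
    then show "0 \<le> 1 - v + v\<^sup>2" by (metis add_nonneg_nonneg zero_le_power2 mult_nonneg_nonneg zero_le_divide_iff zero_le_numeral)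
  qed
  finally have "exp (- v) \<le> 1 - v + v\<^sup>2"
    by (simp add: exp_minus field_simps)
  then show ?thesis by (simp add: v_def)
qed

lemma sum_odd_symmetric_eq_0:
  fixes D :: "real set" and f :: "real \<Rightarrow> real"
  assumes "\<And>d. d \<in> D \<Longrightarrow> - d \<in> D" "\<And>d. f (- d) = - f d"
  shows "sum f D = 0"
proof -
  have "uminus ` D = D" using assms(1) by (force simp: image_iff)
  then have "sum f D = sum (f \<circ> uminus) D"
    by (metis inj_uminus inj_on_subset subset_UNIV sum.reindex)
  also have "\<dots> = - sum f D" by (simp add: assms(2) sum_negf)
  finally show ?thesis by simp
qed

text \<open>Laplace transform of independent entries: the sum over the product set factorizes, and
  in each factor the linear term of \<open>exp_le_quadratic\<close> cancels by the symmetry of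
  \<open>D\<close>.\<close>

lemma sum_PiE_exp_le:
  fixes D :: "real set" and y :: "'a \<Rightarrow> real"
  assumes J: "finite J" and D: "finite D" "\<And>d. d \<in> D \<Longrightarrow> - d \<in> D" "D \<subseteq> {-1..1}"
    and y: "\<And>j. j \<in> J \<Longrightarrow> \<bar>y j\<bar> \<le> 1"
  shows "(\<Sum>r\<in>J \<rightarrow>\<^sub>E D. exp (\<Sum>j\<in>J. r j * y j)) \<le> real (card D) ^ card J * exp (\<Sum>j\<in>J. (y j)\<^sup>2)"
proof -
  have one: "(\<Sum>d\<in>D. exp (d * y j)) \<le> card D * exp ((y j)\<^sup>2)" if "j \<in> J" for j
  proof -
    have d1: "\<bar>d\<bar> \<le> 1" if "d \<in> D" for d using that D(3) by (auto simp: abs_le_iff subset_iff)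
    have "(\<Sum>d\<in>D. exp (d * y j)) \<le> (\<Sum>d\<in>D. 1 + d * y j + (y j)\<^sup>2)"
    proof (rule sum_mono)
      fix d assume d: "d \<in> D"
      have "\<bar>d * y j\<bar> \<le> 1" using d1[OF d] y[OF that] by (simp add: abs_mult mult_le_one)
      then have "exp (d * y j) \<le> 1 + d * y j + (d * y j)\<^sup>2" by (rule exp_le_quadratic)
      also have "(d * y j)\<^sup>2 \<le> (y j)\<^sup>2"
        using d1[OF d] by (simp add: power_mult_distrib mult_left_le_one_le abs_square_le_1)
      finally show "exp (d * y j) \<le> 1 + d * y j + (y j)\<^sup>2" by simp
    qed
    also have "\<dots> = card D * (1 + (y j)\<^sup>2)"
      using sum_odd_symmetric_eq_0[of D "\<lambda>d. d * y j"] D(2)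
      by (simp add: sum.distrib algebra_simps)
    also have "\<dots> \<le> card D * exp ((y j)\<^sup>2)"
      by (intro mult_left_mono) (auto simp: exp_ge_add_one_self)
    finally show ?thesis .
  qed
  have "(\<Sum>r\<in>J \<rightarrow>\<^sub>E D. exp (\<Sum>j\<in>J. r j * y j)) = (\<Prod>j\<in>J. \<Sum>d\<in>D. exp (d * y j))"
    using J D(1) by (simp add: prod_sum_PiE exp_sum)
  also have "\<dots> \<le> (\<Prod>j\<in>J. card D * exp ((y j)\<^sup>2))"
    by (intro prod_mono) (auto intro!: sum_nonneg one)
  also have "\<dots> = real (card D) ^ card J * exp (\<Sum>j\<in>J. (y j)\<^sup>2)"
    using J by (simp add: prod.distrib exp_sum)
  finally show ?thesis .
qed

text \<open>The cosine sum is the real part of a characteristic function, which factorizes, with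
  real factors because \<open>D\<close> is symmetric. \<open>\<eta>\<close> is a lower bound for the
  second moment of \<open>D\<close> and sets the rate of the Gaussian decay.\<close>

lemma sum_PiE_cos_le:
  fixes D :: "real set" and y :: "'a \<Rightarrow> real" and \<eta> :: real
  assumes J: "finite J" and D: "finite D" "\<And>d. d \<in> D \<Longrightarrow> - d \<in> D" "D \<subseteq> {-1..1}"
    and eta: "\<eta> * card D \<le> (\<Sum>d\<in>D. d\<^sup>2)"
    and y: "\<And>j. j \<in> J \<Longrightarrow> \<bar>y j\<bar> \<le> 1"
  shows "(\<Sum>r\<in>J \<rightarrow>\<^sub>E D. cos (\<Sum>j\<in>J. r j * y j))
    \<le> real (card D) ^ card J * exp (- (\<eta> / 4) * (\<Sum>j\<in>J. (y j)\<^sup>2))"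
proof -
  have d1: "\<bar>d\<bar> \<le> 1" if "d \<in> D" for d using that D(3) by (auto simp: abs_le_iff subset_iff)
  have dy1: "\<bar>d * y j\<bar> \<le> 1" if "d \<in> D" "j \<in> J" for d j
    using d1[OF that(1)] y[OF that(2)] by (simp add: abs_mult mult_le_one)
  have one: "(\<Sum>d\<in>D. cos (d * y j)) \<le> card D * exp (- (\<eta> / 4) * (y j)\<^sup>2)" if "j \<in> J" for j
  proof -
    have "(\<Sum>d\<in>D. cos (d * y j)) \<le> (\<Sum>d\<in>D. 1 - (d * y j)\<^sup>2 / 4)"
      by (intro sum_mono cos_le_quadratic dy1 that)
    also have "\<dots> = card D - (\<Sum>d\<in>D. d\<^sup>2) * ((y j)\<^sup>2 / 4)"
      by (simp add: sum_subtractf sum_distrib_right power_mult_distrib)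
    also have "\<dots> \<le> card D - (\<eta> * card D) * ((y j)\<^sup>2 / 4)"
      using mult_right_mono[OF eta, of "(y j)\<^sup>2 / 4"] by simp
    also have "\<dots> = card D * (1 + (- (\<eta> / 4) * (y j)\<^sup>2))" by (simp add: algebra_simps)
    also have "\<dots> \<le> card D * exp (- (\<eta> / 4) * (y j)\<^sup>2)"
      by (intro mult_left_mono exp_ge_add_one_self) auto
    finally show ?thesis .
  qed
  have re: "(\<Sum>d\<in>D. cis (d * y j)) = of_real (\<Sum>d\<in>D. cos (d * y j))" for j
    using sum_odd_symmetric_eq_0[of D "\<lambda>d. sin (d * y j)"] D(2)
    by (simp add: complex_eq_iff)
  have cis_sum: "cis (sum f I) = prod (cis \<circ> f) I" if "finite I" for f and I :: "'a set"
    using that by (induction I) (auto simp: cis_mult[symmetric])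
  have "(\<Sum>r\<in>J \<rightarrow>\<^sub>E D. cos (\<Sum>j\<in>J. r j * y j)) 
      = Re (\<Sum>r\<in>J \<rightarrow>\<^sub>E D. cis (\<Sum>j\<in>J. r j * y j))" by simp
  also have "(\<Sum>r\<in>J \<rightarrow>\<^sub>E D. cis (\<Sum>j\<in>J. r j * y j)) = (\<Prod>j\<in>J. \<Sum>d\<in>D. cis (d * y j))"
    using J D(1) by (simp add: prod_sum_PiE cis_sum)
  also have "\<dots> = of_real (\<Prod>j\<in>J. \<Sum>d\<in>D. cos (d * y j))"
    by (simp add: re)
  finally have "(\<Sum>r\<in>J \<rightarrow>\<^sub>E D. cos (\<Sum>j\<in>J. r j * y j)) = (\<Prod>j\<in>J. \<Sum>d\<in>D. cos (d * y j))"
    by (simp only: Re_complex_of_real)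
  also have "\<dots> \<le> (\<Prod>j\<in>J. card D * exp (- (\<eta> / 4) * (y j)\<^sup>2))"
  \<comment> \<open>Multiplying the bounds needs nonnegative factors: the arguments stay within
    [-1, 1], where cos is positive.\<close>
  proof (intro prod_mono conjI one sum_nonneg)
    fix j d assume "j \<in> J" "d \<in> D"
    then have "\<bar>d * y j\<bar> \<le> pi / 2" using dy1 pi_ge_two by fastforce
    then show "0 \<le> cos (d * y j)" by (intro cos_ge_zero) auto
  qed
  also have "\<dots> = real (card D) ^ card J * exp (- (\<eta> / 4) * (\<Sum>j\<in>J. (y j)\<^sup>2))"
    using J by (simp add: prod.distrib exp_sum sum_distrib_left sum_negf[symmetric])
  finally show ?thesis .
qed

section \<open>Khinchine's inequality and cotype 2 of l1\<close>

abbreviation signs :: "nat \<Rightarrow> (nat \<Rightarrow> real) set"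
  where "signs n \<equiv> {..<n} \<rightarrow>\<^sub>E {-1, 1}"

lemma finite_signs [simp]: "finite (signs n)"
  by (intro finite_PiE) auto

lemma card_signs: "card (signs n) = 2 ^ n"
  by (simp add: card_PiE numeral_2_eq_2)

text \<open>After normalizing the coefficients, |u| >= 1 - cos u turns the decay of the
  characteristic function into a lower bound for the first moment; \<open>sum_PiE_cos_le\<close>
  with \<open>\<eta> = 1\<close> supplies exp (- 1/4).\<close>

lemma khinchine:
  fixes c :: "nat \<Rightarrow> real"
  shows "(1 - exp (- 1/4)) * 2 ^ n * sqrt (\<Sum>i<n. (c i)\<^sup>2) \<le> (\<Sum>\<epsilon>\<in>signs n. \<bar>\<Sum>i<n. \<epsilon> i * c i\<bar>)"
proof (cases "(\<Sum>i<n. (c i)\<^sup>2) = 0")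
  case True
  then show ?thesis by (simp add: sum_nonneg)
next
  case False
  define s where "s = sqrt (\<Sum>i<n. (c i)\<^sup>2)"
  have "0 \<le> (\<Sum>i<n. (c i)\<^sup>2)" by (simp add: sum_nonneg)
  with False have s: "s > 0" "s\<^sup>2 = (\<Sum>i<n. (c i)\<^sup>2)" by (auto simp: s_def)
  define y where "y i = c i / s" for i
  have y1: "(\<Sum>i<n. (y i)\<^sup>2) = 1"
    using s(1) by (simp add: y_def power_divide sum_divide_distrib[symmetric] flip: s(2))
  have "\<bar>y i\<bar> \<le> 1" if "i < n" for i
  proof -
    have "(y i)\<^sup>2 \<le> (\<Sum>i<n. (y i)\<^sup>2)" using that by (intro member_le_sum) auto
    then show ?thesis using y1 abs_square_le_1 by auto
  qed
  then have cos: "(\<Sum>\<epsilon>\<in>signs n. cos (\<Sum>i<n. \<epsilon> i * y i)) \<le> 2 ^ n * exp (- 1/4)"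
    using sum_PiE_cos_le[of "{..<n}" "{-1,1}" 1 y] y1 by (auto simp: numeral_2_eq_2)
  have "(1 - exp (- 1/4)) * 2 ^ n \<le> (\<Sum>\<epsilon>\<in>signs n. 1 - cos (\<Sum>i<n. \<epsilon> i * y i))"
    using cos by (simp add: sum_subtractf card_signs algebra_simps)
  also have "\<dots> \<le> (\<Sum>\<epsilon>\<in>signs n. \<bar>\<Sum>i<n. \<epsilon> i * y i\<bar>)"
    by (intro sum_mono one_minus_cos_le_abs)
  also have "\<dots> = (\<Sum>\<epsilon>\<in>signs n. \<bar>\<Sum>i<n. \<epsilon> i * c i\<bar>) / s"
    using s(1) by (simp add: y_def sum_divide_distrib[symmetric] times_divide_eq_right)
  finally show ?thesis using s(1) by (simp add: field_simps s_def)
qed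

text \<open>Khinchine is applied in each coordinate \<open>w\<close>. The l2 sum over
  \<open>i\<close> and the l1 sum over \<open>w\<close> are exchanged by duality: \<open>S^2\<close>
  is the pairing of the values |z i w| with the vector of norms \<open>s\<close>, and Cauchy-Schwarz
  in \<open>i\<close> leaves one factor \<open>S\<close>, which cancels.\<close>

lemma l1_cotype:
  fixes z :: "nat \<Rightarrow> 'w \<Rightarrow> real"
  assumes W: "finite W"
  shows "(1 - exp (- 1/4))\<^sup>2 * 2 ^ n * (\<Sum>i<n. (\<Sum>w\<in>W. \<bar>z i w\<bar>)\<^sup>2)
    \<le> (\<Sum>\<epsilon>\<in>signs n. (\<Sum>w\<in>W. \<bar>\<Sum>i<n. \<epsilon> i * z i w\<bar>)\<^sup>2)"
proof -
  define \<kappa> :: real where "\<kappa> = 1 - exp (- 1/4)"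
  have \<kappa>: "\<kappa> \<ge> 0" by (simp add: \<kappa>_def)
  define s where "s i = (\<Sum>w\<in>W. \<bar>z i w\<bar>)" for i
  define S where "S = sqrt (\<Sum>i<n. (s i)\<^sup>2)"
  define A where "A = (\<Sum>\<epsilon>\<in>signs n. \<Sum>w\<in>W. \<bar>\<Sum>i<n. \<epsilon> i * z i w\<bar>)"
  have S2: "S\<^sup>2 = (\<Sum>i<n. (s i)\<^sup>2)" by (simp add: S_def sum_nonneg)
  have S0: "S \<ge> 0" by (simp add: S_def sum_nonneg)
  have "\<kappa> * 2 ^ n * S\<^sup>2 = \<kappa> * 2 ^ n * (\<Sum>w\<in>W. \<Sum>i<n. \<bar>z i w\<bar> * s i)"
    unfolding S2 by (subst sum.swap) (simp add: power2_eq_square s_def sum_distrib_right)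
  also have "\<dots> \<le> \<kappa> * 2 ^ n * (\<Sum>w\<in>W. sqrt (\<Sum>i<n. (z i w)\<^sup>2) * S)"
  proof (intro mult_left_mono sum_mono)
    fix w
    have "(\<Sum>i<n. \<bar>z i w\<bar> * s i) \<le> (\<Sum>i<n. \<bar>z i w\<bar> * \<bar>s i\<bar>)"
      by (intro sum_mono mult_left_mono) auto
    also have "\<dots> \<le> L2_set (\<lambda>i. z i w) {..<n} * L2_set s {..<n}"
      by (rule L2_set_mult_ineq)
    finally show "(\<Sum>i<n. \<bar>z i w\<bar> * s i) \<le> sqrt (\<Sum>i<n. (z i w)\<^sup>2) * S"
      by (simp add: L2_set_def S_def)
  qed (use \<kappa> in auto)
  also have "\<dots> = (\<Sum>w\<in>W. \<kappa> * 2 ^ n * sqrt (\<Sum>i<n. (z i w)\<^sup>2)) * S"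
    by (simp add: sum_distrib_left sum_distrib_right mult.assoc)
  also have "\<dots> \<le> (\<Sum>w\<in>W. \<Sum>\<epsilon>\<in>signs n. \<bar>\<Sum>i<n. \<epsilon> i * z i w\<bar>) * S"
    using khinchine S0 unfolding \<kappa>_def by (intro mult_right_mono sum_mono)
  also have "\<dots> = A * S" unfolding A_def by (subst sum.swap) simp
  finally have "\<kappa> * 2 ^ n * S \<le> A \<or> S = 0"
    using S0 by (auto simp: power2_eq_square mult.assoc[symmetric])
  moreover have A0: "A \<ge> 0" by (simp add: A_def sum_nonneg)
  ultimately have "\<kappa> * 2 ^ n * S \<le> A" by auto
  then have "(\<kappa> * 2 ^ n * S)\<^sup>2 \<le> A\<^sup>2" using \<kappa> S0 by (intro power_mono) auto
  also have "A\<^sup>2 \<le> 2 ^ n * (\<Sum>\<epsilon>\<in>signs n. (\<Sum>w\<in>W. \<bar>\<Sum>i<n. \<epsilon> i * z i w\<bar>)\<^sup>2)"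
    using Cauchy_Schwarz_ineq_sum[of "\<lambda>_. 1" "\<lambda>\<epsilon>. \<Sum>w\<in>W. \<bar>\<Sum>i<n. \<epsilon> i * z i w\<bar>" "signs n"]
    by (simp add: A_def card_signs)
  finally show ?thesis
    by (simp add: power_mult_distrib power2_eq_square[of "2^n"] S2 \<kappa>_def s_def)
qed

section \<open>Walsh functions and multipliers on the discrete cube\<close>

definition walsh :: "nat set \<Rightarrow> (nat \<Rightarrow> real) \<Rightarrow> real"
  where "walsh A \<epsilon> = (\<Prod>i\<in>A. \<epsilon> i)"

lemma sign_cases: "\<epsilon> \<in> signs n \<Longrightarrow> i < n \<Longrightarrow> \<epsilon> i \<in> {-1, 1}"
  by (erule PiE_mem) simp

lemma sign_square: "\<epsilon> \<in> signs n \<Longrightarrow> i < n \<Longrightarrow> \<epsilon> i * \<epsilon> i = 1"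
  by (drule (1) sign_cases) auto

lemma sum_signs_prod:
  "(\<Sum>\<epsilon>\<in>signs n. \<Prod>i<n. f i (\<epsilon> i)) = (\<Prod>i<n. f i (-1) + f i 1)" for f :: "nat \<Rightarrow> real \<Rightarrow> real"
  proof -
  have "(\<Prod>i<n. \<Sum>s\<in>{-1,1}. f i s) = (\<Sum>\<epsilon>\<in>signs n. \<Prod>i<n. f i (\<epsilon> i))"
    by (rule prod_sum_PiE) auto
  then show ?thesis by simp
qed

lemma walsh_alt: "A \<subseteq> {..<n} \<Longrightarrow> walsh A \<epsilon> = (\<Prod>i<n. if i \<in> A then \<epsilon> i else 1)"
  by (simp add: walsh_def prod.If_cases Int_absorb1)

lemma walsh_orthogonal:
  assumes "A \<subseteq> {..<n}" "B \<subseteq> {..<n}"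
  shows "(\<Sum>\<epsilon>\<in>signs n. walsh A \<epsilon> * walsh B \<epsilon>) = (if A = B then 2 ^ n else 0)"
proof -
  have "(\<Sum>\<epsilon>\<in>signs n. walsh A \<epsilon> * walsh B \<epsilon>)
      = (\<Sum>\<epsilon>\<in>signs n. \<Prod>i<n. (if i \<in> A then \<epsilon> i else 1) * (if i \<in> B then \<epsilon> i else 1))"
    using assms by (simp add: walsh_alt[where n=n] prod.distrib)
  also have "\<dots> = (\<Prod>i<n. (if i \<in> A then -1 else 1) * (if i \<in> B then -1 else 1) + (1::real))"
    by (subst sum_signs_prod[where f="\<lambda>i s. (if i \<in> A then s else 1) * (if i \<in> B then s else 1)"])
       (intro prod.cong, auto)
  also have "\<dots> = (if A = B then 2 ^ n else 0)"
  proof (cases "A = B")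
    case False
    then obtain i where "i < n" "(i \<in> A) \<noteq> (i \<in> B)" using assms by blast
    then have "\<exists>i\<in>{..<n}. (if i \<in> A then -1 else 1) * (if i \<in> B then -1 else 1) + (1::real) = 0"
      by (intro bexI[of _ i]) auto
    then show ?thesis using False by (simp add: prod_zero_iff)
  next
    case True
    then have "(\<Prod>i<n. (if i \<in> A then -1 else 1) * (if i \<in> B then -1 else 1) + (1::real)) = (\<Prod>i<n. 2)"
      by (intro prod.cong) auto
    then show ?thesis using True by simp
  qed
  finally show ?thesis .
qed

lemma riesz_product_expansion:
  "(\<Prod>i<n. 1 + t * \<epsilon> i * \<epsilon>' i) = (\<Sum>A\<in>Pow {..<n}. t ^ card A * walsh A \<epsilon> * walsh A \<epsilon>')" for t :: real
proof -
  have "(\<Prod>i<n. 1 + t * \<epsilon> i * \<epsilon>' i) = (\<Prod>i<n. t * \<epsilon> i * \<epsilon>' i + 1)" by (simp add: add.commute)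
  also have "\<dots> = (\<Sum>A\<in>Pow {..<n}. (\<Prod>i\<in>A. t * \<epsilon> i * \<epsilon>' i))"
    by (subst prod_add) auto
  finally show ?thesis by (simp add: walsh_def prod.distrib)
qed

text \<open>The Riesz product at \<open>t = 1\<close>: one index with different signs makes a factor
  vanish.\<close>

lemma signs_kernel_delta:
  assumes "\<epsilon> \<in> signs n" "\<epsilon>' \<in> signs n"
  shows "(\<Sum>A\<in>Pow {..<n}. walsh A \<epsilon> * walsh A \<epsilon>') = (if \<epsilon> = \<epsilon>' then 2 ^ n else 0)"
proof -
  have "(\<Sum>A\<in>Pow {..<n}. walsh A \<epsilon> * walsh A \<epsilon>') = (\<Prod>i<n. 1 + \<epsilon> i * \<epsilon>' i)"
    using riesz_product_expansion[where t=1 and n=n and \<epsilon>=\<epsilon> and \<epsilon>'=\<epsilon>'] by simp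
  also have "\<dots> = (if \<epsilon> = \<epsilon>' then 2 ^ n else 0)"
  proof (cases "\<epsilon> = \<epsilon>'")
    case True
    then have "(\<Prod>i<n. 1 + \<epsilon> i * \<epsilon>' i) = (\<Prod>i<n. 2)"
      using assms sign_square[OF assms(1)] by (intro prod.cong) auto
    then show ?thesis using True by simp
  next
    case False
    then obtain i where "i < n" "\<epsilon> i \<noteq> \<epsilon>' i"
      using assms by (metis PiE_ext lessThan_iff)
    moreover have "\<epsilon> i \<in> {-1,1}" "\<epsilon>' i \<in> {-1,1}" using assms sign_cases \<open>i < n\<close> by blast+
    ultimately have "\<exists>i\<in>{..<n}. 1 + \<epsilon> i * \<epsilon>' i = 0" by (intro bexI[of _ i]) auto
    then show ?thesis using False by (simp add: prod_zero_iff)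
  qed
  finally show ?thesis .
qed

definition walsh_coeff :: "nat \<Rightarrow> ((nat \<Rightarrow> real) \<Rightarrow> real) \<Rightarrow> nat set \<Rightarrow> real"
  where "walsh_coeff n \<phi> A = (\<Sum>\<epsilon>\<in>signs n. \<phi> \<epsilon> * walsh A \<epsilon>) / 2 ^ n"

text \<open>A kernel of this form acts as the Fourier multiplier \<open>m\<close>. The identity,
  \<open>odd_riesz\<close> and \<open>rad_proj\<close> are all brought to this form, so that they
  can be compared order by order.\<close>

lemma walsh_kernel_apply:
  "(\<Sum>\<epsilon>'\<in>signs n. (\<Sum>A\<in>\<A>. m A * walsh A \<epsilon> * walsh A \<epsilon>') / 2 ^ n * \<phi> \<epsilon>')
    = (\<Sum>A\<in>\<A>. m A * walsh_coeff n \<phi> A * walsh A \<epsilon>)"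
proof -
  have "(\<Sum>\<epsilon>'\<in>signs n. (\<Sum>A\<in>\<A>. m A * walsh A \<epsilon> * walsh A \<epsilon>') / 2 ^ n * \<phi> \<epsilon>')
      = (\<Sum>\<epsilon>'\<in>signs n. \<Sum>A\<in>\<A>. m A * walsh A \<epsilon> * (\<phi> \<epsilon>' * walsh A \<epsilon>' / 2 ^ n))"
    unfolding sum_divide_distrib sum_distrib_right by (intro sum.cong refl) simp
  also have "\<dots> = (\<Sum>A\<in>\<A>. \<Sum>\<epsilon>'\<in>signs n. m A * walsh A \<epsilon> * (\<phi> \<epsilon>' * walsh A \<epsilon>' / 2 ^ n))"
    by (rule sum.swap)
  also have "\<dots> = (\<Sum>A\<in>\<A>. m A * walsh_coeff n \<phi> A * walsh A \<epsilon>)"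
    by (simp add: walsh_coeff_def sum_distrib_left sum_divide_distrib mult_ac)
  finally show ?thesis .
qed

lemma walsh_inversion:
  assumes "\<epsilon> \<in> signs n"
  shows "\<phi> \<epsilon> = (\<Sum>A\<in>Pow {..<n}. walsh_coeff n \<phi> A * walsh A \<epsilon>)"
proof -
  have "(\<Sum>A\<in>Pow {..<n}. walsh_coeff n \<phi> A * walsh A \<epsilon>)
      = (\<Sum>\<epsilon>'\<in>signs n. (\<Sum>A\<in>Pow {..<n}. walsh A \<epsilon> * walsh A \<epsilon>') / 2 ^ n * \<phi> \<epsilon>')"
    using walsh_kernel_apply[where m="\<lambda>_. 1" and \<epsilon>=\<epsilon> and \<A>="Pow {..<n}" and \<phi>=\<phi> and n=n] by simp
  also have "\<dots> = (\<Sum>\<epsilon>'\<in>signs n. if \<epsilon> = \<epsilon>' then \<phi> \<epsilon>' else 0)"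
    using assms by (intro sum.cong) (auto simp: signs_kernel_delta)
  also have "\<dots> = \<phi> \<epsilon>" using assms by simp
  finally show ?thesis by simp
qed

lemma walsh_parseval:
  "(\<Sum>\<epsilon>\<in>signs n. (\<Sum>A\<in>Pow {..<n}. c A * walsh A \<epsilon>)\<^sup>2) = 2 ^ n * (\<Sum>A\<in>Pow {..<n}. (c A)\<^sup>2)"
proof -
  have "(\<Sum>\<epsilon>\<in>signs n. (\<Sum>A\<in>Pow {..<n}. c A * walsh A \<epsilon>)\<^sup>2)
      = (\<Sum>\<epsilon>\<in>signs n. \<Sum>A\<in>Pow {..<n}. \<Sum>B\<in>Pow {..<n}. c A * c B * (walsh A \<epsilon> * walsh B \<epsilon>))"
    by (simp add: power2_eq_square sum_product mult_ac)
  also have "\<dots> = (\<Sum>A\<in>Pow {..<n}. \<Sum>\<epsilon>\<in>signs n. \<Sum>B\<in>Pow {..<n}. c A * c B * (walsh A \<epsilon> * walsh B \<epsilon>))"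
    by (rule sum.swap)
  also have "\<dots> = (\<Sum>A\<in>Pow {..<n}. \<Sum>B\<in>Pow {..<n}. \<Sum>\<epsilon>\<in>signs n. c A * c B * (walsh A \<epsilon> * walsh B \<epsilon>))"
    by (intro sum.cong refl sum.swap)
  also have "\<dots> = (\<Sum>A\<in>Pow {..<n}. \<Sum>B\<in>Pow {..<n}. if A = B then c A * c B * 2 ^ n else 0)"
    by (intro sum.cong refl) (simp add: sum_distrib_left[symmetric] walsh_orthogonal)
  also have "\<dots> = 2 ^ n * (\<Sum>A\<in>Pow {..<n}. (c A)\<^sup>2)"
    by (simp add: sum.delta power2_eq_square sum_distrib_left mult_ac)
  finally show ?thesis .
qed

text \<open>\<open>odd_riesz t\<close> is the difference of the averaging kernels \<open>\<Prod>(1 \<plusminus> t \<epsilon>\<^sub>i \<epsilon>'\<^sub>i)\<close>, normalized so that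
  it fixes Rademacher sums; on Walsh functions of odd order \<open>m\<close> it multiplies by \<open>t\<^sup>m\<^sup>-\<^sup>1\<close>.\<close>

definition riesz :: "nat \<Rightarrow> real \<Rightarrow> (nat \<Rightarrow> real) \<Rightarrow> (nat \<Rightarrow> real) \<Rightarrow> real"
  where "riesz n t \<epsilon> \<epsilon>' = (\<Prod>i<n. 1 + t * \<epsilon> i * \<epsilon>' i) / 2 ^ n"

definition odd_riesz :: "nat \<Rightarrow> real \<Rightarrow> (nat \<Rightarrow> real) \<Rightarrow> (nat \<Rightarrow> real) \<Rightarrow> real"
  where "odd_riesz n t \<epsilon> \<epsilon>' = (riesz n t \<epsilon> \<epsilon>' - riesz n (- t) \<epsilon> \<epsilon>') / (2 * t)"

text \<open>Kernel of the Rademacher projection. On square integrable functions with values in l1 it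
  is not bounded uniformly in the dimension, since l1 is not K-convex; hence the detour through
  \<open>odd_riesz\<close>.\<close>

definition rad_proj :: "nat \<Rightarrow> (nat \<Rightarrow> real) \<Rightarrow> (nat \<Rightarrow> real) \<Rightarrow> real"
  where "rad_proj n \<epsilon> \<epsilon>' = (\<Sum>i<n. \<epsilon> i * \<epsilon>' i) / 2 ^ n"

lemma riesz_nonneg:
  assumes "\<bar>t\<bar> \<le> 1" "\<epsilon> \<in> signs n" "\<epsilon>' \<in> signs n"
  shows "0 \<le> riesz n t \<epsilon> \<epsilon>'"
proof -
  have "0 \<le> 1 + t * \<epsilon> i * \<epsilon>' i" if "i < n" for i
  proof -
    from sign_cases[OF assms(2) that] sign_cases[OF assms(3) that]
    show ?thesis using assms(1) by auto
  qed
  then show ?thesis unfolding riesz_def by (intro divide_nonneg_pos prod_nonneg) auto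
qed

lemma riesz_commute: "riesz n t \<epsilon> \<epsilon>' = riesz n t \<epsilon>' \<epsilon>"
  by (simp add: riesz_def mult_ac)

lemma sum_riesz:
  "(\<Sum>\<epsilon>'\<in>signs n. riesz n t \<epsilon> \<epsilon>') = 1"
proof -
  have "(\<Sum>\<epsilon>'\<in>signs n. riesz n t \<epsilon> \<epsilon>') = (\<Sum>\<epsilon>'\<in>signs n. \<Prod>i<n. 1 + t * \<epsilon> i * \<epsilon>' i) / 2 ^ n"
    by (simp add: riesz_def sum_divide_distrib)
  also have "(\<Sum>\<epsilon>'\<in>signs n. \<Prod>i<n. 1 + t * \<epsilon> i * \<epsilon>' i) = (\<Prod>i<n. 2)"
    by (subst sum_signs_prod[where f="\<lambda>i s. 1 + t * \<epsilon> i * s"]) simp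
  finally show ?thesis by simp
qed

text \<open>On signs the kernel is nonnegative and symmetric with row sums 1. Convexity of the
  square, in the form of Cauchy-Schwarz with the weight split into square roots, bounds each row;
  symmetry then gives column sums 1.\<close>

lemma riesz_contraction:
  fixes F :: "(nat \<Rightarrow> real) \<Rightarrow> 'w \<Rightarrow> real"
  assumes "\<bar>t\<bar> \<le> 1"
  shows "(\<Sum>\<epsilon>\<in>signs n. (\<Sum>w\<in>W. \<bar>\<Sum>\<epsilon>'\<in>signs n. riesz n t \<epsilon> \<epsilon>' * F \<epsilon>' w\<bar>)\<^sup>2)
    \<le> (\<Sum>\<epsilon>\<in>signs n. (\<Sum>w\<in>W. \<bar>F \<epsilon> w\<bar>)\<^sup>2)"
proof -
  define f where "f \<epsilon> = (\<Sum>w\<in>W. \<bar>F \<epsilon> w\<bar>)" for \<epsilon>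
  have "(\<Sum>w\<in>W. \<bar>\<Sum>\<epsilon>'\<in>signs n. riesz n t \<epsilon> \<epsilon>' * F \<epsilon>' w\<bar>)\<^sup>2
      \<le> (\<Sum>\<epsilon>'\<in>signs n. riesz n t \<epsilon> \<epsilon>' * (f \<epsilon>')\<^sup>2)" if e: "\<epsilon> \<in> signs n" for \<epsilon>
  proof -
    have r0: "0 \<le> riesz n t \<epsilon> \<epsilon>'" if "\<epsilon>' \<in> signs n" for \<epsilon>'
      using riesz_nonneg assms e that by blast
    have "(\<Sum>w\<in>W. \<bar>\<Sum>\<epsilon>'\<in>signs n. riesz n t \<epsilon> \<epsilon>' * F \<epsilon>' w\<bar>)
        \<le> (\<Sum>w\<in>W. \<Sum>\<epsilon>'\<in>signs n. riesz n t \<epsilon> \<epsilon>' * \<bar>F \<epsilon>' w\<bar>)"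
      by (intro sum_mono order_trans[OF sum_abs]) (auto simp: abs_mult r0)
    also have "\<dots> = (\<Sum>\<epsilon>'\<in>signs n. riesz n t \<epsilon> \<epsilon>' * f \<epsilon>')"
      by (subst sum.swap) (simp add: f_def sum_distrib_left)
    finally have "(\<Sum>w\<in>W. \<bar>\<Sum>\<epsilon>'\<in>signs n. riesz n t \<epsilon> \<epsilon>' * F \<epsilon>' w\<bar>)\<^sup>2
        \<le> (\<Sum>\<epsilon>'\<in>signs n. riesz n t \<epsilon> \<epsilon>' * f \<epsilon>')\<^sup>2"
      by (intro power_mono) (auto intro: sum_nonneg)
    also have "\<dots> = (\<Sum>\<epsilon>'\<in>signs n. sqrt (riesz n t \<epsilon> \<epsilon>') * (sqrt (riesz n t \<epsilon> \<epsilon>') * f \<epsilon>'))\<^sup>2"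
      using r0 by (simp add: mult.assoc[symmetric])
    also have "\<dots> \<le> (\<Sum>\<epsilon>'\<in>signs n. (sqrt (riesz n t \<epsilon> \<epsilon>'))\<^sup>2) * (\<Sum>\<epsilon>'\<in>signs n. (sqrt (riesz n t \<epsilon> \<epsilon>') * f \<epsilon>')\<^sup>2)"
      by (rule Cauchy_Schwarz_ineq_sum)
    also have "\<dots> = (\<Sum>\<epsilon>'\<in>signs n. riesz n t \<epsilon> \<epsilon>' * (f \<epsilon>')\<^sup>2)"
      using r0 sum_riesz[of n t \<epsilon>] by (simp add: power_mult_distrib)
    finally show ?thesis .
  qed
  then have "(\<Sum>\<epsilon>\<in>signs n. (\<Sum>w\<in>W. \<bar>\<Sum>\<epsilon>'\<in>signs n. riesz n t \<epsilon> \<epsilon>' * F \<epsilon>' w\<bar>)\<^sup>2)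
      \<le> (\<Sum>\<epsilon>\<in>signs n. \<Sum>\<epsilon>'\<in>signs n. riesz n t \<epsilon> \<epsilon>' * (f \<epsilon>')\<^sup>2)"
    by (rule sum_mono)
  also have "\<dots> = (\<Sum>\<epsilon>'\<in>signs n. (\<Sum>\<epsilon>\<in>signs n. riesz n t \<epsilon>' \<epsilon>) * (f \<epsilon>')\<^sup>2)"
    by (subst sum.swap) (simp add: sum_distrib_right riesz_commute)
  also have "\<dots> = (\<Sum>\<epsilon>'\<in>signs n. (f \<epsilon>')\<^sup>2)" by (simp add: sum_riesz)
  finally show ?thesis by (simp add: f_def)
qed

lemma square_add_le: "(a + b)\<^sup>2 \<le> 2 * a\<^sup>2 + 2 * b\<^sup>2" for a b :: real
  using zero_le_power2[of "a - b"] by (simp add: power2_eq_square algebra_simps)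

text \<open>A difference of two contractions divided by \<open>2 * t\<close>. The price of a small
  \<open>t\<close> is the factor 1 / t^2.\<close>

lemma odd_riesz_bound:
  fixes F :: "(nat \<Rightarrow> real) \<Rightarrow> 'w \<Rightarrow> real"
  assumes t: "0 < t" "t \<le> 1"
  shows "(\<Sum>\<epsilon>\<in>signs n. (\<Sum>w\<in>W. \<bar>\<Sum>\<epsilon>'\<in>signs n. odd_riesz n t \<epsilon> \<epsilon>' * F \<epsilon>' w\<bar>)\<^sup>2)
    \<le> (\<Sum>\<epsilon>\<in>signs n. (\<Sum>w\<in>W. \<bar>F \<epsilon> w\<bar>)\<^sup>2) / t\<^sup>2"
proof -
  define R where "R s \<epsilon> w = (\<Sum>\<epsilon>'\<in>signs n. riesz n s \<epsilon> \<epsilon>' * F \<epsilon>' w)" for s \<epsilon> w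
  define S where "S = (\<Sum>\<epsilon>\<in>signs n. (\<Sum>w\<in>W. \<bar>F \<epsilon> w\<bar>)\<^sup>2)"
  have eq: "(\<Sum>\<epsilon>'\<in>signs n. odd_riesz n t \<epsilon> \<epsilon>' * F \<epsilon>' w) = (R t \<epsilon> w - R (- t) \<epsilon> w) / (2 * t)" for \<epsilon> w
    by (simp add: R_def odd_riesz_def sum_subtractf[symmetric] sum_divide_distrib algebra_simps)
  have half: "(2 * a + 2 * b) / (2 * t)\<^sup>2 = (a + b) / (2 * t\<^sup>2)" for a b
    using t(1) by (simp add: power2_eq_square field_simps)
  have "(\<Sum>w\<in>W. \<bar>\<Sum>\<epsilon>'\<in>signs n. odd_riesz n t \<epsilon> \<epsilon>' * F \<epsilon>' w\<bar>)\<^sup>2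
     \<le> ((\<Sum>w\<in>W. \<bar>R t \<epsilon> w\<bar>)\<^sup>2 + (\<Sum>w\<in>W. \<bar>R (-t) \<epsilon> w\<bar>)\<^sup>2) / (2 * t\<^sup>2)" for \<epsilon>
  proof -
    have "(\<Sum>w\<in>W. \<bar>(R t \<epsilon> w - R (- t) \<epsilon> w) / (2 * t)\<bar>) \<le> (\<Sum>w\<in>W. (\<bar>R t \<epsilon> w\<bar> + \<bar>R (-t) \<epsilon> w\<bar>) / (2 * t))"
      using t(1) by (intro sum_mono) (auto simp: abs_mult divide_right_mono)
    also have "\<dots> = ((\<Sum>w\<in>W. \<bar>R t \<epsilon> w\<bar>) + (\<Sum>w\<in>W. \<bar>R (-t) \<epsilon> w\<bar>)) / (2 * t)"
      by (simp add: sum_divide_distrib[symmetric] sum.distrib)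
    finally have "(\<Sum>w\<in>W. \<bar>(R t \<epsilon> w - R (- t) \<epsilon> w) / (2 * t)\<bar>)\<^sup>2
      \<le> (((\<Sum>w\<in>W. \<bar>R t \<epsilon> w\<bar>) + (\<Sum>w\<in>W. \<bar>R (-t) \<epsilon> w\<bar>)) / (2 * t))\<^sup>2"
      by (intro power_mono) (auto intro: sum_nonneg)
    also have "\<dots> \<le> (2 * (\<Sum>w\<in>W. \<bar>R t \<epsilon> w\<bar>)\<^sup>2 + 2 * (\<Sum>w\<in>W. \<bar>R (-t) \<epsilon> w\<bar>)\<^sup>2) / (2 * t)\<^sup>2"
      unfolding power_divide by (intro divide_right_mono square_add_le) auto
    also have "\<dots> = ((\<Sum>w\<in>W. \<bar>R t \<epsilon> w\<bar>)\<^sup>2 + (\<Sum>w\<in>W. \<bar>R (-t) \<epsilon> w\<bar>)\<^sup>2) / (2 * t\<^sup>2)"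
      using half by simp
    finally show ?thesis unfolding eq .
  qed
  then have "(\<Sum>\<epsilon>\<in>signs n. (\<Sum>w\<in>W. \<bar>\<Sum>\<epsilon>'\<in>signs n. odd_riesz n t \<epsilon> \<epsilon>' * F \<epsilon>' w\<bar>)\<^sup>2)
     \<le> (\<Sum>\<epsilon>\<in>signs n. ((\<Sum>w\<in>W. \<bar>R t \<epsilon> w\<bar>)\<^sup>2 + (\<Sum>w\<in>W. \<bar>R (-t) \<epsilon> w\<bar>)\<^sup>2) / (2 * t\<^sup>2))"
    by (rule sum_mono)
  also have "\<dots> = ((\<Sum>\<epsilon>\<in>signs n. (\<Sum>w\<in>W. \<bar>R t \<epsilon> w\<bar>)\<^sup>2) + (\<Sum>\<epsilon>\<in>signs n. (\<Sum>w\<in>W. \<bar>R (-t) \<epsilon> w\<bar>)\<^sup>2)) / (2 * t\<^sup>2)"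
    by (simp add: sum_divide_distrib[symmetric] sum.distrib)
  also have "\<dots> \<le> (S + S) / (2 * t\<^sup>2)"
    unfolding S_def R_def using t
    by (intro divide_right_mono add_mono riesz_contraction) auto
  also have "\<dots> = S / t\<^sup>2" by simp
  finally show ?thesis by (simp add: S_def)
qed

lemma odd_riesz_expansion:
  assumes "0 < t"
  shows "odd_riesz n t \<epsilon> \<epsilon>'
    = (\<Sum>A\<in>Pow {..<n}. (if odd (card A) then t ^ (card A - 1) else 0) * walsh A \<epsilon> * walsh A \<epsilon>') / 2 ^ n"
proof -
  have eq: "odd_riesz n t \<epsilon> \<epsilon>' = (\<Sum>A\<in>Pow {..<n}. (t ^ card A - (- t) ^ card A) / (2 * t) * walsh A \<epsilon> * walsh A \<epsilon>') / 2 ^ n"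
    unfolding odd_riesz_def riesz_def riesz_product_expansion
    by (simp add: sum_subtractf[symmetric] sum_divide_distrib algebra_simps diff_divide_distrib)
  have "(t ^ card A - (- t) ^ card A) / (2 * t) = (if odd (card A) then t ^ (card A - 1) else 0)" for A :: "nat set"
  proof (cases "odd (card A)")
    case True
    then obtain m where m: "card A = Suc m" by (metis odd_pos gr0_implies_Suc)
    then have "(- t) ^ card A = - (t ^ card A)" using True by (metis power_minus_odd)
    then show ?thesis using True m assms by simp
  qed auto
  then show ?thesis by (simp only: eq)
qed

lemma rad_proj_expansion:
  "rad_proj n \<epsilon> \<epsilon>'
    = (\<Sum>A\<in>Pow {..<n}. (if card A = 1 then 1 else 0) * walsh A \<epsilon> * walsh A \<epsilon>') / 2 ^ n"
proof -
  have "(\<Sum>A\<in>Pow {..<n}. (if card A = 1 then 1 else 0) * walsh A \<epsilon> * walsh A \<epsilon>')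
     = (\<Sum>A\<in>(\<lambda>i. {i}) ` {..<n}. walsh A \<epsilon> * walsh A \<epsilon>')"
    by (rule sum.mono_neutral_cong_right) (auto simp: card_1_singleton_iff)
  also have "\<dots> = (\<Sum>i<n. \<epsilon> i * \<epsilon>' i)"
    by (subst sum.reindex) (auto simp: walsh_def inj_on_def)
  finally show ?thesis by (simp add: rad_proj_def)
qed

text \<open>The two multipliers agree at order 1 and vanish at even orders; at odd order m >= 3
  their difference is t^(m - 1) <= t^2, while the right-hand side has multiplier 1 there. Parseval
  concludes. This is a Hilbert space estimate and is later used coordinatewise in the
  kernel.\<close>

lemma odd_riesz_minus_rad_proj:
  assumes t: "0 < t" "t \<le> 1"
  shows "(\<Sum>\<epsilon>\<in>signs n. (\<Sum>\<epsilon>'\<in>signs n. (odd_riesz n t \<epsilon> \<epsilon>' - rad_proj n \<epsilon> \<epsilon>') * \<phi> \<epsilon>')\<^sup>2)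
    \<le> t ^ 4 * (\<Sum>\<epsilon>\<in>signs n. (\<phi> \<epsilon> - (\<Sum>\<epsilon>'\<in>signs n. rad_proj n \<epsilon> \<epsilon>' * \<phi> \<epsilon>'))\<^sup>2)"
proof -
  let ?P = "Pow {..<n}"
  define c where "c = walsh_coeff n \<phi>"
  define m :: "nat set \<Rightarrow> real" where "m A = (if odd (card A) then t ^ (card A - 1) else 0) - (if card A = 1 then 1 else 0)" for A
  define m' :: "nat set \<Rightarrow> real" where "m' A = 1 - (if card A = 1 then 1 else 0)" for A
  have rad: "(\<Sum>\<epsilon>'\<in>signs n. rad_proj n \<epsilon> \<epsilon>' * \<phi> \<epsilon>') = (\<Sum>A\<in>?P. (if card A = 1 then 1 else 0) * c A * walsh A \<epsilon>)" for \<epsilon>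
    unfolding rad_proj_expansion walsh_kernel_apply c_def ..
  have "(\<Sum>\<epsilon>'\<in>signs n. odd_riesz n t \<epsilon> \<epsilon>' * \<phi> \<epsilon>')
      = (\<Sum>A\<in>?P. (if odd (card A) then t ^ (card A - 1) else 0) * c A * walsh A \<epsilon>)" for \<epsilon>
    unfolding odd_riesz_expansion[OF t(1)] walsh_kernel_apply c_def ..
  then have 1: "(\<Sum>\<epsilon>'\<in>signs n. (odd_riesz n t \<epsilon> \<epsilon>' - rad_proj n \<epsilon> \<epsilon>') * \<phi> \<epsilon>') = (\<Sum>A\<in>?P. (m A * c A) * walsh A \<epsilon>)" for \<epsilon>
    using rad by (simp add: left_diff_distrib sum_subtractf m_def)
  have 2: "\<phi> \<epsilon> - (\<Sum>\<epsilon>'\<in>signs n. rad_proj n \<epsilon> \<epsilon>' * \<phi> \<epsilon>') = (\<Sum>A\<in>?P. (m' A * c A) * walsh A \<epsilon>)" if "\<epsilon> \<in> signs n" for \<epsilon>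
    unfolding rad by (subst walsh_inversion[OF that, of \<phi>])
      (simp add: m'_def c_def left_diff_distrib sum_subtractf)
  have "(m A)\<^sup>2 \<le> t ^ 4 * (m' A)\<^sup>2" for A
  proof (cases "odd (card A) \<and> card A \<noteq> 1")
    case True
    then have c3: "card A \<ge> 3" by presburger
    then have "t ^ (card A - 1) \<le> t ^ 2" using t by (intro power_decreasing) auto
    then have "(t ^ (card A - 1))\<^sup>2 \<le> (t ^ 2)\<^sup>2" using t by (intro power_mono) auto
    then show ?thesis using True by (simp add: m_def m'_def power_mult[symmetric])
  next
    case False
    then have "m A = 0" by (auto simp: m_def)
    then show ?thesis using t by simp
  qed
  then have "(m A)\<^sup>2 * (c A)\<^sup>2 \<le> (t ^ 4 * (m' A)\<^sup>2) * (c A)\<^sup>2" for A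
    by (intro mult_right_mono) auto
  then have "(m A * c A)\<^sup>2 \<le> t ^ 4 * (m' A * c A)\<^sup>2" for A
    by (simp only: power_mult_distrib mult.assoc)
  then have "2 ^ n * (\<Sum>A\<in>?P. (m A * c A)\<^sup>2) \<le> 2 ^ n * (\<Sum>A\<in>?P. t ^ 4 * (m' A * c A)\<^sup>2)"
    by (intro mult_left_mono sum_mono) auto
  then show ?thesis
    unfolding 1 walsh_parseval using 2 walsh_parseval[where n=n and c="\<lambda>A. m' A * c A"]
    by (simp add: sum_distrib_left mult_ac)
qed

lemma odd_riesz_fixes_sign:
  assumes t: "0 < t" and j: "j < n"
  shows "(\<Sum>\<epsilon>'\<in>signs n. odd_riesz n t \<epsilon> \<epsilon>' * \<epsilon>' j) = \<epsilon> j"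
proof -
  have c: "walsh_coeff n (\<lambda>\<epsilon>. \<epsilon> j) A = (if A = {j} then 1 else 0)" if "A \<subseteq> {..<n}" for A
    using walsh_orthogonal[of "{j}" n A] j that by (auto simp: walsh_coeff_def walsh_def)
  have "(\<Sum>\<epsilon>'\<in>signs n. odd_riesz n t \<epsilon> \<epsilon>' * \<epsilon>' j)
      = (\<Sum>A\<in>Pow {..<n}. (if odd (card A) then t ^ (card A - 1) else 0) * walsh_coeff n (\<lambda>\<epsilon>. \<epsilon> j) A * walsh A \<epsilon>)"
    unfolding odd_riesz_expansion[OF t] walsh_kernel_apply ..
  also have "\<dots> = (\<Sum>A\<in>Pow {..<n}. if A = {j} then walsh A \<epsilon> else 0)"
    by (intro sum.cong) (auto simp: c)
  also have "\<dots> = \<epsilon> j" using j by (simp add: walsh_def)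
  finally show ?thesis .
qed

section \<open>Cotype of quotients with Hilbertian kernel\<close>

text \<open>The l1 norm, in dimension k + l, of the preimage of \<open>x\<close> whose last
  \<open>l\<close> coordinates are \<open>y\<close>; its first \<open>k\<close> coordinates are then
  forced to be (x - G y) / sqrt k.\<close>

definition quot_cost :: "nat \<Rightarrow> nat \<Rightarrow> (nat \<Rightarrow> nat \<Rightarrow> real) \<Rightarrow> (nat \<Rightarrow> real) \<Rightarrow> (nat \<Rightarrow> real) \<Rightarrow> real"
  where "quot_cost k l G x y =
    (\<Sum>i<k. \<bar>x i - (\<Sum>j<l. G i j * y j)\<bar>) / sqrt k + (\<Sum>j<l. \<bar>y j\<bar>)"

text \<open>The quotient of \<open>\<ell>\<^sub>1\<^sup>k\<^sup>+\<^sup>l\<close> whose unit ball is the absolutely convex hull of the vectors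
  \<open>\<surd>k e\<^sub>i\<close> and the columns of \<open>G\<close>.\<close>

definition quot_norm :: "nat \<Rightarrow> nat \<Rightarrow> (nat \<Rightarrow> nat \<Rightarrow> real) \<Rightarrow> (nat \<Rightarrow> real) \<Rightarrow> real"
  where "quot_norm k l G x = (INF y. quot_cost k l G x y)"

definition l2 :: "nat \<Rightarrow> (nat \<Rightarrow> real) \<Rightarrow> real"
  where "l2 n y = sqrt (\<Sum>j<n. (y j)\<^sup>2)"

definition mat_vec :: "nat \<Rightarrow> (nat \<Rightarrow> nat \<Rightarrow> real) \<Rightarrow> (nat \<Rightarrow> real) \<Rightarrow> nat \<Rightarrow> real"
  where "mat_vec l G y i = (\<Sum>j<l. G i j * y j)"

definition entries_le_1 :: "nat \<Rightarrow> nat \<Rightarrow> (nat \<Rightarrow> nat \<Rightarrow> real) \<Rightarrow> bool"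
  where "entries_le_1 k l G \<longleftrightarrow> (\<forall>i<k. \<forall>j<l. \<bar>G i j\<bar> \<le> 1)"

text \<open>The upper and the lower estimate say that the kernel of the quotient map is Hilbertian.\<close>

definition l1_euclidean :: "real \<Rightarrow> real \<Rightarrow> nat \<Rightarrow> nat \<Rightarrow> (nat \<Rightarrow> nat \<Rightarrow> real) \<Rightarrow> bool"
  where "l1_euclidean a b k l G \<longleftrightarrow>
    (\<forall>y. a * k * l2 l y \<le> (\<Sum>i<k. \<bar>mat_vec l G y i\<bar>) \<and> (\<Sum>i<k. \<bar>mat_vec l G y i\<bar>) \<le> b * k * l2 l y)"

lemma l2_nonneg [simp]: "0 \<le> l2 n y"
  by (simp add: l2_def sum_nonneg)

lemma l2_square: "(l2 n y)\<^sup>2 = (\<Sum>j<n. (y j)\<^sup>2)"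
  by (simp add: l2_def sum_nonneg)

lemma sum_abs_le_sqrt_l2: "(\<Sum>j<n. \<bar>y j\<bar>) \<le> sqrt n * l2 n y"
  using L2_set_mult_ineq[of "\<lambda>_. 1" y "{..<n}"] by (simp add: L2_set_def l2_def)

lemma quot_cost_nonneg [simp]: "0 \<le> quot_cost k l G x y"
  by (simp add: quot_cost_def sum_nonneg)

lemma bdd_below_quot_cost: "bdd_below (range (quot_cost k l G x))"
  by (rule bdd_belowI[of _ 0]) auto

lemma quot_norm_le_cost: "quot_norm k l G x \<le> quot_cost k l G x y"
  unfolding quot_norm_def by (rule cINF_lower[OF bdd_below_quot_cost]) simp

lemma quot_norm_nonneg: "0 \<le> quot_norm k l G x"
  unfolding quot_norm_def by (rule cINF_greatest) auto

lemma quot_norm_less_imp_cost: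
  assumes "quot_norm k l G x < c" obtains y where "quot_cost k l G x y < c"
  using assms cINF_less_iff[OF _ bdd_below_quot_cost] unfolding quot_norm_def by blast

lemma quot_norm_cong: "(\<And>i. i < k \<Longrightarrow> x i = x' i) \<Longrightarrow> quot_norm k l G x = quot_norm k l G x'"
  by (simp add: quot_norm_def quot_cost_def)

lemma quot_norm_add: "quot_norm k l G (\<lambda>i. x i + x' i) \<le> quot_norm k l G x + quot_norm k l G x'"
proof (rule field_le_epsilon)
  fix e :: real assume e: "0 < e"
  obtain y where y: "quot_cost k l G x y < quot_norm k l G x + e/2"
    using quot_norm_less_imp_cost[of k l G x "quot_norm k l G x + e/2"] e by auto
  obtain y' where y': "quot_cost k l G x' y' < quot_norm k l G x' + e/2"
    using quot_norm_less_imp_cost[of k l G x' "quot_norm k l G x' + e/2"] e by auto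
  let ?u = "\<lambda>i. x i - (\<Sum>j<l. G i j * y j)" and ?v = "\<lambda>i. x' i - (\<Sum>j<l. G i j * y' j)"
  have "quot_cost k l G (\<lambda>i. x i + x' i) (\<lambda>j. y j + y' j) 
      = (\<Sum>i<k. \<bar>?u i + ?v i\<bar>) / sqrt k + (\<Sum>j<l. \<bar>y j + y' j\<bar>)"
    by (simp add: quot_cost_def distrib_left sum.distrib algebra_simps)
  also have "\<dots> \<le> (\<Sum>i<k. \<bar>?u i\<bar> + \<bar>?v i\<bar>) / sqrt k + (\<Sum>j<l. \<bar>y j\<bar> + \<bar>y' j\<bar>)"
    by (intro add_mono divide_right_mono sum_mono abs_triangle_ineq) auto
  also have "\<dots> = quot_cost k l G x y + quot_cost k l G x' y'"
    by (simp add: quot_cost_def sum.distrib add_divide_distrib)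
  finally show "quot_norm k l G (\<lambda>i. x i + x' i) \<le> quot_norm k l G x + quot_norm k l G x' + e"
    using y y' quot_norm_le_cost[of k l G "\<lambda>i. x i + x' i" "\<lambda>j. y j + y' j"] by linarith
qed

lemma quot_cost_scale: "quot_cost k l G (\<lambda>i. c * x i) (\<lambda>j. c * y j) = \<bar>c\<bar> * quot_cost k l G x y"
proof -
  have "c * x i - (\<Sum>j<l. G i j * (c * y j)) = c * (x i - (\<Sum>j<l. G i j * y j))" for i
    by (simp add: algebra_simps sum_distrib_left)
  then show ?thesis
    by (simp add: quot_cost_def abs_mult sum_distrib_left[symmetric] distrib_left)
qed

lemma quot_norm_scale: "quot_norm k l G (\<lambda>i. c * x i) = \<bar>c\<bar> * quot_norm k l G x"
proof -
  have le: "quot_norm k l G (\<lambda>i. c * x i) \<le> \<bar>c\<bar> * quot_norm k l G x" for c x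
  proof (cases "c = 0")
    case True
    have "quot_norm k l G (\<lambda>i. 0) \<le> quot_cost k l G (\<lambda>i. 0) (\<lambda>i. 0)" by (rule quot_norm_le_cost)
    then show ?thesis using True by (simp add: quot_cost_def)
  next
    case False
    have "quot_norm k l G (\<lambda>i. c * x i) / \<bar>c\<bar> \<le> quot_norm k l G x"
      unfolding quot_norm_def[of k l G x]
    proof (rule cINF_greatest)
      fix y
      show "quot_norm k l G (\<lambda>i. c * x i) / \<bar>c\<bar> \<le> quot_cost k l G x y"
        using quot_norm_le_cost[of k l G "\<lambda>i. c * x i" "\<lambda>j. c * y j"] False
        by (simp add: quot_cost_scale divide_le_eq mult.commute)
    qed simp
    then show ?thesis using False by (simp add: divide_le_eq mult.commute)
  qed
  show ?thesis
  proof (cases "c = 0")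
    case True
    then show ?thesis using le[of 0 x] quot_norm_nonneg[of k l G "\<lambda>i. 0"] by simp
  next
    case False
    have "quot_norm k l G x \<le> \<bar>inverse c\<bar> * quot_norm k l G (\<lambda>i. c * x i)"
      using le[of "inverse c" "\<lambda>i. c * x i"] False by (simp add: mult.assoc[symmetric])
    then show ?thesis using le[of c x] False by (simp add: field_simps)
  qed
qed

text \<open>Every generator of the unit ball, \<open>sqrt k\<close> times a unit vector or a column
  of \<open>G\<close>, has coordinates at most \<open>sqrt k\<close>.\<close>

lemma quot_norm_coord:
  assumes "entries_le_1 k l G" "i < k"
  shows "\<bar>x i\<bar> \<le> sqrt k * quot_norm k l G x"
proof -
  have k: "real k \<ge> 1" using assms by simp
  have "\<bar>x i\<bar> / sqrt k \<le> quot_norm k l G x"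
    unfolding quot_norm_def
  proof (rule cINF_greatest)
    fix y
    have "\<bar>\<Sum>j<l. G i j * y j\<bar> \<le> (\<Sum>j<l. \<bar>G i j * y j\<bar>)" by (rule sum_abs)
    also have "\<dots> \<le> (\<Sum>j<l. \<bar>y j\<bar>)"
      using assms by (intro sum_mono) (auto simp: abs_mult entries_le_1_def intro!: mult_left_le_one_le)
    finally have "\<bar>x i\<bar> \<le> \<bar>x i - (\<Sum>j<l. G i j * y j)\<bar> + (\<Sum>j<l. \<bar>y j\<bar>)" by linarith
    also have "\<dots> \<le> (\<Sum>i<k. \<bar>x i - (\<Sum>j<l. G i j * y j)\<bar>) + (\<Sum>j<l. \<bar>y j\<bar>)"
      using assms(2) by (intro add_mono member_le_sum[of i]) auto
    also have "\<dots> \<le> sqrt k * quot_cost k l G x y"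
    proof -
      have "(\<Sum>j<l. \<bar>y j\<bar>) * 1 \<le> (\<Sum>j<l. \<bar>y j\<bar>) * sqrt k" using k by (intro mult_left_mono) (auto intro: sum_nonneg)
      then show ?thesis using k by (simp add: quot_cost_def algebra_simps)
    qed
    finally show "\<bar>x i\<bar> / sqrt k \<le> quot_cost k l G x y"
      using k by (simp add: divide_le_eq mult.commute)
  qed simp
  then show ?thesis using k by (simp add: divide_le_eq mult.commute)
qed

lemma quot_norm_le_l1: "quot_norm k l G x \<le> (\<Sum>i<k. \<bar>x i\<bar>) / sqrt k"
  using quot_norm_le_cost[of k l G x "\<lambda>_. 0"] by (simp add: quot_cost_def)

text \<open>A near-optimal lift \<open>F\<close> of a Rademacher sum is corrected by the odd Riesz averages: these are
  bounded on every \<open>L\<^sub>2(\<ell>\<^sub>1)\<close>, fix the Rademacher part, and are nearly zero on the remaining part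
  of \<open>F\<close>, which takes values in the Hilbertian kernel.\<close>

lemma quot_norm_cotype:
  fixes a b :: real
  assumes ab: "0 < a" "0 \<le> b"
  obtains C :: real where "C > 0"
    "\<And>k l G n x. l \<le> k \<Longrightarrow> entries_le_1 k l G \<Longrightarrow> l1_euclidean a b k l G \<Longrightarrow>
      2 ^ n * (\<Sum>i<n. (quot_norm k l G (x i))\<^sup>2)
      \<le> C * (\<Sum>\<epsilon>\<in>signs n. (quot_norm k l G (\<lambda>m. \<Sum>i<n. \<epsilon> i * x i m))\<^sup>2)"
proof -
  \<comment> \<open>\<open>r\<close> bounds the distortion of the kernel: its norm lies between
    \<open>a * sqrt k\<close> and \<open>(b + 1) * sqrt k\<close> times \<open>l2 l\<close>, the
    summand 1 being the share of the last \<open>l\<close> coordinates. \<open>t\<close> is small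
    enough for the term with 4 * r^2 * t^4 to be absorbed at the end.\<close>
  define r where "r = (b + 1) / a"
  have r: "r > 0" using ab by (simp add: r_def)
  define t where "t = min 1 (1 / (3 * r))"
  have t: "0 < t" "t \<le> 1" and t3: "3 * r * t \<le> 1"
    using r by (auto simp: t_def min_def field_simps)
  have rt: "4 * r\<^sup>2 * t ^ 4 \<le> 1/2"
  proof -
    have "t\<^sup>2 \<le> 1" using t by (simp add: power_le_one)
    then have "(3 * r * t)\<^sup>2 * t\<^sup>2 \<le> 1" 
      using t t3 r by (intro mult_le_one) (auto simp: power_le_one)
    moreover have "(3 * r * t)\<^sup>2 * t\<^sup>2 = 9 * (r\<^sup>2 * t ^ 4)" by (simp add: power2_eq_square power4_eq_xxxx)
    moreover have "0 \<le> r\<^sup>2 * t ^ 4" by simp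
    ultimately show ?thesis by linarith
  qed
  define \<kappa> :: real where "\<kappa> = (1 - exp (- 1/4))\<^sup>2"
  have \<kappa>: "\<kappa> > 0" by (simp add: \<kappa>_def)
  \<comment> \<open>The factors stem from the bound on \<open>H2\<close> below, from lifts that are
    optimal up to a factor 2, and from \<open>l1_cotype\<close>.\<close>
  define C where "C = 2 * (2 / t\<^sup>2 + 1/2) * 4 / \<kappa>"
  have C: "C > 0" using \<kappa> t by (auto simp: C_def intro!: divide_pos_pos mult_pos_pos add_pos_pos)
  have main: "2 ^ n * (\<Sum>i<n. (quot_norm k l G (x i))\<^sup>2)
      \<le> C * (\<Sum>\<epsilon>\<in>signs n. (quot_norm k l G (\<lambda>m. \<Sum>i<n. \<epsilon> i * x i m))\<^sup>2)"
    if lk: "l \<le> k" and ent: "entries_le_1 k l G" and euc: "l1_euclidean a b k l G" for k l G n x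
  proof (cases "k = 0")
    case True
    then have "quot_norm k l G z = 0" for z
      using quot_norm_le_l1[of k l G z] quot_norm_nonneg[of k l G z] by simp
    then show ?thesis by simp
  next
    case False
    then have k: "real k \<ge> 1" by simp
    define p where "p = quot_norm k l G"
    define X where "X \<epsilon> m = (\<Sum>i<n. \<epsilon> i * x i m)" for \<epsilon> :: "nat \<Rightarrow> real" and m :: nat
    \<comment> \<open>The infimum yields such a lift only if the quotient norm is positive.
      Otherwise \<open>X \<epsilon>\<close> vanishes on the first \<open>k\<close> coordinates and
      the zero lift is exact.\<close>
    have "\<exists>y. quot_cost k l G (X \<epsilon>) y \<le> 2 * p (X \<epsilon>)" for \<epsilon>
    proof (cases "p (X \<epsilon>) = 0")
      case True
      then have "X \<epsilon> i = 0" if "i < k" for i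
        using quot_norm_coord[OF ent that, of "X \<epsilon>"] by (simp add: p_def)
      then have "quot_cost k l G (X \<epsilon>) (\<lambda>_. 0) = 0" by (simp add: quot_cost_def)
      then show ?thesis using True by (metis mult_zero_right order_refl)
    next
      case False
      then have "p (X \<epsilon>) < 2 * p (X \<epsilon>)" using quot_norm_nonneg[of k l G "X \<epsilon>"] by (simp add: p_def)
      then show ?thesis unfolding p_def using quot_norm_less_imp_cost less_imp_le by metis
    qed
    then obtain y where y: "\<And>\<epsilon>. quot_cost k l G (X \<epsilon>) (y \<epsilon>) \<le> 2 * p (X \<epsilon>)" by metis
    \<comment> \<open>\<open>L u v\<close> is the point of l1 over \<open>u\<close> with last part
      \<open>v\<close>, linear in the pair.\<close>
    define W where "W = {..<k} <+> {..<l}"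
    define L where "L u v = case_sum (\<lambda>i. (u i - mat_vec l G v i) / sqrt k) v" for u v :: "nat \<Rightarrow> real"
    have cost: "quot_cost k l G u v = (\<Sum>w\<in>W. \<bar>L u v w\<bar>)" for u v
      by (simp add: quot_cost_def W_def sum.Plus L_def mat_vec_def sum_divide_distrib)
    have L_lin: "L (\<lambda>m. \<Sum>s\<in>I. c s * u s m) (\<lambda>j. \<Sum>s\<in>I. c s * v s j) w = (\<Sum>s\<in>I. c s * L (u s) (v s) w)"
      for I :: "'s set" and c u v w
    proof (cases w)
      case (Inl i)
      have "mat_vec l G (\<lambda>j. \<Sum>s\<in>I. c s * v s j) i = (\<Sum>s\<in>I. c s * mat_vec l G (v s) i)"
        unfolding mat_vec_def by (simp add: sum_distrib_left sum.swap[of _ I] mult_ac)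
      then show ?thesis using Inl
        by (simp add: L_def sum_subtractf[symmetric] sum_divide_distrib algebra_simps)
    qed (simp add: L_def)
    \<comment> \<open>\<open>yi i\<close> is the Walsh coefficient of \<open>y\<close> at {i}, and
      \<open>yh\<close> is the Rademacher projection of \<open>y\<close>. The vectors
      \<open>L (x i) (yi i)\<close> lift the \<open>x i\<close>, and \<open>H2\<close> is the second
      moment of their signed sums; once \<open>H2\<close> is bounded, cotype 2 of l1 applies to
      these lifts.\<close>
    define yi where "yi i j = (\<Sum>\<epsilon>\<in>signs n. \<epsilon> i * y \<epsilon> j) / 2 ^ n" for i j
    define yh where "yh \<epsilon> j = (\<Sum>i<n. \<epsilon> i * yi i j)" for \<epsilon> :: "nat \<Rightarrow> real" and j
    define Sy where "Sy \<epsilon> j = (\<Sum>\<epsilon>'\<in>signs n. odd_riesz n t \<epsilon> \<epsilon>' * y \<epsilon>' j)" for \<epsilon> j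
    have yh: "yh \<epsilon> j = (\<Sum>\<epsilon>'\<in>signs n. rad_proj n \<epsilon> \<epsilon>' * y \<epsilon>' j)" for \<epsilon> j
      unfolding yh_def yi_def rad_proj_def
      by (simp add: sum_distrib_left sum_distrib_right sum_divide_distrib sum.swap[of _ "signs n"] mult_ac)
    define f where "f \<epsilon> = quot_cost k l G (X \<epsilon>) (y \<epsilon>)" for \<epsilon>
    define h where "h \<epsilon> = quot_cost k l G (X \<epsilon>) (yh \<epsilon>)" for \<epsilon>
    define g where "g \<epsilon> = quot_cost k l G (X \<epsilon>) (Sy \<epsilon>)" for \<epsilon>
    define F2 where "F2 = (\<Sum>\<epsilon>\<in>signs n. (f \<epsilon>)\<^sup>2)"
    define H2 where "H2 = (\<Sum>\<epsilon>\<in>signs n. (h \<epsilon>)\<^sup>2)"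
    have SX: "(\<Sum>\<epsilon>'\<in>signs n. odd_riesz n t \<epsilon> \<epsilon>' * X \<epsilon>' m) = X \<epsilon> m" for \<epsilon> m
    proof -
      have "(\<Sum>\<epsilon>'\<in>signs n. odd_riesz n t \<epsilon> \<epsilon>' * X \<epsilon>' m)
         = (\<Sum>i<n. (\<Sum>\<epsilon>'\<in>signs n. odd_riesz n t \<epsilon> \<epsilon>' * \<epsilon>' i) * x i m)"
        unfolding X_def by (simp add: sum_distrib_left sum_distrib_right sum.swap[of _ "signs n"] mult_ac)
      then show ?thesis using odd_riesz_fixes_sign[OF t(1)] by (simp add: X_def)
    qed
    \<comment> \<open>Since the averages fix the Rademacher sum \<open>X\<close>, averaging the lift
      only replaces \<open>y\<close> by \<open>Sy\<close>.\<close>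
    have "L (X \<epsilon>) (Sy \<epsilon>) w = (\<Sum>\<epsilon>'\<in>signs n. odd_riesz n t \<epsilon> \<epsilon>' * L (X \<epsilon>') (y \<epsilon>') w)" for \<epsilon> w
      using L_lin[of "\<lambda>\<epsilon>'. odd_riesz n t \<epsilon> \<epsilon>'" X "signs n" y w] SX[of \<epsilon>]
      by (simp add: Sy_def[abs_def])
    then have S: "(\<Sum>\<epsilon>\<in>signs n. (g \<epsilon>)\<^sup>2) \<le> F2 / t\<^sup>2"
      unfolding g_def F2_def f_def cost using odd_riesz_bound[OF t, where n=n and W=W and F="\<lambda>\<epsilon>. L (X \<epsilon>) (y \<epsilon>)"] by simp
    have Ldiff: "L u v w - L u v' w = L (\<lambda>_. 0) (\<lambda>j. v j - v' j) w" for u v v' w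
      by (cases w) (simp_all add: L_def mat_vec_def right_diff_distrib sum_subtractf diff_divide_distrib[symmetric])
    have kersum: "quot_cost k l G (\<lambda>_. 0) v = (\<Sum>i<k. \<bar>mat_vec l G v i\<bar>) / sqrt k + (\<Sum>j<l. \<bar>v j\<bar>)" for v
      by (simp add: quot_cost_def mat_vec_def)
    have kk: "real k / sqrt k = sqrt k" using k by (simp add: real_div_sqrt)
    have ker_le: "(quot_cost k l G (\<lambda>_. 0) v)\<^sup>2 \<le> (b + 1)\<^sup>2 * k * (l2 l v)\<^sup>2" for v
    proof -
      have "(\<Sum>i<k. \<bar>mat_vec l G v i\<bar>) / sqrt k \<le> (b * k * l2 l v) / sqrt k"
        using euc by (intro divide_right_mono) (auto simp: l1_euclidean_def)
      also have "\<dots> = b * sqrt k * l2 l v" using kk by (metis mult.assoc mult.commute times_divide_eq_right)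
      finally have "(\<Sum>i<k. \<bar>mat_vec l G v i\<bar>) / sqrt k \<le> b * sqrt k * l2 l v" .
      moreover have "(\<Sum>j<l. \<bar>v j\<bar>) \<le> sqrt k * l2 l v"
        using lk by (intro order_trans[OF sum_abs_le_sqrt_l2] mult_right_mono) auto
      ultimately have "quot_cost k l G (\<lambda>_. 0) v \<le> (b + 1) * sqrt k * l2 l v"
        unfolding kersum by (simp add: algebra_simps)
      then have "(quot_cost k l G (\<lambda>_. 0) v)\<^sup>2 \<le> ((b + 1) * sqrt k * l2 l v)\<^sup>2"
        by (intro power_mono) auto
      then show ?thesis by (simp add: power_mult_distrib)
    qed
    have ker_ge: "a\<^sup>2 * k * (l2 l v)\<^sup>2 \<le> (quot_cost k l G (\<lambda>_. 0) v)\<^sup>2" for v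
    proof -
      have "(a * k * l2 l v) / sqrt k \<le> (\<Sum>i<k. \<bar>mat_vec l G v i\<bar>) / sqrt k"
        using euc by (intro divide_right_mono) (auto simp: l1_euclidean_def)
      also have "(a * k * l2 l v) / sqrt k = a * sqrt k * l2 l v" using kk by (metis mult.assoc mult.commute times_divide_eq_right)
      finally have "a * sqrt k * l2 l v \<le> (\<Sum>i<k. \<bar>mat_vec l G v i\<bar>) / sqrt k" .
      moreover have "0 \<le> (\<Sum>j<l. \<bar>v j\<bar>)" by (simp add: sum_nonneg)
      ultimately have "a * sqrt k * l2 l v \<le> quot_cost k l G (\<lambda>_. 0) v"
        unfolding kersum by linarith
      then have "(a * sqrt k * l2 l v)\<^sup>2 \<le> (quot_cost k l G (\<lambda>_. 0) v)\<^sup>2"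
        using ab by (intro power_mono) auto
      then show ?thesis by (simp add: power_mult_distrib)
    qed
    have sub: "(\<Sum>w\<in>W. \<bar>L u v w - L u v' w\<bar>) = quot_cost k l G (\<lambda>_. 0) (\<lambda>j. v j - v' j)" for u v v'
      by (simp add: Ldiff cost)
    have tri: "quot_cost k l G u v' \<le> quot_cost k l G u v + quot_cost k l G (\<lambda>_. 0) (\<lambda>j. v j - v' j)" for u v v'
      unfolding sub[of u v v', symmetric] cost sum.distrib[symmetric] by (intro sum_mono) auto
    have tri': "quot_cost k l G (\<lambda>_. 0) (\<lambda>j. v j - v' j) \<le> quot_cost k l G u v + quot_cost k l G u v'" for u v v'
      unfolding sub[of u v v', symmetric] cost sum.distrib[symmetric] by (intro sum_mono) auto
    have "(h \<epsilon>)\<^sup>2 \<le> 2 * (g \<epsilon>)\<^sup>2 + 2 * ((b + 1)\<^sup>2 * k * (\<Sum>j<l. (Sy \<epsilon> j - yh \<epsilon> j)\<^sup>2))" for \<epsilon>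
    proof -
      have "(h \<epsilon>)\<^sup>2 \<le> (g \<epsilon> + quot_cost k l G (\<lambda>_. 0) (\<lambda>j. Sy \<epsilon> j - yh \<epsilon> j))\<^sup>2"
        unfolding h_def g_def by (intro power_mono tri) auto
      also have "\<dots> \<le> 2 * (g \<epsilon>)\<^sup>2 + 2 * (quot_cost k l G (\<lambda>_. 0) (\<lambda>j. Sy \<epsilon> j - yh \<epsilon> j))\<^sup>2"
        by (rule square_add_le)
      finally show ?thesis using ker_le[of "\<lambda>j. Sy \<epsilon> j - yh \<epsilon> j"] by (simp add: l2_square)
    qed
    then have "H2 \<le> (\<Sum>\<epsilon>\<in>signs n. 2 * (g \<epsilon>)\<^sup>2 + 2 * ((b + 1)\<^sup>2 * k * (\<Sum>j<l. (Sy \<epsilon> j - yh \<epsilon> j)\<^sup>2)))"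
      unfolding H2_def by (rule sum_mono)
    also have "\<dots> = 2 * (\<Sum>\<epsilon>\<in>signs n. (g \<epsilon>)\<^sup>2)
        + 2 * (b + 1)\<^sup>2 * k * (\<Sum>j<l. \<Sum>\<epsilon>\<in>signs n. (Sy \<epsilon> j - yh \<epsilon> j)\<^sup>2)"
      by (subst sum.swap[of _ "signs n" "{..<l}"]) (simp add: sum.distrib sum_distrib_left mult_ac)
    also have "\<dots> \<le> 2 * (F2 / t\<^sup>2)
        + 2 * (b + 1)\<^sup>2 * k * (\<Sum>j<l. t ^ 4 * (\<Sum>\<epsilon>\<in>signs n. (y \<epsilon> j - yh \<epsilon> j)\<^sup>2))"
    proof (intro add_mono mult_left_mono sum_mono S)
      fix j
      have "Sy \<epsilon> j - yh \<epsilon> j = (\<Sum>\<epsilon>'\<in>signs n. (odd_riesz n t \<epsilon> \<epsilon>' - rad_proj n \<epsilon> \<epsilon>') * y \<epsilon>' j)" for \<epsilon>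
        by (simp add: Sy_def yh left_diff_distrib sum_subtractf)
      then show "(\<Sum>\<epsilon>\<in>signs n. (Sy \<epsilon> j - yh \<epsilon> j)\<^sup>2) \<le> t ^ 4 * (\<Sum>\<epsilon>\<in>signs n. (y \<epsilon> j - yh \<epsilon> j)\<^sup>2)"
        using odd_riesz_minus_rad_proj[OF t, of n "\<lambda>\<epsilon>. y \<epsilon> j"] by (simp add: yh)
    qed auto
    also have "(\<Sum>j<l. t ^ 4 * (\<Sum>\<epsilon>\<in>signs n. (y \<epsilon> j - yh \<epsilon> j)\<^sup>2))
        = t ^ 4 * (\<Sum>\<epsilon>\<in>signs n. (l2 l (\<lambda>j. y \<epsilon> j - yh \<epsilon> j))\<^sup>2)"
      unfolding l2_square by (subst sum.swap) (simp add: sum_distrib_left)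
    also have "2 * (b + 1)\<^sup>2 * k * (t ^ 4 * (\<Sum>\<epsilon>\<in>signs n. (l2 l (\<lambda>j. y \<epsilon> j - yh \<epsilon> j))\<^sup>2))
        = 2 * r\<^sup>2 * t ^ 4 * (\<Sum>\<epsilon>\<in>signs n. a\<^sup>2 * k * (l2 l (\<lambda>j. y \<epsilon> j - yh \<epsilon> j))\<^sup>2)"
      using ab by (simp add: r_def power_divide sum_distrib_left[symmetric] mult_ac)
    \<comment> \<open>\<open>y \<epsilon> - yh \<epsilon>\<close> is the last part of a difference
      of two lifts of the same \<open>X \<epsilon>\<close>, an element of the kernel of norm at most
      \<open>f \<epsilon> + h \<epsilon>\<close>. This brings \<open>H2\<close> back with a factor
      at most 1/2, and it is moved to the left.\<close>
    also have "\<dots> \<le> 2 * r\<^sup>2 * t ^ 4 * (\<Sum>\<epsilon>\<in>signs n. 2 * (f \<epsilon>)\<^sup>2 + 2 * (h \<epsilon>)\<^sup>2)"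
    proof (intro mult_left_mono sum_mono)
      fix \<epsilon>
      have "(quot_cost k l G (\<lambda>_. 0) (\<lambda>j. y \<epsilon> j - yh \<epsilon> j))\<^sup>2 \<le> (f \<epsilon> + h \<epsilon>)\<^sup>2"
        unfolding f_def h_def by (intro power_mono tri') auto
      then show "a\<^sup>2 * k * (l2 l (\<lambda>j. y \<epsilon> j - yh \<epsilon> j))\<^sup>2 \<le> 2 * (f \<epsilon>)\<^sup>2 + 2 * (h \<epsilon>)\<^sup>2"
        using ker_ge[of "\<lambda>j. y \<epsilon> j - yh \<epsilon> j"] square_add_le[of "f \<epsilon>" "h \<epsilon>"] by linarith
    qed auto
    also have "\<dots> = (4 * r\<^sup>2 * t ^ 4) * (F2 + H2)"
      by (simp add: F2_def H2_def sum.distrib sum_distrib_left[symmetric] algebra_simps)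
    also have "\<dots> \<le> 1/2 * (F2 + H2)"
      using rt by (intro mult_right_mono) (auto simp: F2_def H2_def sum_nonneg)
    finally have "H2 \<le> 2 * (F2 / t\<^sup>2) + 1/2 * (F2 + H2)" by simp
    moreover have "z \<le> x + 4 * u" if "z \<le> 2 * u + 1/2 * (x + z)" for x z u :: real
      using that by argo
    ultimately have "H2 \<le> F2 + 4 * (F2 / t\<^sup>2)" by blast
    then have H2: "H2 \<le> 2 * (2 / t\<^sup>2 + 1/2) * F2" by (simp add: algebra_simps)
    have lift: "L (X \<epsilon>) (yh \<epsilon>) w = (\<Sum>i<n. \<epsilon> i * L (x i) (yi i) w)" for \<epsilon> w
      using L_lin[of \<epsilon> x "{..<n}" yi w] by (simp add: X_def[abs_def] yh_def[abs_def])
    have "\<kappa> * (2 ^ n * (\<Sum>i<n. (p (x i))\<^sup>2)) \<le> \<kappa> * (2 ^ n * (\<Sum>i<n. (\<Sum>w\<in>W. \<bar>L (x i) (yi i) w\<bar>)\<^sup>2))"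
      unfolding p_def cost[symmetric] using \<kappa>
      by (intro mult_left_mono sum_mono power_mono quot_norm_le_cost quot_norm_nonneg) auto
    also have "\<dots> \<le> H2"
      using l1_cotype[of W n "\<lambda>i. L (x i) (yi i)"]
      by (simp add: H2_def h_def cost lift W_def \<kappa>_def mult.assoc)
    also have "\<dots> \<le> 2 * (2 / t\<^sup>2 + 1/2) * (\<Sum>\<epsilon>\<in>signs n. 4 * (p (X \<epsilon>))\<^sup>2)"
    proof (rule order_trans[OF H2 mult_left_mono])
      have "(f \<epsilon>)\<^sup>2 \<le> (2 * p (X \<epsilon>))\<^sup>2" for \<epsilon> unfolding f_def by (intro power_mono y) auto
      then show "F2 \<le> (\<Sum>\<epsilon>\<in>signs n. 4 * (p (X \<epsilon>))\<^sup>2)" unfolding F2_def by (intro sum_mono) (simp add: power_mult_distrib)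
    qed simp
    finally have "2 ^ n * (\<Sum>i<n. (p (x i))\<^sup>2) \<le> C * (\<Sum>\<epsilon>\<in>signs n. (p (X \<epsilon>))\<^sup>2)"
      using \<kappa> by (simp add: C_def field_simps sum_distrib_left[symmetric])
    then show ?thesis by (simp add: p_def X_def[abs_def])
  qed
  show ?thesis by (rule that[OF C main])
qed

section \<open>Direct sums\<close>

lemma sum_fun_apply: "(\<Sum>i\<in>I. f i) m = (\<Sum>i\<in>I. f i m)" for f :: "'i \<Rightarrow> 'a \<Rightarrow> real"
  by (induction I rule: infinite_finite_induct) auto

lemma dim_supported_functions:
  fixes M :: "nat set"
  assumes M: "finite M"
  shows "dim {x :: nat \<Rightarrow> real. \<forall>m. m \<notin> M \<longrightarrow> x m = 0} = card M" (is "dim ?E = _")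
proof -
  define u where "u m = (\<lambda>j. if j = m then 1 else 0 :: real)" for m :: nat
  have inj: "inj_on u M"
  proof (rule inj_onI)
    fix m m' assume "u m = u m'"
    then have "u m m = u m' m" by simp
    then show "m = m'" by (simp add: u_def split: if_splits)
  qed
  have val: "(\<Sum>m\<in>M. c m *\<^sub>R u m) j = (if j \<in> M then c j else 0)" for c j
  proof -
    have "(\<Sum>m\<in>M. c m *\<^sub>R u m) j = (\<Sum>m\<in>M. c m * u m j)"
      by (simp add: sum_fun_apply scaleR_fun_def)
    also have "\<dots> = (\<Sum>m\<in>M. if j = m then c m else 0)"
      by (intro sum.cong) (auto simp: u_def)
    finally show ?thesis using M by simp
  qed
  have ind: "independent (u ` M)"
  proof
    assume "dependent (u ` M)"
    then obtain c v where c: "v \<in> u ` M" "c v \<noteq> 0" "(\<Sum>v\<in>u ` M. c v *\<^sub>R v) = 0"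
      using M by (auto simp: dependent_finite)
    then obtain m where m: "m \<in> M" "v = u m" by auto
    have "(\<Sum>m\<in>M. c (u m) *\<^sub>R u m) = 0" using c(3) by (simp add: sum.reindex[OF inj])
    then have "c (u m) = 0" using val[of "\<lambda>m. c (u m)" m] m by (simp add: zero_fun_def)
    then show False using c m by simp
  qed
  have sub: "u ` M \<subseteq> ?E" by (auto simp: u_def)
  have "?E \<subseteq> span (u ` M)"
  proof
    fix x assume "x \<in> ?E"
    then have "x = (\<Sum>m\<in>M. x m *\<^sub>R u m)" by (auto simp: fun_eq_iff val)
    moreover have "(\<Sum>m\<in>M. x m *\<^sub>R u m) \<in> span (u ` M)"
      by (intro span_sum span_scale span_base) auto
    ultimately show "x \<in> span (u ` M)" by metis
  qed
  then have "dim ?E = card (u ` M)" using ind sub by (intro dim_unique) auto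
  then show ?thesis by (simp add: card_image inj)
qed

lemma subspace_supported_functions: "subspace {x :: nat \<Rightarrow> real. \<forall>m. m \<notin> M \<longrightarrow> x m = 0}"
  by (auto simp: subspace_def plus_fun_def scaleR_fun_def zero_fun_def)

text \<open>The pairing of naturals splits one sequence into countably many blocks, so the direct
  sum can live on \<open>nat \<Rightarrow> real\<close>.\<close>

definition block :: "nat \<Rightarrow> (nat \<Rightarrow> real) \<Rightarrow> nat \<Rightarrow> real"
  where "block n x i = x (prod_encode (n, i))"

lemma block_add: "block n (x + y) = (\<lambda>i. block n x i + block n y i)"
  by (simp add: block_def fun_eq_iff)

lemma block_diff: "block n (x - y) = (\<lambda>i. block n x i - block n y i)"
  by (simp add: block_def fun_eq_iff)

lemma block_scale: "block n (c *\<^sub>R x) = (\<lambda>i. c * block n x i)"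
  by (simp add: block_def fun_eq_iff scaleR_fun_def)

lemma block_sum: "block n (\<Sum>i\<in>I. f i) = (\<lambda>m. \<Sum>i\<in>I. block n (f i) m)"
  by (simp add: block_def fun_eq_iff sum_fun_apply)

lemma block_zero: "block n 0 = (\<lambda>_. 0)"
  by (simp add: block_def fun_eq_iff)

text \<open>\<open>p n\<close> is a norm on the first \<open>d n\<close> coordinates.
  \<open>K\<close> and \<open>H\<close> compare it with the supremum and the l1 norm; they may
  depend on \<open>n\<close>, since they serve only definiteness, completeness and
  separability.\<close>

locale l2_sum =
  fixes d :: "nat \<Rightarrow> nat" and p :: "nat \<Rightarrow> (nat \<Rightarrow> real) \<Rightarrow> real" and K H :: "nat \<Rightarrow> real"
  assumes p_cong: "(\<And>i. i < d n \<Longrightarrow> x i = x' i) \<Longrightarrow> p n x = p n x'"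
    and p_nonneg: "0 \<le> p n x"
    and p_add: "p n (\<lambda>i. x i + x' i) \<le> p n x + p n x'"
    and p_scale: "p n (\<lambda>i. c * x i) = \<bar>c\<bar> * p n x"
    and p_coord: "i < d n \<Longrightarrow> \<bar>x i\<bar> \<le> K n * p n x"
    and p_le: "p n x \<le> H n * (\<Sum>i<d n. \<bar>x i\<bar>)"
begin

definition carrier :: "(nat \<Rightarrow> real) set"
  where "carrier = {x. (\<forall>n i. d n \<le> i \<longrightarrow> block n x i = 0) \<and> summable (\<lambda>n. (p n (block n x))\<^sup>2)}"

definition nrm :: "(nat \<Rightarrow> real) \<Rightarrow> real"
  where "nrm x = sqrt (\<Sum>n. (p n (block n x))\<^sup>2)"

definition part :: "nat \<Rightarrow> (nat \<Rightarrow> real) \<Rightarrow> real"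
  where "part m x = L2_set (\<lambda>n. p n (block n x)) {..<m}"

section \<open>The Hilbertian sum as a normed space\<close>

lemma p_zero: "p n (\<lambda>_. 0) = 0"
  using p_scale[of n 0 "\<lambda>_. 0"] by simp

lemma p_minus_commute: "p n (\<lambda>i. x i - y i) = p n (\<lambda>i. y i - x i)"
  using p_scale[of n "-1" "\<lambda>i. x i - y i"] by simp

lemma p_triangle_diff: "p n x \<le> p n y + p n (\<lambda>i. x i - y i)"
  using p_add[of n y "\<lambda>i. x i - y i"] by simp

lemma part_le_nrm:
  assumes "x \<in> carrier" shows "part m x \<le> nrm x"
  unfolding part_def nrm_def L2_set_def
  using assms by (intro real_sqrt_le_mono sum_le_suminf) (auto simp: carrier_def)

text \<open>Bounded partial norms give summability and the norm bound at once, so every estimate can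
  be made on the finite sums \<open>part\<close>, where Minkowski's inequality is available.\<close>

lemma carrier_and_nrm_le:
  assumes "\<And>n i. d n \<le> i \<Longrightarrow> block n x i = 0" and B: "\<And>m. part m x \<le> B"
  shows "x \<in> carrier" "nrm x \<le> B"
proof -
  have B0: "0 \<le> B" using B[of 0] by (simp add: part_def)
  have b: "(\<Sum>n<m. (p n (block n x))\<^sup>2) \<le> B\<^sup>2" for m
    using power_mono[OF B[of m], of 2] by (simp add: part_def L2_set_def sum_nonneg)
  have s: "summable (\<lambda>n. (p n (block n x))\<^sup>2)"
    by (rule summableI_nonneg_bounded[OF _ b]) auto
  then show "x \<in> carrier" using assms by (auto simp: carrier_def)
  have "(\<Sum>n. (p n (block n x))\<^sup>2) \<le> B\<^sup>2" using suminf_le_const[OF s b] .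
  then show "nrm x \<le> B" unfolding nrm_def using B0 real_le_lsqrt by (simp add: real_sqrt_le_iff real_le_lsqrt)
qed

lemma nrm_nonneg: "x \<in> carrier \<Longrightarrow> 0 \<le> nrm x"
  by (simp add: nrm_def carrier_def suminf_nonneg)

lemma nrm_square: "x \<in> carrier \<Longrightarrow> (nrm x)\<^sup>2 = (\<Sum>n. (p n (block n x))\<^sup>2)"
  by (simp add: nrm_def carrier_def suminf_nonneg)

lemma p_le_nrm: "x \<in> carrier \<Longrightarrow> p n (block n x) \<le> nrm x"
proof -
  assume x: "x \<in> carrier"
  have "p n (block n x) \<le> part (Suc n) x"
    unfolding part_def by (rule member_le_L2_set) auto
  then show ?thesis using part_le_nrm[OF x, of "Suc n"] by linarith
qed

lemma carrier_support: "x \<in> carrier \<Longrightarrow> d n \<le> i \<Longrightarrow> block n x i = 0"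
  by (simp add: carrier_def)

lemma part_add: "part m (x + y) \<le> part m x + part m y"
proof -
  have "part m (x + y) \<le> L2_set (\<lambda>n. p n (block n x) + p n (block n y)) {..<m}"
    unfolding part_def block_add by (intro L2_set_mono p_add p_nonneg)
  also have "\<dots> \<le> part m x + part m y"
    unfolding part_def by (rule L2_set_triangle_ineq)
  finally show ?thesis .
qed

lemma part_scale: "part m (c *\<^sub>R x) = \<bar>c\<bar> * part m x"
  unfolding part_def block_scale p_scale by (rule L2_set_right_distrib[symmetric]) simp

lemma carrier_add:
  assumes "x \<in> carrier" "y \<in> carrier"
  shows "x + y \<in> carrier" "nrm (x + y) \<le> nrm x + nrm y"
proof -
  have "part m (x + y) \<le> nrm x + nrm y" for m
    using part_add[of m x y] part_le_nrm[OF assms(1), of m] part_le_nrm[OF assms(2), of m] by linarith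
  then show "x + y \<in> carrier" "nrm (x + y) \<le> nrm x + nrm y"
    using assms by (auto intro!: carrier_and_nrm_le simp: block_add carrier_support)
qed

lemma carrier_scale:
  assumes "x \<in> carrier"
  shows "c *\<^sub>R x \<in> carrier" "nrm (c *\<^sub>R x) \<le> \<bar>c\<bar> * nrm x"
proof -
  have "part m (c *\<^sub>R x) \<le> \<bar>c\<bar> * nrm x" for m
    using part_le_nrm[OF assms(1), of m] by (simp add: part_scale mult_left_mono)
  then show "c *\<^sub>R x \<in> carrier" "nrm (c *\<^sub>R x) \<le> \<bar>c\<bar> * nrm x"
    using assms by (auto intro!: carrier_and_nrm_le simp: block_scale carrier_support)
qed

lemma subspace_carrier': "subspace carrier"
  unfolding subspace_def
  using carrier_add carrier_scale by (auto simp: carrier_def block_zero p_zero)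

sublocale normed_space_on carrier nrm
proof
  show "subspace carrier" by (rule subspace_carrier')
  show "0 \<le> nrm x" if "x \<in> carrier" for x using that by (rule nrm_nonneg)
  show "nrm (x + y) \<le> nrm x + nrm y" if "x \<in> carrier" "y \<in> carrier" for x y
    using carrier_add that by blast
  show "nrm (c *\<^sub>R x) = \<bar>c\<bar> * nrm x" if x: "x \<in> carrier" for x c
  proof (cases "c = 0")
    case True
    then show ?thesis using carrier_scale[OF x, of 0] nrm_nonneg[of "0 *\<^sub>R x"] by auto
  next
    case False
    have "nrm x \<le> \<bar>inverse c\<bar> * nrm (c *\<^sub>R x)"
      using carrier_scale(2)[OF carrier_scale(1)[OF x, of c], of "inverse c"] False by simp
    then have "\<bar>c\<bar> * nrm x \<le> nrm (c *\<^sub>R x)" using False by (simp add: field_simps)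
    then show ?thesis using carrier_scale(2)[OF x, of c] by linarith
  qed
  show "nrm x = 0 \<longleftrightarrow> x = 0" if x: "x \<in> carrier" for x
  proof
    assume 0: "nrm x = 0"
    have "block n x i = 0" for n i
    proof (cases "i < d n")
      case True
      have "p n (block n x) = 0" using p_le_nrm[OF x, of n] p_nonneg[of n "block n x"] 0 by linarith
      then show ?thesis using p_coord[OF True, of "block n x"] by simp
    qed (use x in \<open>simp add: carrier_support\<close>)
    then have "x (prod_encode (prod_decode m)) = 0" for m
      by (metis block_def prod.collapse)
    then show "x = 0" by (simp add: fun_eq_iff)
  next
    assume "x = 0"
    then show "nrm x = 0" by (simp add: nrm_def block_zero p_zero)
  qed
qed

text \<open>The coordinates converge because \<open>p_coord\<close> bounds them by the norm. Each
  partial norm is continuous in finitely many coordinates, so the Cauchy estimate survives the limit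
  in every \<open>part\<close> and hence in the norm.\<close>

lemma mcomplete: "Metric_space.mcomplete carrier (norm_dist carrier nrm)"
proof -
  interpret M: Metric_space carrier "norm_dist carrier nrm" by (rule Metric_space_norm_dist)
  have diff: "x - y \<in> carrier" if "x \<in> carrier" "y \<in> carrier" for x y
    using that subspace_carrier by (simp add: subspace_diff)
  show ?thesis
    unfolding M.mcomplete_def
  proof (intro allI impI)
    fix \<sigma> assume \<sigma>: "M.MCauchy \<sigma>"
    then have \<sigma>c: "\<sigma> m \<in> carrier" for m by (auto simp: M.MCauchy_def)
    have cauchy: "\<exists>M. \<forall>m m'. M \<le> m \<longrightarrow> M \<le> m' \<longrightarrow> nrm (\<sigma> m - \<sigma> m') < e" if "e > 0" for e
      using \<sigma> that by (auto simp: M.MCauchy_def norm_dist_def \<sigma>c)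
    have conv: "convergent (\<lambda>m. block n (\<sigma> m) i)" for n i
    proof (cases "i < d n")
      case True
      show ?thesis
      proof (rule real_Cauchy_convergent, rule metric_CauchyI)
        fix e :: real assume e: "e > 0"
        define e' where "e' = e / (\<bar>K n\<bar> + 1)"
        have "e' > 0" using e by (simp add: e'_def)
        then obtain M where M: "\<forall>m m'. M \<le> m \<longrightarrow> M \<le> m' \<longrightarrow> nrm (\<sigma> m - \<sigma> m') < e'"
          using cauchy by blast
        have "\<bar>block n (\<sigma> m) i - block n (\<sigma> m') i\<bar> < e" if "m \<ge> M" "m' \<ge> M" for m m'
        proof -
          have "\<bar>block n (\<sigma> m - \<sigma> m') i\<bar> \<le> K n * p n (block n (\<sigma> m - \<sigma> m'))" by (rule p_coord[OF True])
          also have "\<dots> \<le> \<bar>K n\<bar> * p n (block n (\<sigma> m - \<sigma> m'))"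
            using p_nonneg by (intro mult_right_mono) auto
          also have "\<dots> \<le> \<bar>K n\<bar> * nrm (\<sigma> m - \<sigma> m')"
            using p_le_nrm[OF diff[OF \<sigma>c \<sigma>c]] by (intro mult_left_mono) auto
          also have "\<dots> \<le> \<bar>K n\<bar> * e'" using M that by (intro mult_left_mono) (auto intro: less_imp_le)
          also have "\<dots> < e" using e by (simp add: e'_def field_simps)
          finally show ?thesis by (simp add: block_diff)
        qed
        then show "\<exists>M. \<forall>m\<ge>M. \<forall>n'\<ge>M. dist (block n (\<sigma> m) i) (block n (\<sigma> n') i) < e"
          by (auto simp: dist_real_def)
      qed
    next
      case False
      then show ?thesis using \<sigma>c by (simp add: carrier_support convergent_const)
    qed
    define x where "x k = lim (\<lambda>m. \<sigma> m k)" for k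
    have lim: "(\<lambda>m. block n (\<sigma> m) i) \<longlonglongrightarrow> block n x i" for n i
      using conv[of n i] by (simp add: block_def x_def convergent_LIMSEQ_iff)
    \<comment> \<open>Blocks are finite-dimensional: by \<open>p_le\<close>, convergence of the
      coordinates implies convergence in \<open>p n\<close>.\<close>
    have plim: "(\<lambda>m'. p n (block n (y - \<sigma> m'))) \<longlonglongrightarrow> p n (block n (y - x))" for n y
    proof -
      have "(\<lambda>m'. H n * (\<Sum>i<d n. \<bar>block n (\<sigma> m') i - block n x i\<bar>)) \<longlonglongrightarrow> H n * (\<Sum>i<d n. \<bar>block n x i - block n x i\<bar>)"
        by (intro tendsto_intros lim)
      then have 0: "(\<lambda>m'. H n * (\<Sum>i<d n. \<bar>block n (\<sigma> m') i - block n x i\<bar>)) \<longlonglongrightarrow> 0" by simp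
      have "(\<lambda>m'. p n (block n (y - \<sigma> m')) - p n (block n (y - x))) \<longlonglongrightarrow> 0"
      proof (rule tendsto_rabs_zero_cancel, rule tendsto_sandwich[OF _ _ tendsto_const 0])
        show "\<forall>\<^sub>F m' in sequentially. 0 \<le> \<bar>p n (block n (y - \<sigma> m')) - p n (block n (y - x))\<bar>" by simp
        have "\<bar>p n (block n (y - \<sigma> m')) - p n (block n (y - x))\<bar> \<le> p n (\<lambda>i. block n (\<sigma> m') i - block n x i)" for m'
          using p_triangle_diff[of n "block n (y - \<sigma> m')" "block n (y - x)"]
            p_triangle_diff[of n "block n (y - x)" "block n (y - \<sigma> m')"]
            p_minus_commute[of n "block n (\<sigma> m')" "block n x"]
          by (simp add: block_diff)
        then show "\<forall>\<^sub>F m' in sequentially. \<bar>p n (block n (y - \<sigma> m')) - p n (block n (y - x))\<bar>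
            \<le> H n * (\<Sum>i<d n. \<bar>block n (\<sigma> m') i - block n x i\<bar>)"
          using p_le order_trans by (intro always_eventually allI) blast
      qed
      then show ?thesis by (rule LIM_zero_cancel)
    qed
    have supp: "block n x i = 0" if "d n \<le> i" for n i
      using lim[of n i] \<sigma>c that by (simp add: carrier_support LIMSEQ_const_iff)
    have close: "\<exists>M. \<forall>m\<ge>M. \<sigma> m - x \<in> carrier \<and> nrm (\<sigma> m - x) \<le> e" if e: "e > 0" for e
    proof -
      obtain M where M: "\<forall>m m'. M \<le> m \<longrightarrow> M \<le> m' \<longrightarrow> nrm (\<sigma> m - \<sigma> m') < e" using cauchy e by blast
      have "part j (\<sigma> m - x) \<le> e" if "m \<ge> M" for m j
      proof (rule LIMSEQ_le_const2)
        show "(\<lambda>m'. part j (\<sigma> m - \<sigma> m')) \<longlonglongrightarrow> part j (\<sigma> m - x)"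
          unfolding part_def L2_set_def by (intro tendsto_intros plim)
        show "\<exists>N. \<forall>m'\<ge>N. part j (\<sigma> m - \<sigma> m') \<le> e"
          using M that part_le_nrm[OF diff[OF \<sigma>c \<sigma>c]] by (meson less_imp_le order_trans)
      qed
      then show ?thesis
        using supp \<sigma>c by (intro exI[of _ M]) (auto intro!: carrier_and_nrm_le simp: block_diff carrier_support)
    qed
    \<comment> \<open>\<open>close\<close> was shown without knowing that \<open>x\<close> lies in
      the carrier; membership now follows by subtraction.\<close>
    obtain M where "\<sigma> M - x \<in> carrier" using close[of 1] by auto
    then have "\<sigma> M - (\<sigma> M - x) \<in> carrier" using \<sigma>c diff by blast
    then have xc: "x \<in> carrier" by simp
    have "limitin M.mtopology \<sigma> x sequentially"
      unfolding M.limitin_metric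
    proof (intro conjI allI impI xc)
      fix e :: real assume "e > 0"
      then obtain M where "\<forall>m\<ge>M. nrm (\<sigma> m - x) \<le> e/2" using close[of "e/2"] by auto
      then have "\<forall>m\<ge>M. \<sigma> m \<in> carrier \<and> norm_dist carrier nrm (\<sigma> m) x < e"
        using \<sigma>c xc \<open>e > 0\<close> by (fastforce simp: norm_dist_def)
      then show "\<forall>\<^sub>F m in sequentially. \<sigma> m \<in> carrier \<and> norm_dist carrier nrm (\<sigma> m) x < e"
        by (auto simp: eventually_sequentially)
    qed
    then show "\<exists>x. limitin M.mtopology \<sigma> x sequentially" by blast
  qed
qed

lemma banach: "banach_space_on carrier nrm"
  by unfold_locales (rule mcomplete)

text \<open>Finitely supported rational sequences in the carrier are dense: beyond block
  \<open>n0\<close> the tail of \<open>x\<close> has norm below e/4, and the finitely many remaining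
  coordinates are approximated by rationals.\<close>

lemma separable: "separable_norm carrier nrm"
proof -
  interpret M: Metric_space carrier "norm_dist carrier nrm" by (rule Metric_space_norm_dist)
  define f :: "rat list \<Rightarrow> nat \<Rightarrow> real" where "f q m = (if m < length q then of_rat (q ! m) else 0)" for q m
  define U where "U = range f \<inter> carrier"
  have "countable U" by (simp add: U_def)
  moreover have "U \<subseteq> carrier" by (auto simp: U_def)
  moreover have "M.mtopology closure_of U = carrier"
  proof (intro equalityI subsetI)
    fix x assume "x \<in> M.mtopology closure_of U"
    then show "x \<in> carrier" by (simp add: M.metric_closure_of)
  next
    fix x assume x: "x \<in> carrier"
    have "\<exists>y\<in>U. y \<in> M.mball x e" if e: "e > 0" for e
    proof -
      have sm: "summable (\<lambda>n. (p n (block n x))\<^sup>2)" using x by (simp add: carrier_def)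
      obtain n0 where n0: "\<And>n. n \<ge> n0 \<Longrightarrow> norm (\<Sum>i. (p (i + n) (block (i + n) x))\<^sup>2) < (e/4)\<^sup>2"
        using suminf_exist_split[OF _ sm, of "(e/4)\<^sup>2"] e by auto
      \<comment> \<open>The summand 1 avoids a division by zero in \<open>\<delta>\<close> when all
        weights vanish.\<close>
      define S where "S = 1 + (\<Sum>n<n0. \<bar>H n\<bar> * d n)"
      have S: "S \<ge> 1" by (simp add: S_def sum_nonneg)
      define \<delta> where "\<delta> = e / (4 * S)"
      have \<delta>: "\<delta> > 0" using e S by (simp add: \<delta>_def)
      have "\<exists>q::rat. \<bar>r - of_rat q\<bar> < \<delta>" for r :: real
      proof -
        obtain q where "r < of_rat q" "of_rat q < r + \<delta>" using of_rat_dense[of r "r + \<delta>"] \<delta> by auto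
        then show ?thesis by (intro exI[of _ q]) auto
      qed
      then obtain q where q: "\<And>r. \<bar>r - of_rat (q r)\<bar> < \<delta>" by metis
      define Q where "Q = (\<lambda>(n, i). prod_encode (n, i)) ` (Sigma {..<n0} (\<lambda>n. {..<d n}))"
      have finQ: "finite Q" by (simp add: Q_def)
      obtain B where B: "\<And>m. m \<in> Q \<Longrightarrow> m < B" using finQ unfolding finite_nat_set_iff_bounded by blast
      define y where "y = f (map (\<lambda>m. if m \<in> Q then q (x m) else 0) [0..<B])"
      have yv: "y m = (if m \<in> Q then of_rat (q (x m)) else 0)" for m
        using B[of m] by (auto simp: y_def f_def)
      have inQ: "prod_encode (n, i) \<in> Q \<longleftrightarrow> n < n0 \<and> i < d n" for n i
        by (auto simp: Q_def)
      have ysupp: "block n y i = 0" if "d n \<le> i" for n i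
        using that by (simp add: block_def yv inQ)
      have blk1: "p n (block n (x - y)) \<le> \<bar>H n\<bar> * d n * \<delta>" if "n < n0" for n
      proof -
        have "p n (block n (x - y)) \<le> H n * (\<Sum>i<d n. \<bar>block n (x - y) i\<bar>)" by (rule p_le)
        also have "\<dots> \<le> \<bar>H n\<bar> * (\<Sum>i<d n. \<delta>)"
          using that q by (intro mult_mono sum_mono) (auto simp: block_def yv inQ intro: less_imp_le sum_nonneg)
        finally show ?thesis by simp
      qed
      have blk2: "p n (block n (x - y)) = p n (block n x)" if "n \<ge> n0" for n
      proof -
        have "block n y i = 0" for i using that by (simp add: block_def yv inQ)
        then show ?thesis by (simp add: block_diff)
      qed
      have "part m (x - y) \<le> e/2" for m
      proof -
        let ?A = "L2_set (\<lambda>n. if n < n0 then p n (block n (x - y)) else 0) {..<m}"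
          and ?B = "L2_set (\<lambda>n. if n < n0 then 0 else p n (block n x)) {..<m}"
        have "part m (x - y) \<le> L2_set (\<lambda>n. (if n < n0 then p n (block n (x - y)) else 0) + (if n < n0 then 0 else p n (block n x))) {..<m}"
          unfolding part_def by (intro L2_set_mono) (auto simp: blk2 p_nonneg)
        also have "\<dots> \<le> ?A + ?B"
          by (rule L2_set_triangle_ineq)
        finally have t1: "part m (x - y) \<le> ?A + ?B" .
        have "L2_set (\<lambda>n. if n < n0 then p n (block n (x - y)) else 0) {..<m} \<le> (\<Sum>n<m. if n < n0 then p n (block n (x - y)) else 0)"
          by (rule L2_set_le_sum) (auto simp: p_nonneg)
        also have "\<dots> \<le> (\<Sum>n<n0. \<bar>H n\<bar> * d n * \<delta>)"
        proof -
          have "(\<Sum>n<m. if n < n0 then p n (block n (x - y)) else 0) = (\<Sum>n\<in>{..<m} \<inter> {n. n < n0}. p n (block n (x - y)))"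
            by (simp add: sum.If_cases)
          also have "\<dots> \<le> (\<Sum>n<n0. p n (block n (x - y)))"
            by (intro sum_mono2) (auto simp: p_nonneg)
          also have "\<dots> \<le> (\<Sum>n<n0. \<bar>H n\<bar> * d n * \<delta>)" by (intro sum_mono blk1) auto
          finally show ?thesis .
        qed
        also have "\<dots> \<le> S * \<delta>" using \<delta> by (simp add: S_def sum_distrib_right distrib_right)
        also have "S * \<delta> = e/4" using S by (simp add: \<delta>_def)
        finally have t2: "?A \<le> e/4" .
        have t3: "L2_set (\<lambda>n. if n < n0 then 0 else p n (block n x)) {..<m} \<le> e/4"
        proof -
          have "(\<Sum>n<m. (if n < n0 then 0 else p n (block n x))\<^sup>2) = (\<Sum>n\<in>{..<m} \<inter> {n. \<not> n < n0}. (p n (block n x))\<^sup>2)"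
            by (rule sum.mono_neutral_cong_right) auto
          also have "\<dots> \<le> (\<Sum>n\<in>(\<lambda>i. i + n0) ` {..<m}. (p n (block n x))\<^sup>2)"
          proof (rule sum_mono2)
            show "{..<m} \<inter> {n. \<not> n < n0} \<subseteq> (\<lambda>i. i + n0) ` {..<m}"
            proof
              fix n assume "n \<in> {..<m} \<inter> {n. \<not> n < n0}"
              then have "n = (n - n0) + n0" "n - n0 < m" by auto
              then show "n \<in> (\<lambda>i. i + n0) ` {..<m}" by blast
            qed
          qed auto
          also have "\<dots> = (\<Sum>i<m. (p (i + n0) (block (i + n0) x))\<^sup>2)" by (simp add: sum.reindex)
          also have "\<dots> \<le> (\<Sum>i. (p (i + n0) (block (i + n0) x))\<^sup>2)"
            using sm by (intro sum_le_suminf) (auto simp: summable_iff_shift[of "\<lambda>n. (p n (block n x))\<^sup>2"])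
          also have "\<dots> \<le> (e/4)\<^sup>2" using n0[of n0] by simp
          finally show ?thesis unfolding L2_set_def using e by (intro real_le_lsqrt) auto
        qed
        show ?thesis using t1 t2 t3 by linarith
      qed
      then have xy: "x - y \<in> carrier" "nrm (x - y) \<le> e/2"
        using carrier_and_nrm_le[of "x - y" "e/2"] ysupp x by (auto simp: block_diff carrier_support)
      then have "x - (x - y) \<in> carrier" using x subspace_diff[OF subspace_carrier] by blast
      then have "y \<in> carrier" by simp
      then show ?thesis using xy x e by (intro bexI[of _ y]) (auto simp: U_def y_def norm_dist_def)
    qed
    then show "x \<in> M.mtopology closure_of U" using x by (auto simp: M.metric_closure_of)
  qed
  ultimately show ?thesis
    unfolding separable_norm_def separable_space_def by auto
qed

text \<open>With exponent 2 on both sides the squared norms add up over the blocks, so the sum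
  inherits a cotype inequality that is uniform over the blocks, with the same constant.\<close>

lemma cotype:
  assumes C: "C > 0"
    and blocks: "\<And>b n x. 2 ^ n * (\<Sum>i<n. (p b (x i))\<^sup>2)
      \<le> C * (\<Sum>\<epsilon>\<in>signs n. (p b (\<lambda>m. \<Sum>i<n. \<epsilon> i * x i m))\<^sup>2)"
  shows "has_cotype carrier nrm 2 (sqrt C)"
  unfolding has_cotype_def
proof (intro conjI allI impI)
  show "0 < sqrt C" using C by simp
  fix n :: nat and y :: "nat \<Rightarrow> nat \<Rightarrow> real"
  assume "n \<ge> 1" and y: "\<forall>i<n. y i \<in> carrier"
  define z where "z \<epsilon> = (\<Sum>i<n. \<epsilon> i *\<^sub>R y i)" for \<epsilon> :: "nat \<Rightarrow> real"
  have zc: "z \<epsilon> \<in> carrier" for \<epsilon>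
    unfolding z_def using y subspace_carrier by (intro subspace_sum subspace_scale) auto
  have bz: "block b (z \<epsilon>) = (\<lambda>m. \<Sum>i<n. \<epsilon> i * block b (y i) m)" for b \<epsilon>
    by (simp add: z_def block_sum block_scale)
  have sy: "summable (\<lambda>b. (p b (block b (y i)))\<^sup>2)" if "i < n" for i
    using y that by (simp add: carrier_def)
  have sz: "summable (\<lambda>b. (p b (block b (z \<epsilon>)))\<^sup>2)" for \<epsilon>
    using zc by (simp add: carrier_def)
  have "2 ^ n * (\<Sum>i<n. (nrm (y i))\<^sup>2) = (\<Sum>b. 2 ^ n * (\<Sum>i<n. (p b (block b (y i)))\<^sup>2))"
    using y sy by (subst suminf_mult, intro summable_sum, force, subst suminf_sum) (auto simp: nrm_square)
  also have "\<dots> \<le> (\<Sum>b. C * (\<Sum>\<epsilon>\<in>signs n. (p b (block b (z \<epsilon>)))\<^sup>2))"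
  proof (rule suminf_le)
    show "2 ^ n * (\<Sum>i<n. (p b (block b (y i)))\<^sup>2) \<le> C * (\<Sum>\<epsilon>\<in>signs n. (p b (block b (z \<epsilon>)))\<^sup>2)" for b
      unfolding bz by (rule blocks)
  qed (auto intro!: summable_mult summable_sum sy sz)
  also have "\<dots> = C * (\<Sum>\<epsilon>\<in>signs n. (nrm (z \<epsilon>))\<^sup>2)"
    using zc sz by (subst suminf_mult, intro summable_sum, force, subst suminf_sum) (auto simp: nrm_square)
  finally have le: "2 ^ n * (\<Sum>i<n. (nrm (y i))\<^sup>2) \<le> C * (\<Sum>\<epsilon>\<in>signs n. (nrm (z \<epsilon>))\<^sup>2)" .
  have ne: "signs n \<noteq> {}" by (simp add: PiE_eq_empty_iff)
  have E: "measure_pmf.expectation (pmf_of_set (signs n)) (\<lambda>\<sigma>. nrm (z \<sigma>) powr 2) = (\<Sum>\<epsilon>\<in>signs n. (nrm (z \<epsilon>))\<^sup>2) / 2 ^ n"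
    using ne by (simp add: integral_pmf_of_set card_signs powr_numeral nrm_nonneg[OF zc])
  have sq: "sqrt C powr (-2) = 1 / C" using C by (simp add: powr_minus powr_numeral divide_inverse)
  have ys: "(\<Sum>i<n. nrm (y i) powr 2) = (\<Sum>i<n. (nrm (y i))\<^sup>2)"
    using y by (intro sum.cong) (auto simp: powr_numeral nrm_nonneg)
  have "1 / C * A \<le> S / 2 ^ n" if "2 ^ n * A \<le> C * S" for A S
    using that C by (simp add: field_simps)
  from this[OF le] show "sqrt C powr (-2) * (\<Sum>i<n. nrm (y i) powr 2)
      \<le> measure_pmf.expectation (pmf_of_set (signs n)) (\<lambda>\<sigma>. nrm (\<Sum>i<n. \<sigma> i *\<^sub>R y i) powr 2)"
    unfolding sq ys E[unfolded z_def] by (simp only: z_def)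
qed simp

section \<open>Single blocks as subspaces\<close>

definition block_space :: "nat \<Rightarrow> (nat \<Rightarrow> real) set"
  where "block_space n = {x. \<forall>m. m \<notin> (\<lambda>i. prod_encode (n, i)) ` {..<d n} \<longrightarrow> x m = 0}"

lemma subspace_block_space: "subspace (block_space n)"
  unfolding block_space_def by (rule subspace_supported_functions)

lemma dim_block_space: "dim (block_space n) = d n"
proof -
  have "inj_on (\<lambda>i. prod_encode (n, i)) {..<d n}" by (auto simp: inj_on_def)
  then show ?thesis unfolding block_space_def by (subst dim_supported_functions) (auto simp: card_image)
qed

lemma block_of_block_space:
  assumes "x \<in> block_space n"
  shows "block n' x i = (if n' = n \<and> i < d n then block n x i else 0)"
proof -
  have "prod_encode (n', i) \<in> (\<lambda>i. prod_encode (n, i)) ` {..<d n} \<longleftrightarrow> n' = n \<and> i < d n" by auto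
  then show ?thesis using assms by (auto simp: block_space_def block_def)
qed

lemma block_space_nrm:
  assumes x: "x \<in> block_space n"
  shows "x \<in> carrier" "nrm x = p n (block n x)"
proof -
  have other: "p n' (block n' x) = 0" if "n' \<noteq> n" for n'
  proof -
    have "p n' (block n' x) = p n' (\<lambda>_. 0)"
      using block_of_block_space[OF x, of n'] that by (intro p_cong) simp
    then show ?thesis by (simp add: p_zero)
  qed
  have "(\<lambda>n'. (p n' (block n' x))\<^sup>2) sums (\<Sum>n'\<in>{n}. (p n' (block n' x))\<^sup>2)"
    by (rule sums_finite) (auto simp: other)
  then have sums: "(\<lambda>n'. (p n' (block n' x))\<^sup>2) sums (p n (block n x))\<^sup>2" by simp
  have "(\<Sum>n'. (p n' (block n' x))\<^sup>2) = (p n (block n x))\<^sup>2" by (rule sums_unique[OF sums, symmetric])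
  then show "nrm x = p n (block n x)" by (simp add: nrm_def p_nonneg)
  have "block n' x i = 0" if "d n' \<le> i" for n' i
    using that by (subst block_of_block_space[OF x]) auto
  then show "x \<in> carrier" unfolding carrier_def using sums_summable[OF sums] by simp
qed

lemma infinite_dim:
  assumes "\<And>b. \<exists>n. b < d n" shows "infinite_dim carrier"
  unfolding infinite_dim_def
proof
  assume "\<exists>B. finite B \<and> carrier \<subseteq> span B"
  then obtain B where B: "finite B" "carrier \<subseteq> span B" by blast
  obtain n where n: "card B < d n" using assms by blast
  have "block_space n \<subseteq> span B" using B block_space_nrm by blast
  then have "d n \<le> card B" using B dim_block_space[of n] by (metis dim_le_card)
  then show False using n by simp
qed

end

section \<open>John's ellipsoid\<close>

text \<open>Matrix determinant lemma. The bordered matrix \<open>M\<close> is reduced in two ways: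
  clearing its upper right block by the unipotent \<open>P\<close> from the right leaves
  \<open>W * V + b I\<close>, clearing it by \<open>Q\<close> from the left leaves the scalar 1 + V
  W / b next to \<open>b I\<close>.\<close>

lemma det_scalar_plus_rank_one:
  fixes b :: real and v w :: "nat \<Rightarrow> real"
  assumes b: "b \<noteq> 0"
  shows "Determinant.det (mat n n (\<lambda>(i, j). (if i = j then b else 0) + w i * v j))
    = (1 + (\<Sum>i<n. v i * w i) / b) * b ^ n"
proof -
  let ?one = "1\<^sub>m 1 :: real mat" and ?I = "1\<^sub>m n :: real mat"
  define V where "V = mat 1 n (\<lambda>(i, j). v j)"
  define W where "W = mat n 1 (\<lambda>(i, j). w i)"
  let ?bI = "b \<cdot>\<^sub>m ?I"
  define M where "M = four_block_mat ?one (- V) W ?bI"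
  define P where "P = four_block_mat ?one V (0\<^sub>m n 1) ?I"
  define Q where "Q = four_block_mat ?one ((1/b) \<cdot>\<^sub>m V) (0\<^sub>m n 1) ?I"
  have c [simp]: "V \<in> carrier_mat 1 n" "W \<in> carrier_mat n 1" "V \<in> carrier_mat (Suc 0) n" "W \<in> carrier_mat n (Suc 0)" by (auto simp: V_def W_def)
  have c': "- V \<in> carrier_mat 1 n" "?bI \<in> carrier_mat n n" "(1/b) \<cdot>\<^sub>m V \<in> carrier_mat 1 n" by auto
  have cX: "?one + (1/b) \<cdot>\<^sub>m V * W \<in> carrier_mat 1 1"
    by (intro add_carrier_mat mult_carrier_mat[OF c'(3) c(2)])
  have Mc: "M \<in> carrier_mat (1 + n) (1 + n)" "P \<in> carrier_mat (1 + n) (1 + n)" "Q \<in> carrier_mat (1 + n) (1 + n)"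
    unfolding M_def P_def Q_def by (auto intro!: four_block_carrier_mat)
  have "Determinant.det P = Determinant.det ?one * Determinant.det ?I"
    unfolding P_def by (rule det_four_block_mat_lower_left_zero) auto
  then have detP: "Determinant.det P = 1" by simp
  have "Determinant.det Q = Determinant.det ?one * Determinant.det ?I"
    unfolding Q_def by (rule det_four_block_mat_lower_left_zero) auto
  then have detQ: "Determinant.det Q = 1" by simp
  have "M * P = four_block_mat ?one (0\<^sub>m 1 n) W (W * V + ?bI)"
  proof -
    have "M * P = four_block_mat (?one * ?one + (- V) * 0\<^sub>m n 1) (?one * V + (- V) * ?I) (W * ?one + ?bI * 0\<^sub>m n 1) (W * V + ?bI * ?I)"
      unfolding M_def P_def by (rule mult_four_block_mat[of ?one 1 1 "- V" n W n ?bI ?one 1 V n "0\<^sub>m n 1" ?I]) auto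
    also have "?one * ?one + (- V) * 0\<^sub>m n 1 = ?one" by (auto simp: V_def)
    also have "?one * V + (- V) * ?I = 0\<^sub>m 1 n"
    proof -
      have "?one * V = V" "(- V) * ?I = - V"
        by (rule left_mult_one_mat[OF c(1)], rule right_mult_one_mat[OF c'(1)])
      then show ?thesis by (auto intro!: eq_matI simp: V_def)
    qed
    also have "W * ?one + ?bI * 0\<^sub>m n 1 = W"
    proof -
      have "W * ?one = W" "?bI * 0\<^sub>m n 1 = 0\<^sub>m n 1"
        by (rule right_mult_one_mat[OF c(2)], rule right_mult_zero_mat[OF c'(2)])
      then show ?thesis by auto
    qed
    also have "?bI * ?I = ?bI" by (rule right_mult_one_mat[OF c'(2)])
    finally show ?thesis .
  qed
  then have "Determinant.det (M * P) = Determinant.det ?one * Determinant.det (W * V + ?bI)"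
    by (simp only:) (rule det_four_block_mat_upper_right_zero, auto)
  then have 1: "Determinant.det M = Determinant.det (W * V + ?bI)"
    using Mc detP by (simp add: Determinant.det_mult)
  have "Q * M = four_block_mat (?one + (1/b) \<cdot>\<^sub>m V * W) (0\<^sub>m 1 n) W ?bI"
  proof -
    have "Q * M = four_block_mat (?one * ?one + ((1/b) \<cdot>\<^sub>m V) * W) (?one * (- V) + ((1/b) \<cdot>\<^sub>m V) * ?bI) (0\<^sub>m n 1 * ?one + ?I * W) (0\<^sub>m n 1 * (- V) + ?I * ?bI)"
      unfolding M_def Q_def by (rule mult_four_block_mat[of ?one 1 1 "(1/b) \<cdot>\<^sub>m V" n "0\<^sub>m n 1" n ?I ?one 1 "- V" n W ?bI]) auto
    also have "?one * ?one = ?one" by simp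
    also have "?one * (- V) + ((1/b) \<cdot>\<^sub>m V) * ?bI = 0\<^sub>m 1 n"
    proof -
      have "?one * (- V) = - V" by (rule left_mult_one_mat[OF c'(1)])
      moreover have "((1/b) \<cdot>\<^sub>m V) * ?bI = b \<cdot>\<^sub>m (((1/b) \<cdot>\<^sub>m V) * ?I)"
        by (rule mult_smult_distrib[OF c'(3), of ?I n]) simp
      moreover have "((1/b) \<cdot>\<^sub>m V) * ?I = (1/b) \<cdot>\<^sub>m V" by (rule right_mult_one_mat[OF c'(3)])
      ultimately show ?thesis using b by (auto intro!: eq_matI simp: V_def)
    qed
    also have "0\<^sub>m n 1 * ?one + ?I * W = W"
    proof -
      have "?I * W = W" by (rule left_mult_one_mat[OF c(2)])
      then show ?thesis by auto
    qed
    also have "0\<^sub>m n 1 * (- V) + ?I * ?bI = ?bI"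
    proof -
      have "?I * ?bI = ?bI" "0\<^sub>m n 1 * (- V) = 0\<^sub>m n n"
        by (rule left_mult_one_mat[OF c'(2)], rule left_mult_zero_mat[OF c'(1)])
      then show ?thesis by auto
    qed
    finally show ?thesis .
  qed
  then have "Determinant.det (Q * M) = Determinant.det (?one + (1/b) \<cdot>\<^sub>m V * W) * Determinant.det ?bI"
    by (simp only:) (rule det_four_block_mat_upper_right_zero[OF cX refl c(2) c'(2)])
  moreover have "Determinant.det (?one + (1/b) \<cdot>\<^sub>m V * W) = 1 + (\<Sum>i<n. v i * w i) / b"
  proof (subst det_single)
    show "?one + (1/b) \<cdot>\<^sub>m V * W \<in> carrier_mat 1 1" by (rule cX)
    have "((1/b) \<cdot>\<^sub>m V * W) $$ (0,0) = (\<Sum>i<n. v i * w i) / b"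
      by (simp add: V_def W_def scalar_prod_def atLeast0LessThan sum_divide_distrib)
    then show "(?one + (1/b) \<cdot>\<^sub>m V * W) $$ (0, 0) = 1 + (\<Sum>i<n. v i * w i) / b"
      by (simp add: V_def W_def)
  qed
  moreover have "Determinant.det ?bI = b ^ n" by simp
  ultimately have 2: "Determinant.det M = (1 + (\<Sum>i<n. v i * w i) / b) * b ^ n"
    using Mc detQ by (simp add: Determinant.det_mult)
  have "mat n n (\<lambda>(i, j). (if i = j then b else 0) + w i * v j) = W * V + ?bI"
    by (rule eq_matI) (auto simp: V_def W_def scalar_prod_def)
  then show ?thesis using 1 2 by simp
qed

text \<open>A norm written in the coordinates of a basis of \<open>k\<close> vectors;
  \<open>h i\<close> bounds the norm of the i-th basis vector.\<close>

locale fin_norm =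
  fixes k :: nat and p :: "(nat \<Rightarrow> real) \<Rightarrow> real" and h :: "nat \<Rightarrow> real"
  assumes p_add: "p (\<lambda>i. x i + x' i) \<le> p x + p x'"
    and p_scale: "p (\<lambda>i. c * x i) = \<bar>c\<bar> * p x"
    and p_le: "p x \<le> (\<Sum>i<k. \<bar>x i\<bar> * h i)"
    and p_definite: "p x = 0 \<Longrightarrow> i < k \<Longrightarrow> x i = 0"
begin

lemma p_nonneg: "0 \<le> p x"
proof -
  have "p (\<lambda>_. 0) = 0" using p_scale[of 0 "\<lambda>_. 0"] by simp
  moreover have "p (\<lambda>i. x i + - 1 * x i) \<le> p x + p (\<lambda>i. - 1 * x i)" by (rule p_add)
  ultimately show ?thesis using p_scale[of "- 1" x] by simp
qed

text \<open>Equivalence of norms by compactness of the l1 sphere: otherwise there are vectors on it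
  with \<open>p\<close> tending to 0, and a coordinatewise limit point would have
  \<open>p = 0\<close> but l1 norm 1.\<close>

lemma coordinate_bound:
  obtains K where "K > 0" "\<And>x i. i < k \<Longrightarrow> \<bar>x i\<bar> \<le> K * p x"
proof (rule ccontr)
  assume contra: "\<not> thesis"
  have ex: "\<exists>w. (\<Sum>j<k. \<bar>w j\<bar>) = 1 \<and> p w < 1 / real (Suc m)" for m
  proof -
    have "\<not> (\<forall>x i. i < k \<longrightarrow> \<bar>x i\<bar> \<le> real (Suc m) * p x)"
    proof
      assume "\<forall>x i. i < k \<longrightarrow> \<bar>x i\<bar> \<le> real (Suc m) * p x"
      then have thesis by (intro that[rotated]) auto
      then show False using contra by blast
    qed
    then obtain x i where xi: "i < k" "\<bar>x i\<bar> > real (Suc m) * p x" by (auto simp: not_le)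
    define s where "s = (\<Sum>j<k. \<bar>x j\<bar>)"
    have "\<bar>x i\<bar> \<le> s" unfolding s_def using xi by (intro member_le_sum) auto
    moreover have "0 \<le> real (Suc m) * p x" by (intro mult_nonneg_nonneg p_nonneg) auto
    ultimately have s: "s > 0" "real (Suc m) * p x < s" using xi by linarith+
    have "(\<Sum>j<k. \<bar>inverse s * x j\<bar>) = 1"
      using s by (simp add: abs_mult sum_distrib_left[symmetric] s_def[symmetric])
    moreover have "p (\<lambda>j. inverse s * x j) < 1 / real (Suc m)"
      using s unfolding p_scale by (simp add: field_simps)
    ultimately show ?thesis by (intro exI[of _ "\<lambda>j. inverse s * x j"] conjI)
  qed
  then obtain w where w: "\<And>m. (\<Sum>j<k. \<bar>w m j\<bar>) = 1" "\<And>m. p (w m) < 1 / real (Suc m)" by metis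
  have bnd: "bounded ((\<lambda>x. x j) ` range w)" if "j \<in> {..<k}" for j
  proof (rule boundedI)
    fix z assume "z \<in> (\<lambda>x. x j) ` range w"
    then obtain m where "z = w m j" by auto
    moreover have "\<bar>w m j\<bar> \<le> (\<Sum>j<k. \<bar>w m j\<bar>)" using that by (intro member_le_sum) auto
    ultimately show "norm z \<le> 1" using w by simp
  qed
  have "\<forall>\<delta>\<subseteq>{..<k}. \<exists>l::nat \<Rightarrow> real. \<exists>r::nat\<Rightarrow>nat.
    strict_mono r \<and> (\<forall>\<epsilon>>0. eventually (\<lambda>n. \<forall>i\<in>\<delta>. dist (w (r n) i) (l i) < \<epsilon>) sequentially)"
    by (rule compact_lemma_general[where proj="\<lambda>x i. x i" and unproj="\<lambda>x. x" and f=w]) (use bnd in auto)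
  then obtain l r where r: "strict_mono r"
    and l: "\<And>\<epsilon>. \<epsilon> > 0 \<Longrightarrow> eventually (\<lambda>n. \<forall>i\<in>{..<k}. dist (w (r n) i) (l i) < \<epsilon>) sequentially" by blast
  have lim: "(\<lambda>n. w (r n) i) \<longlonglongrightarrow> l i" if "i < k" for i
  proof (rule tendstoI)
    fix e :: real assume "e > 0"
    from l[OF this] show "\<forall>\<^sub>F n in sequentially. dist (w (r n) i) (l i) < e"
      by (rule eventually_mono) (use that in auto)
  qed
  have "(\<lambda>n. \<Sum>j<k. \<bar>w (r n) j\<bar>) \<longlonglongrightarrow> (\<Sum>j<k. \<bar>l j\<bar>)" by (intro tendsto_intros lim) auto
  then have suml: "(\<Sum>j<k. \<bar>l j\<bar>) = 1" using w(1) by (simp add: LIMSEQ_const_iff)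
  have "(\<lambda>n. \<Sum>j<k. \<bar>l j - w (r n) j\<bar> * h j) \<longlonglongrightarrow> (\<Sum>j<k. \<bar>l j - l j\<bar> * h j)"
    by (intro tendsto_intros lim) auto
  moreover have "(\<lambda>n. 1 / real (Suc (r n))) \<longlonglongrightarrow> 0"
    using LIMSEQ_subseq_LIMSEQ[OF LIMSEQ_inverse_real_of_nat r] by (simp add: o_def inverse_eq_divide)
  ultimately have "(\<lambda>n. 1 / real (Suc (r n)) + (\<Sum>j<k. \<bar>l j - w (r n) j\<bar> * h j)) \<longlonglongrightarrow> 0 + (\<Sum>j<k. \<bar>l j - l j\<bar> * h j)"
    by (intro tendsto_add)
  then have "p l \<le> 0 + (\<Sum>j<k. \<bar>l j - l j\<bar> * h j)"
  proof (rule LIMSEQ_le_const, intro exI allI impI)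
    fix n
    have "p l \<le> p (w (r n)) + p (\<lambda>i. l i - w (r n) i)"
      using p_add[of "w (r n)" "\<lambda>i. l i - w (r n) i"] by simp
    then show "p l \<le> 1 / real (Suc (r n)) + (\<Sum>j<k. \<bar>l j - w (r n) j\<bar> * h j)"
      using w(2)[of "r n"] p_le[of "\<lambda>i. l i - w (r n) i"] by linarith
  qed
  then have "p l = 0" using p_nonneg[of l] by simp
  then have "\<bar>l j\<bar> = 0" if "j < k" for j using p_definite[of l j] that by simp
  then have "(\<Sum>j<k. \<bar>l j\<bar>) = 0" by (intro sum.neutral) auto
  then show False using suml by simp
qed

definition dt :: "(nat \<Rightarrow> nat \<Rightarrow> real) \<Rightarrow> real"
  where "dt S = Determinant.det (mat k k (\<lambda>(i, j). S i j))"

text \<open>\<open>S\<close> maps the Euclidean ball into the unit ball of \<open>p\<close>. Such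
  \<open>S\<close> parametrize the ellipsoids inside the unit ball, and |dt S| is proportional to
  their volume.\<close>

definition ellipsoid :: "(nat \<Rightarrow> nat \<Rightarrow> real) \<Rightarrow> bool"
  where "ellipsoid S \<longleftrightarrow> (\<forall>y. p (\<lambda>i. \<Sum>j<k. S i j * y j) \<le> l2 k y)"

text \<open>The columns of \<open>S\<close> lie in the unit ball of \<open>p\<close>, so
  \<open>coordinate_bound\<close> limits the entries, and the Leibniz formula limits the
  determinant.\<close>

lemma dt_bounded: "\<exists>M. \<forall>S. ellipsoid S \<longrightarrow> \<bar>dt S\<bar> \<le> M"
proof -
  obtain K where K: "K > 0" "\<And>x i. i < k \<Longrightarrow> \<bar>x i\<bar> \<le> K * p x" using coordinate_bound by blast
  have "\<bar>dt S\<bar> \<le> (\<Sum>q | q permutes {0..<k}. K ^ k)" if S: "ellipsoid S" for S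
  proof -
    have ent: "\<bar>S i j\<bar> \<le> K" if "i < k" "j < k" for i j
    proof -
      let ?y = "\<lambda>m. if m = j then 1 else 0 :: real"
      have col: "(\<Sum>m<k. S i m * ?y m) = S i j" for i using that by (simp add: if_distrib[of "\<lambda>z. _ * z"] cong: if_cong)
      have "p (\<lambda>i. \<Sum>m<k. S i m * ?y m) \<le> l2 k ?y" by (rule S[unfolded ellipsoid_def, rule_format])
      also have "l2 k ?y = 1" using that by (simp add: l2_def if_distrib[of "\<lambda>z. z\<^sup>2"] cong: if_cong)
      finally have "p (\<lambda>i. S i j) \<le> 1" unfolding col .
      then have "K * p (\<lambda>i. S i j) \<le> K * 1" using K(1) by (intro mult_left_mono) auto
      then show ?thesis using K(2)[OF that(1), of "\<lambda>i. S i j"] by simp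
    qed
    have "dt S = (\<Sum>q | q permutes {0..<k}. of_int (sign q) * (\<Prod>i = 0..<k. mat k k (\<lambda>(i, j). S i j) $$ (i, q i)))"
      unfolding dt_def by (rule det_def') simp
    also have "\<bar>\<dots>\<bar> \<le> (\<Sum>q | q permutes {0..<k}. K ^ k)"
    proof (rule order_trans[OF sum_abs sum_mono])
      fix q assume "q \<in> {q. q permutes {0..<k}}"
      then have q: "q permutes {0..<k}" by simp
      then have "q i < k" if "i < k" for i using that permutes_in_image[OF q, of i] by simp
      then have "\<bar>\<Prod>i = 0..<k. mat k k (\<lambda>(i, j). S i j) $$ (i, q i)\<bar> \<le> (\<Prod>i = 0..<k. K)"
        unfolding abs_prod by (intro prod_mono) (auto simp: ent)
      then show "\<bar>of_int (sign q) * (\<Prod>i = 0..<k. mat k k (\<lambda>(i, j). S i j) $$ (i, q i))\<bar> \<le> K ^ k"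
        by (simp add: abs_mult sign_def)
    qed
    finally show ?thesis .
  qed
  then show ?thesis by blast
qed

lemma dt_positive: "\<exists>S. ellipsoid S \<and> dt S > 0"
proof -
  define A where "A = 1 + (\<Sum>i<k. \<bar>h i\<bar>)"
  have A: "A > 0" by (simp add: A_def sum_nonneg add_pos_nonneg)
  define S where "S i j = (if i = j then 1 / A else 0)" for i j :: nat
  have "p (\<lambda>i. \<Sum>j<k. S i j * y j) \<le> l2 k y" for y
  proof -
    have Sy: "(\<Sum>j<k. S i j * y j) = y i / A" if "i < k" for i
      using that by (simp add: S_def if_distrib[of "\<lambda>z. z * _"] cong: if_cong)
    have yi: "\<bar>y i\<bar> \<le> l2 k y" if "i < k" for i
      using member_le_L2_set[of "{..<k}" i "\<lambda>i. \<bar>y i\<bar>"] that by (simp add: L2_set_def l2_def)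
    have "p (\<lambda>i. \<Sum>j<k. S i j * y j) \<le> (\<Sum>i<k. \<bar>\<Sum>j<k. S i j * y j\<bar> * h i)" by (rule p_le)
    also have "\<dots> \<le> (\<Sum>i<k. l2 k y / A * \<bar>h i\<bar>)"
    proof (rule sum_mono)
      fix i assume "i \<in> {..<k}"
      then have "\<bar>\<Sum>j<k. S i j * y j\<bar> \<le> l2 k y / A" using A yi[of i] Sy[of i] by (simp add: divide_right_mono)
      then have "\<bar>\<Sum>j<k. S i j * y j\<bar> * \<bar>h i\<bar> \<le> l2 k y / A * \<bar>h i\<bar>" by (rule mult_right_mono) simp
      then show "\<bar>\<Sum>j<k. S i j * y j\<bar> * h i \<le> l2 k y / A * \<bar>h i\<bar>"
        by (smt (verit) abs_ge_zero mult_left_mono)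
    qed
    also have "\<dots> = l2 k y * ((A - 1) / A)" by (simp add: A_def sum_distrib_left sum_divide_distrib)
    also have "\<dots> \<le> l2 k y * 1" using A by (intro mult_left_mono) auto
    finally show ?thesis by simp
  qed
  moreover have "dt S > 0"
  proof -
    have "mat k k (\<lambda>(i, j). S i j) = (1 / A) \<cdot>\<^sub>m 1\<^sub>m k" by (rule eq_matI) (auto simp: S_def)
    then show ?thesis using A by (simp add: dt_def)
  qed
  ultimately show ?thesis unfolding ellipsoid_def by blast
qed

text \<open>If some \<open>u\<close> on the Euclidean sphere has small \<open>p\<close>-norm under a nearly maximal ellipsoid, then
  stretching along \<open>u\<close> and shrinking slightly in the orthogonal directions gives an ellipsoid of
  substantially larger determinant.\<close>

lemma near_maximal_ellipsoid_stretch: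
  assumes k: "k \<ge> 1" and S: "ellipsoid S" and u: "(\<Sum>i<k. (u i)\<^sup>2) = 1"
    and small: "p (\<lambda>i. \<Sum>j<k. S i j * u j) \<le> 1 / sqrt (8 * k)"
  shows "\<exists>S'. ellipsoid S' \<and> 2 * (dt S)\<^sup>2 \<le> (dt S')\<^sup>2"
proof -
  \<comment> \<open>\<open>R\<close> doubles \<open>u\<close> and multiplies its orthogonal
    complement by \<open>b\<close>. The smallness of \<open>p\<close> at \<open>S u\<close> turns
    the doubled part into \<open>sqrt \<eta> * |q|\<close>, and b^2 + \<eta> = 1 lets Cauchy-Schwarz
    keep the new ellipsoid in the unit ball. The squared determinant of \<open>R\<close> is 4 * (1 -
    \<eta>)^(k - 1), at least 2 by Bernoulli since (k - 1) * \<eta> <= 1/2.\<close>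
  define \<eta> where "\<eta> = 1 / (2 * real k)"
  have \<eta>: "0 < \<eta>" "\<eta> \<le> 1/2" using k by (auto simp: \<eta>_def field_simps)
  define b where "b = sqrt (1 - \<eta>)"
  have b: "b > 0" "b\<^sup>2 = 1 - \<eta>" using \<eta> by (auto simp: b_def)
  define R where "R i j = (if i = j then b else 0) + (2 - b) * u i * u j" for i j
  define S' where "S' i j = (\<Sum>m<k. S i m * R m j)" for i j
  have "ellipsoid S'"
    unfolding ellipsoid_def
  proof
    fix y :: "nat \<Rightarrow> real"
    define q where "q = (\<Sum>j<k. u j * y j)"
    define z where "z j = y j - q * u j" for j
    have Ry: "(\<Sum>j<k. R i j * y j) = b * z i + 2 * q * u i" if "i < k" for i
    proof -
      have "(\<Sum>j<k. R i j * y j) = (\<Sum>j<k. if i = j then b * y j else 0) + (\<Sum>j<k. (2 - b) * u i * (u j * y j))"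
        unfolding R_def sum.distrib[symmetric] by (intro sum.cong) (auto simp: algebra_simps)
      also have "\<dots> = b * y i + (2 - b) * u i * q"
        using that by (simp add: q_def sum_distrib_left)
      finally show ?thesis by (simp add: z_def algebra_simps)
    qed
    have S'y: "(\<Sum>j<k. S' i j * y j) = b * (\<Sum>j<k. S i j * z j) + 2 * q * (\<Sum>j<k. S i j * u j)" for i
    proof -
      have "(\<Sum>j<k. S' i j * y j) = (\<Sum>m<k. S i m * (\<Sum>j<k. R m j * y j))"
        unfolding S'_def by (simp add: sum_distrib_left sum_distrib_right mult_ac) (rule sum.swap)
      also have "\<dots> = (\<Sum>m<k. S i m * (b * z m + 2 * q * u m))" by (intro sum.cong) (auto simp: Ry)
      finally show ?thesis by (simp add: sum_distrib_left sum.distrib algebra_simps)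
    qed
    have zz: "(l2 k z)\<^sup>2 + q\<^sup>2 = (l2 k y)\<^sup>2"
    proof -
      have "(l2 k z)\<^sup>2 = (\<Sum>j<k. (y j)\<^sup>2 - 2 * q * (u j * y j) + q\<^sup>2 * (u j)\<^sup>2)"
        unfolding l2_square z_def by (intro sum.cong) (auto simp: power2_eq_square algebra_simps)
      also have "\<dots> = (\<Sum>j<k. (y j)\<^sup>2) - 2 * q * q + q\<^sup>2 * 1"
        by (simp add: sum.distrib sum_subtractf sum_distrib_left[symmetric] u q_def[symmetric])
      finally show ?thesis by (simp add: l2_square[of k y] power2_eq_square[of q])
    qed
    have "p (\<lambda>i. \<Sum>j<k. S' i j * y j) \<le> p (\<lambda>i. b * (\<Sum>j<k. S i j * z j)) + p (\<lambda>i. 2 * q * (\<Sum>j<k. S i j * u j))"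
      unfolding S'y by (rule p_add)
    also have "\<dots> \<le> b * l2 k z + sqrt \<eta> * \<bar>q\<bar>"
    proof (rule add_mono)
      show "p (\<lambda>i. b * (\<Sum>j<k. S i j * z j)) \<le> b * l2 k z"
        using S b unfolding p_scale ellipsoid_def by (simp add: mult_left_mono)
      have "p (\<lambda>i. 2 * q * (\<Sum>j<k. S i j * u j)) \<le> \<bar>2 * q\<bar> * (1 / sqrt (8 * k))"
        unfolding p_scale by (intro mult_left_mono small) auto
      also have "\<dots> = sqrt \<eta> * \<bar>q\<bar>"
      proof -
        have "sqrt (8 * real k) = sqrt (4 * (2 * real k))" by simp
        also have "\<dots> = 2 * sqrt (2 * real k)" by (simp only: real_sqrt_mult real_sqrt_four)
        finally have "sqrt (8 * real k) = 2 * sqrt (2 * real k)" .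
        then show ?thesis by (simp add: \<eta>_def real_sqrt_divide abs_mult)
      qed
      finally show "p (\<lambda>i. 2 * q * (\<Sum>j<k. S i j * u j)) \<le> sqrt \<eta> * \<bar>q\<bar>" .
    qed
    also have "\<dots> \<le> sqrt (b\<^sup>2 + (sqrt \<eta>)\<^sup>2) * sqrt ((l2 k z)\<^sup>2 + \<bar>q\<bar>\<^sup>2)"
      unfolding real_sqrt_mult[symmetric]
    proof (rule real_le_rsqrt)
      have "0 \<le> (b * \<bar>q\<bar> - sqrt \<eta> * l2 k z)\<^sup>2" by simp
      then show "(b * l2 k z + sqrt \<eta> * \<bar>q\<bar>)\<^sup>2 \<le> (b\<^sup>2 + (sqrt \<eta>)\<^sup>2) * ((l2 k z)\<^sup>2 + \<bar>q\<bar>\<^sup>2)"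
        by (simp add: power2_sum power2_diff power_mult_distrib distrib_right distrib_left mult_ac)
    qed
    also have "\<dots> = l2 k y" using b \<eta> zz by simp
    finally show "p (\<lambda>i. \<Sum>j<k. S' i j * y j) \<le> l2 k y" .
  qed
  moreover have "2 * (dt S)\<^sup>2 \<le> (dt S')\<^sup>2"
  proof -
    have "mat k k (\<lambda>(i, j). S' i j) = mat k k (\<lambda>(i, j). S i j) * mat k k (\<lambda>(i, j). R i j)"
      by (rule eq_matI) (auto simp: S'_def scalar_prod_def atLeast0LessThan)
    then have "dt S' = dt S * dt R" unfolding dt_def by (simp only:) (rule Determinant.det_mult, auto)
    moreover have "2 \<le> (dt R)\<^sup>2"
    proof -
      have "dt R = (1 + (\<Sum>i<k. u i * ((2 - b) * u i)) / b) * b ^ k"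
        unfolding dt_def R_def using det_scalar_plus_rank_one[of b k "\<lambda>i. (2 - b) * u i" u] b(1) by simp
      also have "(\<Sum>i<k. u i * ((2 - b) * u i)) = (2 - b) * (\<Sum>i<k. (u i)\<^sup>2)"
        by (simp add: sum_distrib_left power2_eq_square mult_ac)
      also have "(1 + (2 - b) * (\<Sum>i<k. (u i)\<^sup>2) / b) * b ^ k = 2 * b ^ (k - 1)"
      proof -
        have "b ^ k = b * b ^ (k - 1)" using k by (cases k) auto
        moreover have "(1 + (2 - b) * 1 / b) * (b * X) = 2 * X" for X using b(1) by (simp add: field_simps)
        ultimately show ?thesis by (simp only: u)
      qed
      finally have dR: "dt R = 2 * b ^ (k - 1)" .
      have "(dt R)\<^sup>2 = 4 * (b\<^sup>2) ^ (k - 1)"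
        unfolding dR power_mult_distrib power_mult[symmetric] mult.commute[of "k - 1"] by simp
      then have "(dt R)\<^sup>2 = 4 * (1 - \<eta>) ^ (k - 1)" unfolding b(2) .
      moreover have "1 + real (k - 1) * (- \<eta>) \<le> (1 + (- \<eta>)) ^ (k - 1)"
        using \<eta> by (intro Bernoulli_inequality) auto
      moreover have "real (k - 1) * \<eta> \<le> 1/2" using k by (simp add: \<eta>_def field_simps)
      ultimately show ?thesis by simp
    qed
    then have "(dt S)\<^sup>2 * 2 \<le> (dt S)\<^sup>2 * (dt R)\<^sup>2" by (intro mult_left_mono) auto
    ultimately show ?thesis by (simp add: power_mult_distrib mult.commute)
  qed
  ultimately show ?thesis by blast
qed

lemma john_ellipsoid:
  assumes k: "k \<ge> 1"
  obtains S where "\<And>y. p (\<lambda>i. \<Sum>j<k. S i j * y j) \<le> l2 k y"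
    "\<And>y. l2 k y \<le> sqrt (8 * k) * p (\<lambda>i. \<Sum>j<k. S i j * y j)"
proof -
  define M where "M = (SUP S\<in>Collect ellipsoid. (dt S)\<^sup>2)"
  obtain B where B: "\<And>S. ellipsoid S \<Longrightarrow> \<bar>dt S\<bar> \<le> B" using dt_bounded by blast
  have bdd: "bdd_above ((\<lambda>S. (dt S)\<^sup>2) ` Collect ellipsoid)"
  proof (rule bdd_aboveI2)
    fix S assume "S \<in> Collect ellipsoid"
    then have "\<bar>dt S\<bar>\<^sup>2 \<le> B\<^sup>2" using B by (intro power_mono) auto
    then show "(dt S)\<^sup>2 \<le> B\<^sup>2" by simp
  qed
  have le: "(dt S)\<^sup>2 \<le> M" if "ellipsoid S" for S
    unfolding M_def using that by (intro cSUP_upper bdd) auto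
  obtain S0 where S0: "ellipsoid S0" "dt S0 > 0" using dt_positive by blast
  then have M0: "M > 0" using le[OF S0(1)] by (smt (verit) zero_less_power)
  then have "M / 2 < M" by simp
  then obtain S where S: "ellipsoid S" "M / 2 < (dt S)\<^sup>2"
    unfolding M_def using less_cSUP_iff[OF _ bdd, of "M / 2"] S0 by (auto simp: M_def)
  show ?thesis
  proof (rule that[of S])
    show "p (\<lambda>i. \<Sum>j<k. S i j * y j) \<le> l2 k y" for y using S(1) unfolding ellipsoid_def by blast
    show "l2 k y \<le> sqrt (8 * k) * p (\<lambda>i. \<Sum>j<k. S i j * y j)" for y
    proof (rule ccontr)
      assume neg: "\<not> ?thesis"
      have kpos: "sqrt (8 * real k) > 0" using k by simp
      have "0 \<le> sqrt (8 * real k) * p (\<lambda>i. \<Sum>j<k. S i j * y j)" by (simp add: p_nonneg)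
      then have y0: "l2 k y > 0" using neg by auto
      define u where "u j = inverse (l2 k y) * y j" for j
      have "(\<Sum>i<k. (u i)\<^sup>2) = 1"
        using y0 by (simp add: u_def power_mult_distrib sum_distrib_left[symmetric] l2_square[symmetric] power_inverse)
      moreover have "p (\<lambda>i. \<Sum>j<k. S i j * u j) \<le> 1 / sqrt (8 * k)"
      proof -
        have "(\<Sum>j<k. S i j * u j) = inverse (l2 k y) * (\<Sum>j<k. S i j * y j)" for i
          by (simp add: u_def sum_distrib_left mult_ac)
        then have "p (\<lambda>i. \<Sum>j<k. S i j * u j) = inverse (l2 k y) * p (\<lambda>i. \<Sum>j<k. S i j * y j)"
          using y0 by (simp only: p_scale) simp
        moreover have "sqrt (8 * k) * p (\<lambda>i. \<Sum>j<k. S i j * y j) < l2 k y" using neg by simp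
        from this have "inverse (l2 k y) * p (\<lambda>i. \<Sum>j<k. S i j * y j) \<le> inverse (l2 k y) * (l2 k y / sqrt (8 * k))"
          using y0 kpos by (intro mult_left_mono) (auto simp: pos_le_divide_eq mult.commute)
        ultimately show ?thesis using y0 by simp
      qed
      ultimately obtain S' where "ellipsoid S'" "2 * (dt S)\<^sup>2 \<le> (dt S')\<^sup>2"
        using near_maximal_ellipsoid_stretch[OF k S(1)] by blast
      then show False using le[of S'] S(2) by simp
    qed
  qed
qed

end

text \<open>The images \<open>e j\<close> of the unit vectors under an isomorphism from Euclidean
  space onto \<open>E\<close> of distortion at most \<open>sqrt (8 * k)\<close>.\<close>

definition john_frame :: "('a::real_vector \<Rightarrow> real) \<Rightarrow> 'a set \<Rightarrow> nat \<Rightarrow> (nat \<Rightarrow> 'a) \<Rightarrow> bool"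
  where "john_frame N E k e \<longleftrightarrow> (\<forall>j<k. e j \<in> E) \<and> (\<forall>x\<in>E. \<exists>y. x = (\<Sum>j<k. y j *\<^sub>R e j)) \<and>
    (\<forall>y. N (\<Sum>j<k. y j *\<^sub>R e j) \<le> l2 k y \<and> l2 k y \<le> sqrt (8 * k) * N (\<Sum>j<k. y j *\<^sub>R e j))"

lemma l2_eq_0D: "l2 k y = 0 \<Longrightarrow> j < k \<Longrightarrow> y j = 0"
  by (auto simp: l2_def sum_nonneg_eq_0_iff)

lemma (in normed_space_on) john_frame_exists:
  assumes E: "subspace E" "E \<subseteq> V" and dim: "dim E = k" and k: "k \<ge> 1"
  obtains e where "john_frame N E k e"
proof -
  obtain B where B: "B \<subseteq> E" "independent B" "E \<subseteq> span B" "card B = dim E"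
    using basis_exists by blast
  have finB: "finite B" using B(4) dim k by (intro card_ge_0_finite) simp
  obtain b where b: "bij_betw b {..<k} B"
    using ex_bij_betw_nat_finite[OF finB] B(4) dim by (auto simp: atLeast0LessThan)
  have bE: "b i \<in> E" if "i < k" for i using b B(1) that by (auto simp: bij_betw_def)
  have sumE: "(\<Sum>i<k. v i *\<^sub>R b i) \<in> E" for v
    using E(1) bE by (intro subspace_sum subspace_scale) auto
  define p where "p v = N (\<Sum>i<k. v i *\<^sub>R b i)" for v
  interpret fin_norm k p "\<lambda>i. N (b i)"
  proof
    show "p (\<lambda>i. x i + x' i) \<le> p x + p x'" for x x'
      using norm_triangle[of "\<Sum>i<k. x i *\<^sub>R b i" "\<Sum>i<k. x' i *\<^sub>R b i"] sumE E(2)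
      by (auto simp: p_def scaleR_add_left sum.distrib)
    show "p (\<lambda>i. c * x i) = \<bar>c\<bar> * p x" for c x
    proof -
      have "(\<Sum>i<k. (c * x i) *\<^sub>R b i) = c *\<^sub>R (\<Sum>i<k. x i *\<^sub>R b i)"
        by (simp add: scaleR_sum_right)
      then show ?thesis using norm_scale sumE[of x] E(2) by (auto simp: p_def)
    qed
    show "p x \<le> (\<Sum>i<k. \<bar>x i\<bar> * N (b i))" for x
    proof -
      have "N (\<Sum>i\<in>I. x i *\<^sub>R b i) \<le> (\<Sum>i\<in>I. \<bar>x i\<bar> * N (b i)) \<and> (\<Sum>i\<in>I. x i *\<^sub>R b i) \<in> V"
        if "finite I" "I \<subseteq> {..<k}" for I
        using that
      proof (induction I)
        case empty
        have "0 \<in> V" using subspace_carrier by (rule subspace_0)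
        then show ?case using norm_eq_zero_iff[of 0] by simp
      next
        case (insert i I)
        have bi: "b i \<in> V" using insert bE E(2) by auto
        then have xi: "x i *\<^sub>R b i \<in> V" using subspace_carrier by (simp add: subspace_scale)
        have "N (x i *\<^sub>R b i + (\<Sum>i\<in>I. x i *\<^sub>R b i)) \<le> N (x i *\<^sub>R b i) + N (\<Sum>i\<in>I. x i *\<^sub>R b i)"
          using insert xi by (intro norm_triangle) auto
        then show ?case using insert norm_scale[OF bi, of "x i"] xi subspace_carrier
          by (auto simp: subspace_add)
      qed
      from this[of "{..<k}"] show ?thesis by (simp add: p_def)
    qed
    show "x i = 0" if "p x = 0" "i < k" for x i
    proof -
      let ?c = "\<lambda>v. x (the_inv_into {..<k} b v)"
      have "(\<Sum>i<k. x i *\<^sub>R b i) = 0" using that norm_eq_zero_iff sumE[of x] E(2) by (auto simp: p_def)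
      moreover have "(\<Sum>v\<in>B. ?c v *\<^sub>R v) = (\<Sum>i<k. ?c (b i) *\<^sub>R b i)"
        by (rule sum.reindex_bij_betw[OF b, symmetric])
      moreover have inv: "?c (b i) = x i" if "i < k" for i
        using b that by (simp add: the_inv_into_f_f bij_betw_def)
      ultimately have "(\<Sum>v\<in>B. ?c v *\<^sub>R v) = 0" by simp
      moreover have "b i \<in> B" using b that by (auto simp: bij_betw_def)
      ultimately have "?c (b i) = 0" using independentD[OF B(2) finB subset_refl, of ?c "b i"] by blast
      then show ?thesis using inv that by simp
    qed
  qed
  obtain S where S: "\<And>y. p (\<lambda>i. \<Sum>j<k. S i j * y j) \<le> l2 k y"
    "\<And>y. l2 k y \<le> sqrt (8 * k) * p (\<lambda>i. \<Sum>j<k. S i j * y j)"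
    using john_ellipsoid[OF k] by blast
  define e where "e j = (\<Sum>i<k. S i j *\<^sub>R b i)" for j
  have eE: "e j \<in> E" for j unfolding e_def by (rule sumE)
  have "(\<Sum>j<k. y j *\<^sub>R e j) = (\<Sum>i<k. (\<Sum>j<k. S i j * y j) *\<^sub>R b i)" for y
    unfolding e_def scaleR_sum_right scaleR_sum_left
    by (subst sum.swap) (simp add: mult.commute)
  then have Ne: "N (\<Sum>j<k. y j *\<^sub>R e j) = p (\<lambda>i. \<Sum>j<k. S i j * y j)" for y by (simp add: p_def)
  \<comment> \<open>The lower estimate makes the coordinates with respect to \<open>e\<close>
    unique. The \<open>k\<close> vectors are therefore distinct and independent, and they span
    \<open>E\<close> by dimension; invertibility of \<open>S\<close> is never invoked.\<close>
  have zero: "y j = 0" if "(\<Sum>j<k. y j *\<^sub>R e j) = 0" "j < k" for y j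
  proof -
    have "0 \<in> V" using subspace_carrier by (rule subspace_0)
    then have "N 0 = 0" using norm_eq_zero_iff by blast
    then have "p (\<lambda>i. \<Sum>j<k. S i j * y j) = 0" using Ne[of y] that by simp
    then have "l2 k y \<le> 0" using S(2)[of y] by simp
    then show ?thesis using l2_eq_0D[of k y j] that l2_nonneg[of k y] by linarith
  qed
  have inj: "inj_on e {..<k}"
  proof (rule inj_onI)
    fix i j assume ij: "i \<in> {..<k}" "j \<in> {..<k}" "e i = e j"
    define y :: "nat \<Rightarrow> real" where "y m = (if m = i then 1 else 0) - (if m = j then 1 else 0)" for m
    have "(\<Sum>m<k. y m *\<^sub>R e m) = (\<Sum>m<k. if m = i then e m else 0) - (\<Sum>m<k. if m = j then e m else 0)"
      unfolding sum_subtractf[symmetric] by (intro sum.cong) (auto simp: y_def)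
    also have "\<dots> = 0" using ij by simp
    finally have "y i = 0" using zero[of y i] ij by simp
    then show "i = j" by (auto simp: y_def split: if_splits)
  qed
  have ind: "independent (e ` {..<k})"
  proof
    assume "dependent (e ` {..<k})"
    then obtain c v where c: "v \<in> e ` {..<k}" "c v \<noteq> 0" "(\<Sum>v\<in>e ` {..<k}. c v *\<^sub>R v) = 0"
      by (auto simp: dependent_finite)
    then obtain j where j: "j < k" "v = e j" by auto
    have "(\<Sum>j<k. c (e j) *\<^sub>R e j) = 0" using c(3) by (simp add: sum.reindex[OF inj])
    then have "c (e j) = 0" using zero[of "\<lambda>j. c (e j)" j] j by simp
    then show False using c j by simp
  qed
  have sp: "x \<in> span (e ` {..<k})" if x: "x \<in> E" for x
  proof (rule ccontr)
    assume nx: "x \<notin> span (e ` {..<k})"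
    then have "independent (insert x (e ` {..<k}))" using ind by (simp add: independent_insert)
    moreover have "insert x (e ` {..<k}) \<subseteq> span B" using B(3) eE x by auto
    ultimately have "card (insert x (e ` {..<k})) \<le> card B"
      using independent_span_bound[OF finB] by blast
    moreover have "x \<notin> e ` {..<k}" using nx by (metis span_base)
    then have "card (insert x (e ` {..<k})) = Suc k"
      using card_image[OF inj] by (subst card_insert_disjoint) auto
    ultimately show False using B(4) dim by linarith
  qed
  have "\<exists>y. x = (\<Sum>j<k. y j *\<^sub>R e j)" if x: "x \<in> E" for x
  proof -
    have "finite (e ` {..<k})" by simp
    from sp[OF x, unfolded span_finite[OF this]]
    obtain c where "x = (\<Sum>v\<in>e ` {..<k}. c v *\<^sub>R v)" by (rule rangeE)
    then have "x = (\<Sum>j<k. c (e j) *\<^sub>R e j)" by (simp add: sum.reindex[OF inj])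
    then show ?thesis by (intro exI[of _ "\<lambda>j. c (e j)"])
  qed
  then have "john_frame N E k e"
    unfolding john_frame_def Ne using eE S by blast
  then show ?thesis by (rule that)
qed

text \<open>Both spaces are compared with Euclidean space: \<open>T\<close> carries a John frame of
  \<open>E\<close> to one of \<open>F\<close>, and each direction costs
  \<open>sqrt (8 * k)\<close>.\<close>

lemma (in normed_space_on) banach_mazur_dist_le:
  assumes E: "subspace E" "E \<subseteq> V" "dim E = k" and F: "subspace F" "F \<subseteq> V" "dim F = k"
    and k: "k \<ge> 1"
  shows "banach_mazur_dist N E F \<le> ereal (8 * real k)"
proof -
  obtain e where e: "john_frame N E k e" using john_frame_exists[OF E k] .
  obtain f where f: "john_frame N F k f" using john_frame_exists[OF F k] .
  define lc where "lc u y = (\<Sum>j<k. y j *\<^sub>R u j)" for u :: "nat \<Rightarrow> 'a" and y :: "nat \<Rightarrow> real"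
  have N0: "N 0 = 0" using subspace_0[OF subspace_carrier] norm_eq_zero_iff by blast
  have uniq: "y j = y' j" if "john_frame N G k u" "lc u y = lc u y'" "j < k" for G u y y' j
  proof -
    have "lc u (\<lambda>j. y j - y' j) = 0"
      using that(2) by (simp add: lc_def scaleR_diff_left sum_subtractf)
    then have "l2 k (\<lambda>j. y j - y' j) \<le> 0"
      using that(1) N0 unfolding john_frame_def lc_def by (metis mult_zero_right)
    then show ?thesis using l2_eq_0D[of k "\<lambda>j. y j - y' j" j] l2_nonneg[of k "\<lambda>j. y j - y' j"] that(3) by linarith
  qed
  have lcE: "lc e y \<in> E" for y
    unfolding lc_def using e E(1) by (intro subspace_sum subspace_scale) (auto simp: john_frame_def)
  have lcF: "lc f y \<in> F" for y
    unfolding lc_def using f F(1) by (intro subspace_sum subspace_scale) (auto simp: john_frame_def)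
  have lc_cong: "lc u y = lc u y'" if "\<And>j. j < k \<Longrightarrow> y j = y' j" for u y y'
    using that by (simp add: lc_def)
  define c where "c x = (SOME y. x = lc e y)" for x
  have c: "x = lc e (c x)" if "x \<in> E" for x
    using e that someI_ex[of "\<lambda>y. x = lc e y"] unfolding c_def john_frame_def lc_def by blast
  define T where "T x = lc f (c x)" for x
  have Tlc: "T (lc e y) = lc f y" for y
    unfolding T_def using uniq[OF e c[OF lcE, symmetric]] by (intro lc_cong) auto
  have add: "lc u (\<lambda>j. y j + y' j) = lc u y + lc u y'" for u y y'
    by (simp add: lc_def scaleR_add_left sum.distrib)
  have scale: "lc u (\<lambda>j. a * y j) = a *\<^sub>R lc u y" for u a y
    by (simp add: lc_def scaleR_sum_right)
  have lin: "linear_between E F T"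
    unfolding linear_between_def
  proof (intro conjI ballI allI)
    show "T ` E \<subseteq> F" using lcF by (auto simp: T_def)
    show "T (x + y) = T x + T y" if "x \<in> E" "y \<in> E" for x y
      using c[OF that(1)] c[OF that(2)] Tlc add by metis
    show "T (a *\<^sub>R x) = a *\<^sub>R T x" if "x \<in> E" for a x
      using c[OF that(1)] Tlc scale by metis
  qed
  have bij: "bij_betw T E F"
  proof (rule bij_betwI')
    show "T x = T y \<longleftrightarrow> x = y" if "x \<in> E" "y \<in> E" for x y
    proof
      assume "T x = T y"
      then have "lc e (c x) = lc e (c y)" unfolding T_def using uniq[OF f] by (intro lc_cong) blast
      then show "x = y" using c that by metis
    qed simp
    show "T x \<in> F" if "x \<in> E" for x by (simp add: T_def lcF)
    show "\<exists>x\<in>E. z = T x" if "z \<in> F" for z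
    proof -
      obtain y where "z = lc f y" using f \<open>z \<in> F\<close> unfolding john_frame_def lc_def by blast
      then show ?thesis using Tlc[of y] lcE[of y] by metis
    qed
  qed
  have est: "N (T x) \<le> sqrt (8 * k) * N x" "N x \<le> sqrt (8 * k) * N (T x)" if x: "x \<in> E" for x
  proof -
    have "N (lc e (c x)) \<le> l2 k (c x)" "l2 k (c x) \<le> sqrt (8 * k) * N (lc e (c x))"
      using e unfolding john_frame_def lc_def by blast+
    moreover have "N (lc f (c x)) \<le> l2 k (c x)" "l2 k (c x) \<le> sqrt (8 * k) * N (lc f (c x))"
      using f unfolding john_frame_def lc_def by blast+
    ultimately show "N (T x) \<le> sqrt (8 * k) * N x" "N x \<le> sqrt (8 * k) * N (T x)"
      using c[OF x] unfolding T_def by auto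
  qed
  have s0: "sqrt (8 * real k) \<ge> 0" by simp
  have op1: "op_norm N E T \<le> ereal (sqrt (8 * real k))"
    unfolding op_norm_def
  proof (rule SUP_least)
    fix x assume x: "x \<in> {x \<in> E. N x \<le> 1}"
    then have "sqrt (8 * real k) * N x \<le> sqrt (8 * real k) * 1" using s0 by (intro mult_left_mono) auto
    then show "ereal (N (T x)) \<le> ereal (sqrt (8 * real k))" using est(1)[of x] x by simp
  qed
  have op2: "op_norm N F (inv_into E T) \<le> ereal (sqrt (8 * real k))"
    unfolding op_norm_def
  proof (rule SUP_least)
    fix z assume z: "z \<in> {x \<in> F. N x \<le> 1}"
    define x where "x = inv_into E T z"
    have "x \<in> E" "T x = z" using z bij unfolding x_def
      by (auto simp: bij_betw_def inv_into_into f_inv_into_f)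
    moreover have "sqrt (8 * real k) * N z \<le> sqrt (8 * real k) * 1" using s0 z by (intro mult_left_mono) auto
    ultimately show "ereal (N (inv_into E T z)) \<le> ereal (sqrt (8 * real k))"
      using est(2)[of x] by (simp add: x_def)
  qed
  \<comment> \<open>Products in \<open>ereal\<close> are monotone only for nonnegative factors;
    evaluating at 0 shows that neither supremum is negative.\<close>
  have "0 \<in> E" using E(1) by (rule subspace_0)
  moreover have "N (T 0) \<ge> 0" using lcF F(2) norm_nonneg by (auto simp: T_def)
  ultimately have op0: "0 \<le> op_norm N E T"
    unfolding op_norm_def using N0 by (intro SUP_upper2[of 0]) auto
  have "0 \<in> F" using F(1) by (rule subspace_0)
  moreover from this have "inv_into E T 0 \<in> E" using bij by (auto simp: bij_betw_def intro!: inv_into_into)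
  then have "N (inv_into E T 0) \<ge> 0" using E(2) norm_nonneg by auto
  ultimately have op0': "0 \<le> op_norm N F (inv_into E T)"
    unfolding op_norm_def using N0 by (intro SUP_upper2[of 0]) auto
  have "banach_mazur_dist N E F \<le> op_norm N E T * op_norm N F (inv_into E T)"
    unfolding banach_mazur_dist_def using lin bij by (intro INF_lower) auto
  also have "\<dots> \<le> ereal (sqrt (8 * real k)) * ereal (sqrt (8 * real k))"
    using op0 op0' op1 op2 s0 by (intro ereal_mult_mono) auto
  also have "\<dots> = ereal (8 * real k)" by simp
  finally show ?thesis .
qed

lemma (in normed_space_on) subspace_diameter_le:
  assumes "k \<ge> 1" shows "subspace_diameter V N k \<le> ereal (8 * real k)"
  unfolding subspace_diameter_def using banach_mazur_dist_le[OF _ _ _ _ _ _ assms]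
  by (intro SUP_least) auto

section \<open>Random matrices\<close>

definition lattice_l1_ball :: "nat \<Rightarrow> nat \<Rightarrow> (nat \<Rightarrow> int) set"
  where "lattice_l1_ball n s = {z \<in> {..<n} \<rightarrow>\<^sub>E {- int s..int s}. (\<Sum>i<n. \<bar>z i\<bar>) \<le> int s}"

lemma finite_lattice_l1_ball [simp]: "finite (lattice_l1_ball n s)"
  by (simp add: lattice_l1_ball_def finite_PiE)

lemma restrict_in_lattice_l1_ball:
  fixes z :: "nat \<Rightarrow> int"
  assumes "(\<Sum>i<n. \<bar>z i\<bar>) \<le> int s" shows "restrict z {..<n} \<in> lattice_l1_ball n s"
proof -
  have "\<bar>z i\<bar> \<le> int s" if "i < n" for i
    using member_le_sum[of i "{..<n}" "\<lambda>i. \<bar>z i\<bar>"] that assms by auto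
  then have "z i \<in> {- int s..int s}" if "i < n" for i using that by (fastforce simp: abs_le_iff)
  then show ?thesis using assms by (simp add: lattice_l1_ball_def)
qed

lemma sum_half_powers_le: "(\<Sum>a\<in>{- int s..int s}. (1/2::real) ^ nat \<bar>a\<bar>) \<le> 3"
proof -
  have "(\<Sum>a\<in>{- int s..int s}. (1/2::real) ^ nat \<bar>a\<bar>) = 3 - 2 * (1/2) ^ s"
  proof (induction s)
    case (Suc s)
    have "{- int (Suc s)..int (Suc s)} = insert (- int (Suc s)) (insert (int (Suc s)) {- int s..int s})" by auto
    then have "(\<Sum>a\<in>{- int (Suc s)..int (Suc s)}. (1/2::real) ^ nat \<bar>a\<bar>)
        = (1/2) ^ Suc s + ((1/2) ^ Suc s + (\<Sum>a\<in>{- int s..int s}. (1/2) ^ nat \<bar>a\<bar>))"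
      by (simp add: nat_add_distrib)
    then show ?case using Suc by simp
  qed simp
  then show ?thesis by simp
qed

text \<open>Generating function bound: give an integer point the weight 2 to the power - |z i| in
  each coordinate. The weights factorize and sum to at most 3^n, while each point of the ball weighs
  at least 2^(-s).\<close>

lemma card_lattice_l1_ball: "card (lattice_l1_ball n s) \<le> 2 ^ s * 3 ^ n"
proof -
  let ?P = "{..<n} \<rightarrow>\<^sub>E {- int s..int s}"
  have "(1/2::real) ^ s * card (lattice_l1_ball n s) = (\<Sum>z\<in>lattice_l1_ball n s. (1/2) ^ s)" by simp
  also have "\<dots> \<le> (\<Sum>z\<in>lattice_l1_ball n s. \<Prod>i<n. (1/2) ^ nat \<bar>z i\<bar>)"
  proof (rule sum_mono)
    fix z assume z: "z \<in> lattice_l1_ball n s"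
    have "int (\<Sum>i<n. nat \<bar>z i\<bar>) = (\<Sum>i<n. \<bar>z i\<bar>)" by simp
    also have "\<dots> \<le> int s" using z by (simp add: lattice_l1_ball_def)
    finally have "(\<Sum>i<n. nat \<bar>z i\<bar>) \<le> s" by (simp only: of_nat_le_iff)
    then have "(1/2::real) ^ s \<le> (1/2) ^ (\<Sum>i<n. nat \<bar>z i\<bar>)" by (intro power_decreasing) auto
    then show "(1/2::real) ^ s \<le> (\<Prod>i<n. (1/2) ^ nat \<bar>z i\<bar>)" by (simp add: power_sum)
  qed
  also have "\<dots> \<le> (\<Sum>z\<in>?P. \<Prod>i<n. (1/2) ^ nat \<bar>z i\<bar>)"
    by (intro sum_mono2 finite_PiE) (auto simp: lattice_l1_ball_def prod_nonneg)
  also have "\<dots> = (\<Prod>i<n. \<Sum>a\<in>{- int s..int s}. (1/2) ^ nat \<bar>a\<bar>)"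
    by (rule prod_sum_PiE[symmetric]) auto
  also have "\<dots> \<le> (\<Prod>i<n. 3)" by (intro prod_mono) (auto intro: sum_nonneg sum_half_powers_le)
  finally have "real (card (lattice_l1_ball n s)) \<le> 2 ^ s * 3 ^ n" by (simp add: power_divide field_simps)
  then have "real (card (lattice_l1_ball n s)) \<le> real (2 ^ s * 3 ^ n)" by simp
  then show ?thesis by (simp only: of_nat_le_iff)
qed

definition grid :: "nat \<Rightarrow> real set"
  where "grid L = (\<lambda>a. of_int a / real L) ` {- int L..int L}"

text \<open>A finite model of a matrix with independent entries spread evenly over [-1, 1].
  Extensional functions make it finite, and it factorizes over rows and entries.\<close>

definition grid_matrices :: "nat \<Rightarrow> nat \<Rightarrow> nat \<Rightarrow> (nat \<Rightarrow> nat \<Rightarrow> real) set"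
  where "grid_matrices k l L = {..<k} \<rightarrow>\<^sub>E ({..<l} \<rightarrow>\<^sub>E grid L)"

lemma finite_grid [simp]: "finite (grid L)" by (simp add: grid_def)

lemma finite_grid_matrices [simp]: "finite (grid_matrices k l L)"
  unfolding grid_matrices_def by (intro finite_PiE) auto

lemma inj_grid: "L > 0 \<Longrightarrow> inj_on (\<lambda>a. of_int a / real L) A"
  by (auto simp: inj_on_def)

lemma card_grid: "L > 0 \<Longrightarrow> card (grid L) = 2 * L + 1"
  by (simp add: grid_def card_image[OF inj_grid])

lemma card_grid_matrices: "card (grid_matrices k l L) = card (grid L) ^ (k * l)"
  by (simp add: grid_matrices_def card_PiE power_mult[symmetric] mult.commute)

lemma grid_uminus: "d \<in> grid L \<Longrightarrow> - d \<in> grid L"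
  unfolding grid_def by (auto simp: image_iff intro!: bexI[of _ "- _"])

lemma grid_subset: "L > 0 \<Longrightarrow> grid L \<subseteq> {-1..1}"
proof
  fix d assume L: "L > 0" and "d \<in> grid L"
  then obtain a where a: "- int L \<le> a" "a \<le> int L" "d = of_int a / real L" by (auto simp: grid_def)
  then have "- real L \<le> of_int a" "of_int a \<le> real L" by linarith+
  then have "-1 \<le> of_int a / real L" "of_int a / real L \<le> 1" using L by (auto simp: pos_le_divide_eq pos_divide_le_eq)
  then show "d \<in> {-1..1}" using a(3) by simp
qed

text \<open>This supplies \<open>\<eta> = 1/3\<close> for \<open>sum_PiE_cos_le\<close>.\<close>

lemma sum_squares_grid: "L > 0 \<Longrightarrow> 1/3 * real (card (grid L)) \<le> (\<Sum>d\<in>grid L. d\<^sup>2)"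
proof -
  assume L: "L > 0"
  have sq: "3 * (\<Sum>a\<in>{- int m..int m}. (of_int a)\<^sup>2) = real m * (real m + 1) * (2 * real m + 1)" for m
  proof (induction m)
    case (Suc m)
    have "{- int (Suc m)..int (Suc m)} = insert (- int (Suc m)) (insert (int (Suc m)) {- int m..int m})" by auto
    then have "(\<Sum>a\<in>{- int (Suc m)..int (Suc m)}. (of_int a)\<^sup>2)
        = 2 * (real m + 1)\<^sup>2 + (\<Sum>a\<in>{- int m..int m}. (of_int a)\<^sup>2)"
      by (simp add: power2_eq_square algebra_simps)
    then show ?case using Suc by (simp add: power2_eq_square algebra_simps)
  qed simp
  have "(\<Sum>d\<in>grid L. d\<^sup>2) = (\<Sum>a\<in>{- int L..int L}. (of_int a)\<^sup>2) / (real L)\<^sup>2"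
    unfolding grid_def by (simp add: sum.reindex[OF inj_grid[OF L]] power_divide sum_divide_distrib)
  also have "\<dots> = (real L * (real L + 1) * (2 * real L + 1)) / 3 / (real L)\<^sup>2"
    unfolding sq[of L, symmetric] by simp
  also have "\<dots> = (real L + 1) / real L * (2 * real L + 1) / 3" using L by (simp add: power2_eq_square)
  also have "\<dots> \<ge> 1 * (2 * real L + 1) / 3"
    using L by (intro divide_right_mono mult_right_mono) (auto simp: field_simps)
  finally show ?thesis using L by (simp add: card_grid)
qed

lemma grid_matrix_entries:
  assumes "G \<in> grid_matrices k l L" "L > 0" shows "entries_le_1 k l G"
  unfolding entries_le_1_def
proof (intro allI impI)
  fix i j assume "i < k" "j < l"
  then have "G i j \<in> grid L" using assms(1) by (auto simp: grid_matrices_def PiE_iff)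
  then show "\<bar>G i j\<bar> \<le> 1" using grid_subset[OF assms(2)] by (auto simp: abs_le_iff)
qed

lemma sum_grid_matrices:
  fixes f :: "(nat \<Rightarrow> real) \<Rightarrow> real"
  shows "(\<Sum>G\<in>grid_matrices k l L. \<Prod>i<k. f (G i)) = (\<Sum>r\<in>{..<l} \<rightarrow>\<^sub>E grid L. f r) ^ k"
proof -
  have "(\<Prod>i<k. \<Sum>r\<in>{..<l} \<rightarrow>\<^sub>E grid L. f r) = (\<Sum>G\<in>grid_matrices k l L. \<Prod>i<k. f (G i))"
    unfolding grid_matrices_def by (rule prod_sum_PiE) (auto intro: finite_PiE)
  then show ?thesis by simp
qed

section \<open>Exponential moments of the l1 norm of an image\<close>

lemma coord_le_l2: "j < l \<Longrightarrow> \<bar>y j\<bar> \<le> l2 l y"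
  using member_le_L2_set[of "{..<l}" j "\<lambda>j. \<bar>y j\<bar>"] by (simp add: L2_set_def l2_def)

definition l1_image :: "nat \<Rightarrow> nat \<Rightarrow> (nat \<Rightarrow> nat \<Rightarrow> real) \<Rightarrow> (nat \<Rightarrow> real) \<Rightarrow> real"
  where "l1_image k l G y = (\<Sum>i<k. \<bar>mat_vec l G y i\<bar>)"

text \<open>The rows are independent, and in one row exp |u| <= exp u + exp (- u) reduces the
  absolute value to the Laplace transform.\<close>

lemma sum_exp_l1_image_le:
  assumes L: "L > 0" and y: "l2 l y \<le> 1"
  shows "(\<Sum>G\<in>grid_matrices k l L. exp (l1_image k l G y)) \<le> card (grid_matrices k l L) * (2 * exp 1) ^ k"
proof -
  let ?R = "{..<l} \<rightarrow>\<^sub>E grid L" and ?c = "real (card (grid L))"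
  have y1: "\<bar>y j\<bar> \<le> 1" if "j < l" for j using coord_le_l2[OF that, of y] y by linarith
  have "(l2 l y)\<^sup>2 \<le> 1\<^sup>2" using y by (intro power_mono) auto
  then have y2: "(\<Sum>j<l. (y j)\<^sup>2) \<le> 1" by (simp add: l2_square)
  have one: "(\<Sum>r\<in>?R. exp (\<Sum>j<l. r j * z j)) \<le> ?c ^ l * exp 1" if "z = y \<or> z = (\<lambda>j. - y j)" for z
  proof -
    have "(\<Sum>r\<in>?R. exp (\<Sum>j<l. r j * z j)) \<le> ?c ^ card {..<l} * exp (\<Sum>j<l. (z j)\<^sup>2)"
      by (rule sum_PiE_exp_le) (use that y1 grid_uminus grid_subset[OF L] in auto)
    also have "\<dots> \<le> ?c ^ l * exp 1" using that y2 by (intro mult_mono) auto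
    finally show ?thesis .
  qed
  have "(\<Sum>r\<in>?R. exp \<bar>\<Sum>j<l. r j * y j\<bar>) \<le> (\<Sum>r\<in>?R. exp (\<Sum>j<l. r j * y j) + exp (\<Sum>j<l. r j * (- y j)))"
    by (intro sum_mono) (auto simp: abs_if sum_negf)
  also have "\<dots> \<le> ?c ^ l * exp 1 + ?c ^ l * exp 1"
    unfolding sum.distrib by (intro add_mono one) auto
  also have "\<dots> = ?c ^ l * (2 * exp 1)" by simp
  finally have row: "(\<Sum>r\<in>?R. exp \<bar>\<Sum>j<l. r j * y j\<bar>) \<le> ?c ^ l * (2 * exp 1)" .
  have "(\<Sum>G\<in>grid_matrices k l L. exp (l1_image k l G y)) = (\<Sum>r\<in>?R. exp \<bar>\<Sum>j<l. r j * y j\<bar>) ^ k"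
    unfolding sum_grid_matrices[symmetric] l1_image_def mat_vec_def by (simp add: exp_sum)
  also have "\<dots> \<le> (?c ^ l * (2 * exp 1)) ^ k"
    using row by (intro power_mono) (auto intro: sum_nonneg)
  also have "\<dots> = card (grid_matrices k l L) * (2 * exp 1) ^ k"
    unfolding card_grid_matrices by (simp add: power_mult_distrib power_mult[symmetric] mult.commute)
  finally show ?thesis .
qed

text \<open>Links the negative exponential moment, which controls small values of an l1 norm, to the
  characteristic function.\<close>

lemma exp_minus_le_cos: 
  assumes "0 \<le> (u::real)" shows "exp (- u) \<le> 1 - (1 - cos u) / 4"
proof -
  have "exp (- u) \<le> inverse (1 + u)"
    unfolding exp_minus using assms exp_ge_add_one_self[of u] by (intro le_imp_inverse_le) auto
  then have 1: "u / (1 + u) \<le> 1 - exp (- u)" using assms by (simp add: field_simps)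
  have "(1 - cos u) / 4 \<le> u / (1 + u)"
  proof (cases "u \<le> 1")
    case True
    have "(1 - cos u) / 4 \<le> u / 4" using one_minus_cos_le_abs[of u] assms by simp
    also have "\<dots> \<le> u / (1 + u)" using assms True by (intro divide_left_mono) auto
    finally show ?thesis .
  next
    case False
    have "1 - cos u \<le> 2" using cos_ge_minus_one[of u] by linarith
    then have "(1 - cos u) / 4 \<le> 2 / 4" by (rule divide_right_mono) simp
    also have "\<dots> = (1/2::real)" by simp
    finally have "(1 - cos u) / 4 \<le> 1/2" .
    also have "\<dots> \<le> u / (1 + u)" using False by (simp add: field_simps)
    finally show ?thesis .
  qed
  then show ?thesis using 1 by linarith
qed

text \<open>\<open>\<theta>\<close> is the bound for one row. In it 192 = 12 * 16, from the decay
  rate (1/3) / 4 and the squared norm of \<open>y\<close>, which is at least 1/16.\<close>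

lemma sum_exp_minus_l1_image_le:
  fixes \<theta> :: real
  defines "\<theta> \<equiv> 1 - (1 - exp (- 1/192)) / 4"
  assumes L: "L > 0" and y: "l2 l y \<le> 1" "1/4 \<le> l2 l y"
  shows "(\<Sum>G\<in>grid_matrices k l L. exp (- l1_image k l G y)) \<le> card (grid_matrices k l L) * \<theta> ^ k"
proof -
  let ?R = "{..<l} \<rightarrow>\<^sub>E grid L" and ?c = "real (card (grid L))"
  have y1: "\<bar>y j\<bar> \<le> 1" if "j < l" for j using coord_le_l2[OF that, of y] y by linarith
  have "(1/4)\<^sup>2 \<le> (l2 l y)\<^sup>2" using y by (intro power_mono) auto
  then have y2: "1/16 \<le> (\<Sum>j<l. (y j)\<^sup>2)" unfolding l2_square by (simp add: power_divide)
  have "(\<Sum>r\<in>?R. cos (\<Sum>j<l. r j * y j)) \<le> ?c ^ card {..<l} * exp (- (1/3 / 4) * (\<Sum>j<l. (y j)\<^sup>2))"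
    by (rule sum_PiE_cos_le[where J="{..<l}" and D="grid L" and \<eta>="1/3" and y=y]) (use y1 grid_uminus grid_subset[OF L] sum_squares_grid[OF L] in auto)
  also have "\<dots> \<le> ?c ^ l * exp (- 1/192)" using y2 by (intro mult_mono) auto
  finally have cos: "(\<Sum>r\<in>?R. cos (\<Sum>j<l. r j * y j)) \<le> ?c ^ l * exp (- 1/192)" .
  have "(\<Sum>r\<in>?R. exp (- \<bar>\<Sum>j<l. r j * y j\<bar>)) \<le> (\<Sum>r\<in>?R. 1 - (1 - cos (\<Sum>j<l. r j * y j)) / 4)"
    by (intro sum_mono order_trans[OF exp_minus_le_cos]) auto
  also have "\<dots> = (\<Sum>r\<in>?R. 3/4 + (1/4) * cos (\<Sum>j<l. r j * y j))" by (intro sum.cong refl) (simp add: field_simps)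
  also have "\<dots> = 3/4 * ?c ^ l + 1/4 * (\<Sum>r\<in>?R. cos (\<Sum>j<l. r j * y j))"
  proof -
    have "real (card ?R) = ?c ^ l" by (simp add: card_PiE)
    then show ?thesis unfolding sum.distrib sum_distrib_left[symmetric] sum_constant by simp
  qed
  also have "\<dots> \<le> 3/4 * ?c ^ l + 1/4 * (?c ^ l * exp (- 1/192))" using cos by simp
  also have "\<dots> = ?c ^ l * \<theta>" by (simp add: \<theta>_def field_simps)
  finally have row: "(\<Sum>r\<in>?R. exp (- \<bar>\<Sum>j<l. r j * y j\<bar>)) \<le> ?c ^ l * \<theta>" .
  have "(\<Sum>G\<in>grid_matrices k l L. exp (- l1_image k l G y)) = (\<Sum>r\<in>?R. exp (- \<bar>\<Sum>j<l. r j * y j\<bar>)) ^ k"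
    unfolding sum_grid_matrices[symmetric] l1_image_def mat_vec_def by (simp add: exp_sum sum_negf[symmetric])
  also have "\<dots> \<le> (?c ^ l * \<theta>) ^ k"
    using row by (intro power_mono) (auto intro: sum_nonneg)
  also have "\<dots> = card (grid_matrices k l L) * \<theta> ^ k"
    unfolding card_grid_matrices by (simp add: power_mult_distrib power_mult[symmetric] mult.commute)
  finally show ?thesis .
qed

lemma card_le_markov:
  fixes f :: "'a \<Rightarrow> real"
  assumes "finite S" "(\<Sum>x\<in>S. exp (f x)) \<le> B"
  shows "card {x\<in>S. t \<le> f x} \<le> B * exp (- t)"
proof -
  have "card {x\<in>S. t \<le> f x} * exp t = (\<Sum>x\<in>{x\<in>S. t \<le> f x}. exp t)" by simp
  also have "\<dots> \<le> (\<Sum>x\<in>{x\<in>S. t \<le> f x}. exp (f x))" by (intro sum_mono) auto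
  also have "\<dots> \<le> (\<Sum>x\<in>S. exp (f x))" using assms(1) by (intro sum_mono2) auto
  finally show ?thesis using assms(2) by (simp add: exp_minus field_simps)
qed

lemma l1_image_scale: "l1_image k l G (\<lambda>j. c * y j) = \<bar>c\<bar> * l1_image k l G y"
proof -
  have "mat_vec l G (\<lambda>j. c * y j) i = c * mat_vec l G y i" for i
    by (simp add: mat_vec_def sum_distrib_left mult_ac)
  then show ?thesis by (simp add: l1_image_def abs_mult sum_distrib_left)
qed

lemma l1_image_triangle: "l1_image k l G y \<le> l1_image k l G y' + l1_image k l G (\<lambda>j. y j - y' j)"
proof -
  have "mat_vec l G y i = mat_vec l G y' i + mat_vec l G (\<lambda>j. y j - y' j) i" for i
    by (simp add: mat_vec_def sum.distrib[symmetric] algebra_simps)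
  then show ?thesis unfolding l1_image_def sum.distrib[symmetric] by (intro sum_mono) simp
qed

lemma l1_image_minus: "l1_image k l G (\<lambda>j. y j - y' j) = l1_image k l G (\<lambda>j. y' j - y j)"
  using l1_image_scale[of k l G "-1" "\<lambda>j. y j - y' j"] by simp

lemma l2_scale: "l2 n (\<lambda>j. c * y j) = \<bar>c\<bar> * l2 n y"
  by (simp add: l2_def power_mult_distrib sum_distrib_left[symmetric] real_sqrt_mult)

lemma l2_triangle: "l2 n y \<le> l2 n y' + l2 n (\<lambda>j. y j - y' j)"
  using L2_set_triangle_ineq[of y' "\<lambda>j. y j - y' j" "{..<n}"] by (simp add: L2_set_def l2_def)

lemma l2_minus: "l2 n (\<lambda>j. y j - y' j) = l2 n (\<lambda>j. y' j - y j)"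
  using l2_scale[of n "-1" "\<lambda>j. y j - y' j"] by simp

text \<open>The vectors \<open>2 * w\<close> approximate the unit sphere with error
  \<open>1 / R\<close>. Halving keeps those that are used between norms 1/4 and 1, as the moment
  estimates demand. A unit vector scaled by \<open>R * sqrt l\<close> has l1 norm at most
  \<open>R * l\<close>, and rounding adds at most \<open>l\<close>.\<close>

definition sphere_net :: "nat \<Rightarrow> nat \<Rightarrow> (nat \<Rightarrow> real) set"
  where "sphere_net R l = (\<lambda>z j. of_int (z j) / (2 * real R * sqrt l)) ` lattice_l1_ball l ((R + 1) * l)"

lemma sphere_net_approx:
  assumes R: "R \<ge> 2" and l: "l \<ge> 1" and y: "l2 l y = 1"
  obtains w where "w \<in> sphere_net R l" "1/4 \<le> l2 l w" "l2 l w \<le> 1" "l2 l (\<lambda>j. y j - 2 * w j) \<le> 1 / R"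
proof -
  define s where "s = real R * sqrt l"
  have s: "s > 0" using R l by (simp add: s_def)
  define z where "z j = \<lfloor>s * y j\<rfloor>" for j
  have "real_of_int (\<Sum>j<l. \<bar>z j\<bar>) \<le> (\<Sum>j<l. s * \<bar>y j\<bar> + 1)"
    unfolding of_int_sum
  proof (rule sum_mono)
    fix j
    have "real_of_int \<bar>z j\<bar> \<le> \<bar>s * y j\<bar> + 1" unfolding z_def by linarith
    then show "real_of_int \<bar>z j\<bar> \<le> s * \<bar>y j\<bar> + 1" using s by (simp add: abs_mult)
  qed
  also have "\<dots> = s * (\<Sum>j<l. \<bar>y j\<bar>) + l" by (simp add: sum.distrib sum_distrib_left)
  also have "\<dots> \<le> s * (sqrt l * l2 l y) + l" using s by (intro add_mono mult_left_mono sum_abs_le_sqrt_l2) auto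
  also have "\<dots> = real_of_int (int ((R + 1) * l))" by (simp add: y s_def algebra_simps)
  finally have "(\<Sum>j<l. \<bar>z j\<bar>) \<le> int ((R + 1) * l)" by (simp only: of_int_le_iff)
  then have zin: "restrict z {..<l} \<in> lattice_l1_ball l ((R + 1) * l)" by (rule restrict_in_lattice_l1_ball)
  define w where "w j = of_int (restrict z {..<l} j) / (2 * real R * sqrt l)" for j
  have w: "w \<in> sphere_net R l" unfolding sphere_net_def w_def[abs_def] using zin by (rule imageI)
  have wj: "2 * w j = of_int (z j) / s" if "j < l" for j using that s by (simp add: w_def s_def)
  have "(l2 l (\<lambda>j. y j - 2 * w j))\<^sup>2 \<le> (\<Sum>j<l. (1 / s)\<^sup>2)"
    unfolding l2_square
  proof (rule sum_mono)
    fix j assume "j \<in> {..<l}"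
    then have "y j - 2 * w j = (s * y j - of_int (z j)) / s" using s wj by (simp add: field_simps)
    moreover have "\<bar>s * y j - of_int (z j)\<bar> \<le> 1" unfolding z_def by linarith
    ultimately have "\<bar>y j - 2 * w j\<bar> \<le> 1 / s" using s by (simp add: divide_right_mono)
    then have "\<bar>y j - 2 * w j\<bar>\<^sup>2 \<le> (1 / s)\<^sup>2" by (intro power_mono) auto
    then show "(y j - 2 * w j)\<^sup>2 \<le> (1 / s)\<^sup>2" by simp
  qed
  also have "\<dots> = (1 / real R)\<^sup>2" using l by (simp add: s_def power_divide power_mult_distrib)
  finally have dist: "l2 l (\<lambda>j. y j - 2 * w j) \<le> 1 / real R" by (rule power2_le_imp_le) simp
  have R2: "1 / real R \<le> 1/2" using R by (simp add: field_simps)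
  have "l2 l (\<lambda>j. 2 * w j) \<le> l2 l y + 1/2" using l2_triangle[of l "\<lambda>j. 2 * w j" y] l2_minus[of l y "\<lambda>j. 2 * w j"] dist R2 by linarith
  moreover have "l2 l y \<le> l2 l (\<lambda>j. 2 * w j) + 1/2" using l2_triangle[of l y "\<lambda>j. 2 * w j"] dist R2 by linarith
  ultimately have "1/4 \<le> l2 l w" "l2 l w \<le> 1" using y l2_scale[of l 2 w] by auto
  with w dist show ?thesis by (intro that[of w]) auto
qed

text \<open>With \<open>A\<close> the supremum over the sphere, approximation gives A <= 8 k + A /
  R, so A <= 16 k as R >= 2. Below, the net gives 2 c k, of which the error A / R <= 16 k / R <= c k
  removes at most half.\<close>

lemma net_estimates_imp_l1_euclidean:
  fixes c :: real
  assumes c: "c > 0" and R: "R \<ge> 2" "16 \<le> c * real R"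
    and net: "\<And>w. w \<in> sphere_net R l \<Longrightarrow> 1/4 \<le> l2 l w \<Longrightarrow> l2 l w \<le> 1 \<Longrightarrow>
      c * k \<le> l1_image k l G w \<and> l1_image k l G w \<le> 4 * real k"
    and ent: "entries_le_1 k l G"
  shows "l1_euclidean c 16 k l G"
proof (cases "l = 0")
  case True
  then show ?thesis by (simp add: l1_euclidean_def l2_def mat_vec_def)
next
  case False
  let ?F = "l1_image k l G"
  \<comment> \<open>A crude bound whose only purpose is that the supremum \<open>A\<close> is
    finite.\<close>
  have "?F y \<le> real k * (real l)" if "l2 l y = 1" for y
  proof -
    have "?F y \<le> (\<Sum>i<k. real l)"
      unfolding l1_image_def
    proof (rule sum_mono)
      fix i assume i: "i \<in> {..<k}"
      have "\<bar>mat_vec l G y i\<bar> \<le> (\<Sum>j<l. \<bar>G i j * y j\<bar>)" unfolding mat_vec_def by (rule sum_abs)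
      also have "\<dots> \<le> (\<Sum>j<l. 1)"
        using ent i coord_le_l2[of _ l y] that
        by (intro sum_mono) (auto simp: abs_mult entries_le_1_def intro!: mult_le_one)
      finally show "\<bar>mat_vec l G y i\<bar> \<le> real l" by simp
    qed
    then show ?thesis by simp
  qed
  then have bdd: "bdd_above (?F ` {y. l2 l y = 1})" by (intro bdd_aboveI2) auto
  define A where "A = (SUP y\<in>{y. l2 l y = 1}. ?F y)"
  have FA: "?F y \<le> A * l2 l y" for y
  proof (cases "l2 l y = 0")
    case True
    then have "y j = 0" if "j < l" for j using coord_le_l2[OF that, of y] by simp
    then show ?thesis using True by (simp add: l1_image_def mat_vec_def)
  next
    case False
    then have pos: "l2 l y > 0" using l2_nonneg[of l y] by linarith
    then have "l2 l (\<lambda>j. inverse (l2 l y) * y j) = 1" by (simp add: l2_scale)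
    then have "?F (\<lambda>j. inverse (l2 l y) * y j) \<le> A" unfolding A_def by (intro cSUP_upper bdd) auto
    then have "inverse (l2 l y) * ?F y \<le> A" using pos by (simp only: l1_image_scale) simp
    then show ?thesis using pos by (simp add: field_simps)
  qed
  define e0 :: "nat \<Rightarrow> real" where "e0 j = (if j = 0 then 1 else 0)" for j
  have "(\<Sum>j<l. (e0 j)\<^sup>2) = (\<Sum>j<l. if j = 0 then 1 else 0)" by (intro sum.cong) (auto simp: e0_def)
  then have e0: "l2 l e0 = 1" using False by (simp add: l2_def)
  have A0: "0 \<le> A" using FA[of e0] e0 by (simp add: l1_image_def) (meson order_trans sum_nonneg abs_ge_zero)
  have approx: "\<exists>w. 1/4 \<le> l2 l w \<and> l2 l w \<le> 1 \<and> w \<in> sphere_net R l \<and> ?F (\<lambda>j. y j - 2 * w j) \<le> A / R" if y: "l2 l y = 1" for y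
  proof -
    obtain w where w: "w \<in> sphere_net R l" "1/4 \<le> l2 l w" "l2 l w \<le> 1" "l2 l (\<lambda>j. y j - 2 * w j) \<le> 1 / R"
      using sphere_net_approx[OF R(1) _ y] False by auto
    have "?F (\<lambda>j. y j - 2 * w j) \<le> A * (1 / R)"
      using FA[of "\<lambda>j. y j - 2 * w j"] mult_left_mono[OF w(4) A0] by linarith
    then show ?thesis using w by auto
  qed
  have R0: "real R \<ge> 2" using R by simp
  have "?F y \<le> 8 * k + A / R" if y: "l2 l y = 1" for y
  proof -
    obtain w where w: "1/4 \<le> l2 l w" "l2 l w \<le> 1" "w \<in> sphere_net R l" "?F (\<lambda>j. y j - 2 * w j) \<le> A / R"
      using approx[OF y] by blast
    have "?F y \<le> ?F (\<lambda>j. 2 * w j) + A / R" using l1_image_triangle[of k l G y "\<lambda>j. 2 * w j"] w(4) by linarith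
    then show ?thesis using net[OF w(3,1,2)] by (simp add: l1_image_scale)
  qed
  then have "A \<le> 8 * k + A / R" unfolding A_def using e0 by (intro cSUP_least) auto
  moreover have "A / R \<le> A / 2" using A0 R0 by (intro divide_left_mono) auto
  ultimately have A16: "A \<le> 16 * k" by linarith
  have lower: "c * k \<le> ?F y" if y: "l2 l y = 1" for y
  proof -
    obtain w where w: "1/4 \<le> l2 l w" "l2 l w \<le> 1" "w \<in> sphere_net R l" "?F (\<lambda>j. y j - 2 * w j) \<le> A / R"
      using approx[OF y] by blast
    have "?F (\<lambda>j. 2 * w j) \<le> ?F y + A / R"
      using l1_image_triangle[of k l G "\<lambda>j. 2 * w j" y] l1_image_minus[of k l G y "\<lambda>j. 2 * w j"] w(4) by linarith
    moreover have "A / R \<le> c * k"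
    proof -
      have "A \<le> (c * real R) * k" using A16 mult_right_mono[OF R(2), of "real k"] by simp
      then show ?thesis using R0 by (simp add: divide_le_eq mult_ac)
    qed
    ultimately show ?thesis using net[OF w(3,1,2)] by (simp add: l1_image_scale)
  qed
  show ?thesis
    unfolding l1_euclidean_def
  proof (intro allI conjI)
    fix y
    have "A * l2 l y \<le> (16 * real k) * l2 l y" using A16 by (intro mult_right_mono) auto
    then show "(\<Sum>i<k. \<bar>mat_vec l G y i\<bar>) \<le> 16 * real k * l2 l y" using FA[of y] by (simp add: l1_image_def)
    show "c * k * l2 l y \<le> (\<Sum>i<k. \<bar>mat_vec l G y i\<bar>)"
    proof (cases "l2 l y = 0")
      case True then show ?thesis by (simp add: sum_nonneg)
    next
      case False
      then have pos: "l2 l y > 0" using l2_nonneg[of l y] by linarith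
      then have "l2 l (\<lambda>j. inverse (l2 l y) * y j) = 1" by (simp add: l2_scale)
      from lower[OF this] have "c * k \<le> inverse (l2 l y) * ?F y" using pos by (simp only: l1_image_scale) simp
      then show ?thesis using pos by (simp add: l1_image_def field_simps)
    qed
  qed
qed

text \<open>Union bound over the net: its at most B^l points each fail with probability at most 2 *
  q^k, and k >= M * l lets the second factor win for a large constant \<open>M\<close>.\<close>

lemma most_matrices_l1_euclidean:
  obtains a :: real and M :: nat where "a > 0" "M \<ge> 1"
    "\<And>k l L. L > 0 \<Longrightarrow> M * l \<le> k \<Longrightarrow>
      8 * real (card {G \<in> grid_matrices k l L. \<not> l1_euclidean a 16 k l G}) \<le> card (grid_matrices k l L)"
proof -
  define \<theta> :: real where "\<theta> = 1 - (1 - exp (- 1/192)) / 4"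
  have "exp (- 1/192) < (1::real)" "exp (- 1/192) > (0::real)" by simp_all
  then have \<theta>: "0 < \<theta>" "\<theta> < 1" by (simp_all add: \<theta>_def field_simps add_pos_pos)
  \<comment> \<open>Half of the available exponent, so that \<open>exp a * \<theta>\<close>, the
    rate of the lower deviation, is the square root of \<open>\<theta>\<close> and still below 1.
    The 1/8 in \<open>q\<close> covers the upper deviation, whose rate is 2 exp (-3).\<close>
  define a where "a = - ln \<theta> / 2"
  have a: "a > 0" using \<theta> by (simp add: a_def)
  have "exp a * exp a = exp (- ln \<theta>)" unfolding exp_add[symmetric] by (simp add: a_def)
  also have "\<dots> = inverse \<theta>" using \<theta> by (simp add: exp_minus)
  finally have "exp a * exp a = inverse \<theta>" .
  then have ea: "exp a * exp a * \<theta> = 1" using \<theta> by simp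
  define q where "q = max (1/8) (exp a * \<theta>)"
  have "exp a * \<theta> < 1"
  proof -
    have "exp a > 1" using a by simp
    moreover have "exp a * \<theta> = inverse (exp a)" using ea by (simp add: field_simps)
    ultimately show ?thesis by (simp add: inverse_less_1_iff)
  qed
  then have q: "0 < q" "q < 1" by (auto simp: q_def)
  obtain R where R: "real R > max 2 (16 / a)" using reals_Archimedean2 by blast
  then have R: "R \<ge> 2" "16 \<le> a * real R" using a by (auto simp: field_simps)
  define B :: real where "B = 2 ^ (R + 1) * 3"
  have B: "B > 0" by (simp add: B_def)
  \<comment> \<open>The failure probability will be 2 * (B * q^M)^l, at most 1/8 for
    \<open>l\<close> positive.\<close>
  obtain M0 where M0: "q ^ M0 < 1 / (16 * B)" using real_arch_pow_inv[of "1 / (16 * B)" q] q B by auto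
  define M where "M = M0 + 1"
  have M: "B * q ^ M \<le> 1/16"
  proof -
    have "q ^ M \<le> q ^ M0" using q by (intro power_decreasing) (auto simp: M_def)
    then have "B * q ^ M \<le> B * (1 / (16 * B))" using M0 B by (intro mult_left_mono) auto
    then show ?thesis using B by simp
  qed
  have main: "8 * real (card {G \<in> grid_matrices k l L. \<not> l1_euclidean a 16 k l G}) \<le> card (grid_matrices k l L)"
    if L: "L > 0" and k: "M * l \<le> k" for k l L
  proof (cases "l = 0")
    case True
    then have "l1_euclidean a 16 k l G" for G by (simp add: l1_euclidean_def l2_def mat_vec_def)
    then show ?thesis by simp
  next
    case False
    let ?S = "grid_matrices k l L"
    define W where "W = {w \<in> sphere_net R l. 1/4 \<le> l2 l w \<and> l2 l w \<le> 1}"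
    have finN: "finite (sphere_net R l)" by (simp add: sphere_net_def)
    have "card W \<le> card (sphere_net R l)" unfolding W_def by (intro card_mono finN) auto
    also have "\<dots> \<le> card (lattice_l1_ball l ((R + 1) * l))" unfolding sphere_net_def by (intro card_image_le) simp
    also have "\<dots> \<le> 2 ^ ((R + 1) * l) * 3 ^ l" by (rule card_lattice_l1_ball)
    finally have "real (card W) \<le> real (2 ^ ((R + 1) * l) * 3 ^ l)" by (simp only: of_nat_le_iff)
    also have "real (2 ^ ((R + 1) * l) * 3 ^ l) = B ^ l"
      unfolding B_def power_mult_distrib power_mult[symmetric] by simp
    finally have cW: "real (card W) \<le> B ^ l" .
    define bad where "bad w = {G \<in> ?S. \<not> (a * k \<le> l1_image k l G w \<and> l1_image k l G w \<le> 4 * real k)}" for w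
    have badw: "real (card (bad w)) \<le> card ?S * (2 * q ^ k)" if "w \<in> W" for w
    proof -
      have w: "l2 l w \<le> 1" "1/4 \<le> l2 l w" using that by (auto simp: W_def)
      have "bad w \<subseteq> {G\<in>?S. 4 * real k \<le> l1_image k l G w} \<union> {G\<in>?S. - (a * real k) \<le> - l1_image k l G w}"
        by (auto simp: bad_def)
      then have "card (bad w) \<le> card ({G\<in>?S. 4 * real k \<le> l1_image k l G w} \<union> {G\<in>?S. - (a * real k) \<le> - l1_image k l G w})"
        by (intro card_mono) auto
      also have "\<dots> \<le> card {G\<in>?S. 4 * real k \<le> l1_image k l G w} + card {G\<in>?S. - (a * real k) \<le> - l1_image k l G w}"
        by (rule card_Un_le)
      finally have "real (card (bad w)) \<le> real (card {G\<in>?S. 4 * real k \<le> l1_image k l G w}) + real (card {G\<in>?S. - (a * real k) \<le> - l1_image k l G w})"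
        by linarith
      also have "\<dots> \<le> card ?S * (2 * exp 1) ^ k * exp (- (4 * real k)) + card ?S * \<theta> ^ k * exp (- (- (a * real k)))"
        unfolding \<theta>_def using sum_exp_l1_image_le[OF L w(1)] sum_exp_minus_l1_image_le[OF L w]
        by (intro add_mono card_le_markov) auto
      finally have le: "real (card (bad w)) \<le> card ?S * (2 * exp 1) ^ k * exp (- (4 * real k)) + card ?S * \<theta> ^ k * exp (- (- (a * real k)))" .
      have e1: "(2 * exp 1) ^ k * exp (- (4 * real k)) = (2 * exp 1 * exp (-4)) ^ k"
        by (simp add: power_mult_distrib exp_of_nat_mult[symmetric] mult.commute)
      have e2: "\<theta> ^ k * exp (- (- (a * real k))) = (exp a * \<theta>) ^ k"
        by (simp add: power_mult_distrib exp_of_nat2_mult[symmetric] mult.commute)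
      have "real (card (bad w)) \<le> card ?S * (2 * exp 1 * exp (-4)) ^ k + card ?S * (exp a * \<theta>) ^ k"
        using le unfolding mult.assoc[of "real (card ?S)"] e1 e2 .
      moreover have "2 * exp 1 * exp (-4) \<le> (1/8::real)"
      proof -
        have "16 \<le> (1 + 1/2 + (1/2)\<^sup>2 / 2 :: real) ^ 6" by (simp add: power2_eq_square eval_nat_numeral)
        also have "\<dots> \<le> exp (1/2) ^ 6" using exp_lower_Taylor_quadratic[of "1/2"] by (intro power_mono) auto
        finally have "16 \<le> exp (3::real)" by (simp add: exp_of_nat_mult[symmetric])
        then have "exp (-3) \<le> (1/16::real)" by (simp add: exp_minus field_simps)
        moreover have "exp 1 * exp (-4) = exp (-3::real)" by (simp add: exp_add[symmetric])
        ultimately show ?thesis by simp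
      qed
      then have "(2 * exp 1 * exp (-4)) ^ k \<le> q ^ k" by (intro power_mono) (auto simp: q_def)
      moreover have "(exp a * \<theta>) ^ k \<le> q ^ k" using \<theta> by (intro power_mono) (auto simp: q_def)
      ultimately have "real (card (bad w)) \<le> card ?S * q ^ k + card ?S * q ^ k"
        by (meson add_mono mult_left_mono of_nat_0_le_iff order_trans)
      then show ?thesis by (simp add: mult_ac)
    qed
    have "{G \<in> ?S. \<not> l1_euclidean a 16 k l G} \<subseteq> (\<Union>w\<in>W. bad w)"
    proof
      fix G assume G: "G \<in> {G \<in> ?S. \<not> l1_euclidean a 16 k l G}"
      then have ent: "entries_le_1 k l G" using grid_matrix_entries L by blast
      have "\<not> (\<forall>w. w \<in> sphere_net R l \<longrightarrow> 1/4 \<le> l2 l w \<longrightarrow> l2 l w \<le> 1 \<longrightarrow>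
        a * k \<le> l1_image k l G w \<and> l1_image k l G w \<le> 4 * real k)"
      proof
        assume H: "\<forall>w. w \<in> sphere_net R l \<longrightarrow> 1/4 \<le> l2 l w \<longrightarrow> l2 l w \<le> 1 \<longrightarrow>
          a * k \<le> l1_image k l G w \<and> l1_image k l G w \<le> 4 * real k"
        have "l1_euclidean a 16 k l G"
          by (rule net_estimates_imp_l1_euclidean[OF a R H[rule_format] ent])
        then show False using G by simp
      qed
      then show "G \<in> (\<Union>w\<in>W. bad w)" using G by (auto simp: W_def bad_def)
    qed
    then have "card {G \<in> ?S. \<not> l1_euclidean a 16 k l G} \<le> card (\<Union>w\<in>W. bad w)"
      using finN by (intro card_mono) (auto simp: W_def bad_def)
    also have "\<dots> \<le> (\<Sum>w\<in>W. card (bad w))" using finN by (intro card_UN_le) (auto simp: W_def)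
    finally have "real (card {G \<in> ?S. \<not> l1_euclidean a 16 k l G}) \<le> real (\<Sum>w\<in>W. card (bad w))"
      by (simp only: of_nat_le_iff)
    also have "\<dots> = (\<Sum>w\<in>W. real (card (bad w)))" by (rule of_nat_sum)
    also have "\<dots> \<le> (\<Sum>w\<in>W. card ?S * (2 * q ^ k))" by (intro sum_mono badw)
    also have "\<dots> = card W * (card ?S * (2 * q ^ k))" by simp
    also have "\<dots> \<le> B ^ l * (card ?S * (2 * q ^ (M * l)))"
      using cW q B k by (intro mult_mono) (auto intro: power_decreasing)
    also have "\<dots> = card ?S * (2 * (B * q ^ M) ^ l)" by (simp add: power_mult power_mult_distrib)
    also have "\<dots> \<le> card ?S * (2 * (1/16))"
    proof (intro mult_left_mono)
      have "(B * q ^ M) ^ l \<le> (1/16) ^ l" using M B q by (intro power_mono) auto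
      also have "\<dots> \<le> (1/16) ^ 1" using False by (intro power_decreasing) auto
      finally show "(B * q ^ M) ^ l \<le> 1/16" by simp
    qed auto
    finally show ?thesis by simp
  qed
  have M1: "M \<ge> 1" unfolding M_def by simp
  show ?thesis by (rule that[OF a M1 main])
qed

section \<open>Volumes of preimages\<close>

abbreviation lborel_power :: "nat \<Rightarrow> (nat \<Rightarrow> real) measure"
  where "lborel_power k \<equiv> Pi\<^sub>M {..<k} (\<lambda>_. lborel)"

interpretation lborel_product: product_sigma_finite "\<lambda>_::nat. lborel :: real measure"
  by standard

definition mat_app :: "nat \<Rightarrow> (nat \<Rightarrow> nat \<Rightarrow> real) \<Rightarrow> (nat \<Rightarrow> real) \<Rightarrow> nat \<Rightarrow> real"
  where "mat_app k T x = (\<lambda>i\<in>{..<k}. mat_vec k T x i)"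

definition mutually_inverse :: "nat \<Rightarrow> (nat \<Rightarrow> nat \<Rightarrow> real) \<Rightarrow> (nat \<Rightarrow> nat \<Rightarrow> real) \<Rightarrow> bool"
  where "mutually_inverse k T T' \<longleftrightarrow> (\<forall>x. \<forall>i<k. mat_vec k T (mat_vec k T' x) i = x i \<and> mat_vec k T' (mat_vec k T x) i = x i)"

definition half_open_cube :: "nat \<Rightarrow> (nat \<Rightarrow> real) set"
  where "half_open_cube k = {..<k} \<rightarrow>\<^sub>E {0..<1}"

lemma mat_vec_cong: "(\<And>j. j < k \<Longrightarrow> x j = x' j) \<Longrightarrow> mat_vec k T x i = mat_vec k T x' i"
  by (simp add: mat_vec_def)

lemma measurable_affine [measurable]:
  "(\<lambda>x. \<lambda>i\<in>{..<k}. t i + c * x i) \<in> measurable (lborel_power k) (lborel_power k)"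
  by (rule measurable_restrict) simp

lemma measurable_mat_app [measurable]:
  "mat_app k T \<in> measurable (lborel_power k) (lborel_power k)"
  unfolding mat_app_def mat_vec_def by (rule measurable_restrict) simp

text \<open>On boxes this is the one-dimensional change of variables in each coordinate, and a
  measure on the product is determined by boxes.\<close>

lemma emeasure_affine_vimage:
  assumes c: "c > 0" and S: "S \<in> sets (lborel_power k)"
  shows "emeasure (lborel_power k) S
    = ennreal (c ^ k) * emeasure (lborel_power k) ((\<lambda>x. \<lambda>i\<in>{..<k}. t i + c * x i) -` S \<inter> space (lborel_power k))"
proof -
  let ?f = "\<lambda>x. \<lambda>i\<in>{..<k}. t i + c * x i"
  let ?\<mu> = "lborel_power k"
  have one: "emeasure lborel A = ennreal c * emeasure lborel ((\<lambda>x. u + c * x) -` A)" if "A \<in> sets lborel" for A and u :: real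
  proof -
    have "emeasure lborel A = emeasure (density (distr lborel borel (\<lambda>x. u + c * x)) (\<lambda>_. ennreal \<bar>c\<bar>)) A"
      using lborel_real_affine[of c u] c by simp
    also have "\<dots> = ennreal c * emeasure (distr lborel borel (\<lambda>x. u + c * x)) A"
      using c that by (subst emeasure_density_const) auto
    finally show ?thesis using that by (simp add: emeasure_distr)
  qed
  have "density (distr ?\<mu> ?\<mu> ?f) (\<lambda>_. ennreal (c ^ k)) = ?\<mu>"
  proof (rule lborel_product.PiM_eqI)
    fix A :: "nat \<Rightarrow> real set" assume A: "\<And>i. i \<in> {..<k} \<Longrightarrow> A i \<in> sets lborel"
    have PA: "Pi\<^sub>E {..<k} A \<in> sets ?\<mu>" using A by (intro sets_PiM_I_finite) auto
    have vim: "?f -` (Pi\<^sub>E {..<k} A) \<inter> space ?\<mu> = (\<Pi>\<^sub>E i\<in>{..<k}. (\<lambda>x. t i + c * x) -` A i)"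
      by (auto simp: space_PiM PiE_iff)
    have B: "(\<lambda>x. t i + c * x) -` A i \<in> sets lborel" if "i \<in> {..<k}" for i
      using measurable_sets[of "\<lambda>x. t i + c * x" lborel lborel "A i"] A[OF that] by simp
    have "emeasure (density (distr ?\<mu> ?\<mu> ?f) (\<lambda>_. ennreal (c ^ k))) (Pi\<^sub>E {..<k} A)
        = ennreal (c ^ k) * emeasure ?\<mu> (\<Pi>\<^sub>E i\<in>{..<k}. (\<lambda>x. t i + c * x) -` A i)"
      using PA by (subst emeasure_density_const) (auto simp: emeasure_distr vim)
    also have "\<dots> = (\<Prod>i<k. ennreal c) * (\<Prod>i<k. emeasure lborel ((\<lambda>x. t i + c * x) -` A i))"
      using B c by (subst lborel_product.emeasure_PiM) (auto simp: ennreal_power)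
    also have "\<dots> = (\<Prod>i<k. emeasure lborel (A i))"
      unfolding prod.distrib[symmetric] using one A by (intro prod.cong) auto
    finally show "emeasure (density (distr ?\<mu> ?\<mu> ?f) (\<lambda>_. ennreal (c ^ k))) (Pi\<^sub>E {..<k} A) = (\<Prod>i<k. emeasure lborel (A i))" .
  qed auto
  then have "emeasure ?\<mu> S = emeasure (density (distr ?\<mu> ?\<mu> ?f) (\<lambda>_. ennreal (c ^ k))) S" by simp
  also have "\<dots> = ennreal (c ^ k) * emeasure (distr ?\<mu> ?\<mu> ?f) S"
    using S by (subst emeasure_density_const) auto
  finally show ?thesis using S by (simp add: emeasure_distr)
qed

definition shear :: "nat \<Rightarrow> (nat \<Rightarrow> nat \<Rightarrow> real) \<Rightarrow> (nat \<Rightarrow> real) \<times> (nat \<Rightarrow> real) \<Rightarrow> (nat \<Rightarrow> real) \<times> (nat \<Rightarrow> real)"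
  where "shear k T = (\<lambda>(x, y). (x, \<lambda>i\<in>{..<k}. mat_vec k T x i + y i))"

lemma measurable_shear [measurable]:
  "shear k T \<in> measurable (lborel_power k \<Otimes>\<^sub>M lborel_power k) (lborel_power k \<Otimes>\<^sub>M lborel_power k)"
proof -
  have "(\<lambda>p. \<lambda>i\<in>{..<k}. mat_vec k T (fst p) i + snd p i)
      \<in> measurable (lborel_power k \<Otimes>\<^sub>M lborel_power k) (lborel_power k)"
    unfolding mat_vec_def by (rule measurable_restrict) simp
  then show ?thesis unfolding shear_def by (simp add: split_beta')
qed

text \<open>Over each fixed \<open>x\<close> the shear is a translation of the second factor, so
  Fubini reduces the claim to translation invariance.\<close>

lemma emeasure_shear_vimage:
  assumes S: "S \<in> sets (lborel_power k \<Otimes>\<^sub>M lborel_power k)"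
  shows "emeasure (lborel_power k \<Otimes>\<^sub>M lborel_power k) (shear k T -` S \<inter> space (lborel_power k \<Otimes>\<^sub>M lborel_power k))
    = emeasure (lborel_power k \<Otimes>\<^sub>M lborel_power k) S"
proof -
  let ?\<mu> = "lborel_power k"
  interpret \<mu>: sigma_finite_measure ?\<mu> by (rule lborel_product.sigma_finite) simp
  have V: "shear k T -` S \<inter> space (?\<mu> \<Otimes>\<^sub>M ?\<mu>) \<in> sets (?\<mu> \<Otimes>\<^sub>M ?\<mu>)"
    using S by measurable
  have "emeasure ?\<mu> (Pair x -` (shear k T -` S \<inter> space (?\<mu> \<Otimes>\<^sub>M ?\<mu>))) = emeasure ?\<mu> (Pair x -` S)"
    if x: "x \<in> space ?\<mu>" for x
  proof -
    have "Pair x -` (shear k T -` S \<inter> space (?\<mu> \<Otimes>\<^sub>M ?\<mu>))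
        = (\<lambda>y. \<lambda>i\<in>{..<k}. mat_vec k T x i + 1 * y i) -` (Pair x -` S) \<inter> space ?\<mu>"
      using x by (auto simp: shear_def space_pair_measure)
    moreover have "Pair x -` S \<in> sets ?\<mu>" using S by (rule sets_Pair1)
    ultimately show ?thesis
      using emeasure_affine_vimage[of 1 "Pair x -` S" k "mat_vec k T x"] by simp
  qed
  then show ?thesis
    using S V by (simp add: \<mu>.emeasure_pair_measure_alt cong: nn_integral_cong)
qed

text \<open>The matrix \<open>[[0, -T'], [T, 0]]\<close> with \<open>T' = T\<^sup>-\<^sup>1\<close> is a product of three shears, so it preserves
  volume. This replaces the multiplicativity of determinants.\<close>

lemma emeasure_inverse_images:
  assumes inv: "mutually_inverse k T T'"
    and A: "A \<in> sets (lborel_power k)" and B: "B \<in> sets (lborel_power k)"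
  shows "emeasure (lborel_power k) ((\<lambda>y. mat_app k (\<lambda>i j. - T' i j) y) -` A \<inter> space (lborel_power k))
      * emeasure (lborel_power k) (mat_app k T -` B \<inter> space (lborel_power k))
    = emeasure (lborel_power k) A * emeasure (lborel_power k) B"
proof -
  let ?\<mu> = "lborel_power k" and ?P = "lborel_power k \<Otimes>\<^sub>M lborel_power k"
  let ?N = "\<lambda>i j. - T' i j"
  interpret \<mu>: sigma_finite_measure ?\<mu> by (rule lborel_product.sigma_finite) simp
  define swap :: "(nat \<Rightarrow> real) \<times> (nat \<Rightarrow> real) \<Rightarrow> (nat \<Rightarrow> real) \<times> (nat \<Rightarrow> real)" where "swap = (\<lambda>(x, y). (y, x))"
  have neg: "mat_vec k ?N x i = - mat_vec k T' x i" for x i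
    by (simp add: mat_vec_def sum_negf)
  have lin: "mat_vec k M (\<lambda>i\<in>{..<k}. u i + v i) i = mat_vec k M u i + mat_vec k M v i" for M u v i
    by (simp add: mat_vec_def distrib_left sum.distrib)
  have lin': "mat_vec k M (\<lambda>i. - u i) i = - mat_vec k M u i" for M u i
    by (simp add: mat_vec_def sum_negf)
  have res: "mat_vec k M (\<lambda>i\<in>{..<k}. u i) i = mat_vec k M u i" for M u i
    by (rule mat_vec_cong) simp
  have swapm: "swap \<in> measurable ?P ?P" unfolding swap_def by measurable
  have swapS: "emeasure ?P (swap -` S \<inter> space ?P) = emeasure ?P S" if "S \<in> sets ?P" for S
  proof -
    interpret pair_sigma_finite ?\<mu> ?\<mu> ..
    have "emeasure ?P S = emeasure (distr ?P ?P swap) S"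
      using distr_pair_swap unfolding swap_def by (simp add: split_beta')
    then show ?thesis using that swapm by (simp add: emeasure_distr)
  qed
  \<comment> \<open>Starting from (x, y): the first shear gives y1 = T x + y, the second x1 = x - T'
    y1 = - T' y, and the third T x1 + y1 = T x. The swaps let a shear act on the other
    factor.\<close>
  have main: "shear k T (swap (shear k ?N (swap (shear k T (x, y))))) = (mat_app k ?N y, mat_app k T x)"
    if x: "x \<in> space ?\<mu>" and y: "y \<in> space ?\<mu>" for x y
  proof -
    have ext: "x i = undefined" "y i = undefined" if "\<not> i < k" for i
      using x y that by (auto simp: space_PiM PiE_iff extensional_def)
    define y1 where "y1 = (\<lambda>i\<in>{..<k}. mat_vec k T x i + y i)"
    define x1 where "x1 = (\<lambda>i\<in>{..<k}. mat_vec k ?N y1 i + x i)"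
    have x1: "x1 = mat_app k ?N y"
    proof
      fix i show "x1 i = mat_app k ?N y i"
        using inv by (auto simp: x1_def y1_def mat_app_def neg lin mutually_inverse_def)
    qed
    have "(\<lambda>i\<in>{..<k}. mat_vec k T x1 i + y1 i) = mat_app k T x"
    proof
      fix i
      have "mat_vec k T x1 i = - y i" if "i < k"
      proof -
        have "mat_vec k T x1 i = mat_vec k T (\<lambda>i. - mat_vec k T' y i) i"
          unfolding x1 by (rule mat_vec_cong) (simp add: mat_app_def neg)
        then show ?thesis using inv that by (simp add: lin' mutually_inverse_def)
      qed
      then show "(\<lambda>i\<in>{..<k}. mat_vec k T x1 i + y1 i) i = mat_app k T x i"
        by (simp add: y1_def mat_app_def)
    qed
    then show ?thesis by (simp add: shear_def swap_def x1 x1_def[symmetric] y1_def[symmetric])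
  qed
  define S where "S = A \<times> B"
  have S: "S \<in> sets ?P" using A B by (simp add: S_def)
  define S1 where "S1 = shear k T -` S \<inter> space ?P"
  define S2 where "S2 = swap -` S1 \<inter> space ?P"
  define S3 where "S3 = shear k ?N -` S2 \<inter> space ?P"
  define S4 where "S4 = swap -` S3 \<inter> space ?P"
  define S5 where "S5 = shear k T -` S4 \<inter> space ?P"
  have S1: "S1 \<in> sets ?P" "emeasure ?P S1 = emeasure ?P S"
    unfolding S1_def by (rule measurable_sets[OF measurable_shear S], rule emeasure_shear_vimage[OF S])
  have S2: "S2 \<in> sets ?P" "emeasure ?P S2 = emeasure ?P S1"
    unfolding S2_def by (rule measurable_sets[OF swapm S1(1)], rule swapS[OF S1(1)])
  have S3: "S3 \<in> sets ?P" "emeasure ?P S3 = emeasure ?P S2"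
    unfolding S3_def by (rule measurable_sets[OF measurable_shear S2(1)], rule emeasure_shear_vimage[OF S2(1)])
  have S4: "S4 \<in> sets ?P" "emeasure ?P S4 = emeasure ?P S3"
    unfolding S4_def by (rule measurable_sets[OF swapm S3(1)], rule swapS[OF S3(1)])
  have S5: "emeasure ?P S5 = emeasure ?P S4"
    unfolding S5_def by (rule emeasure_shear_vimage[OF S4(1)])
  have sh: "shear k M p \<in> space ?P" if "p \<in> space ?P" for M p
    using measurable_space[OF measurable_shear that] .
  have sw: "swap p \<in> space ?P" if "p \<in> space ?P" for p
    using measurable_space[OF swapm that] .
  have S5': "p \<in> S5 \<longleftrightarrow> p \<in> space ?P \<and> shear k T (swap (shear k ?N (swap (shear k T p)))) \<in> S" for p
    unfolding S5_def S4_def S3_def S2_def S1_def vimage_eq Int_iff by (blast intro: sh sw)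
  have S5'': "(x, y) \<in> S5 \<longleftrightarrow> x \<in> space ?\<mu> \<and> y \<in> space ?\<mu> \<and> mat_app k ?N y \<in> A \<and> mat_app k T x \<in> B" for x y
    unfolding S5' by (auto simp: space_pair_measure S_def main)
  have "S5 = (mat_app k T -` B \<inter> space ?\<mu>) \<times> (mat_app k ?N -` A \<inter> space ?\<mu>)"
    using S5'' by auto
  moreover have "mat_app k T -` B \<inter> space ?\<mu> \<in> sets ?\<mu>" "mat_app k ?N -` A \<inter> space ?\<mu> \<in> sets ?\<mu>"
    using A B by (auto intro: measurable_sets)
  ultimately have "emeasure ?P S5 = emeasure ?\<mu> (mat_app k T -` B \<inter> space ?\<mu>) * emeasure ?\<mu> (mat_app k ?N -` A \<inter> space ?\<mu>)"
    by (simp add: \<mu>.emeasure_pair_measure_Times)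
  moreover have "emeasure ?P S = emeasure ?\<mu> A * emeasure ?\<mu> B"
    unfolding S_def using A B by (simp add: \<mu>.emeasure_pair_measure_Times)
  ultimately show ?thesis using S1 S2 S3 S4 S5 by (simp add: mult.commute)
qed

text \<open>For an invertible \<open>T\<close> this is 1 / |det T|; the value is at most 1 when
  \<open>T\<close> does not shrink volume.\<close>

definition preimage_volume :: "nat \<Rightarrow> (nat \<Rightarrow> nat \<Rightarrow> real) \<Rightarrow> ennreal"
  where "preimage_volume k T = emeasure (lborel_power k) (mat_app k T -` half_open_cube k \<inter> space (lborel_power k))"

lemma half_open_cube_measurable [measurable]: "half_open_cube k \<in> sets (lborel_power k)"
  unfolding half_open_cube_def by (intro sets_PiM_I_finite) auto

lemma emeasure_box:
  assumes "\<And>i. i < k \<Longrightarrow> emeasure lborel (A i) = ennreal c" "\<And>i. i < k \<Longrightarrow> A i \<in> sets borel" "c \<ge> 0"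
  shows "emeasure (lborel_power k) (\<Pi>\<^sub>E i\<in>{..<k}. A i) = ennreal (c ^ k)"
  using assms by (subst lborel_product.emeasure_PiM) (auto simp: ennreal_power)

lemma preimage_volume_mult:
  assumes "mutually_inverse k T T'"
  shows "preimage_volume k T * preimage_volume k T' = 1"
proof -
  let ?\<mu> = "lborel_power k"
  \<comment> \<open>The reflected half-open cube: the sign in - T' turns it exactly into
    \<open>half_open_cube\<close>, boundary included.\<close>
  define Q' where "Q' = {..<k} \<rightarrow>\<^sub>E {-1<..(0::real)}"
  have Q': "Q' \<in> sets ?\<mu>" unfolding Q'_def by (intro sets_PiM_I_finite) auto
  have "mat_app k (\<lambda>i j. - T' i j) y \<in> Q' \<longleftrightarrow> mat_app k T' y \<in> half_open_cube k" for y
    by (auto simp: mat_app_def Q'_def half_open_cube_def mat_vec_def PiE_iff sum_negf)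
  then have "(\<lambda>y. mat_app k (\<lambda>i j. - T' i j) y) -` Q' \<inter> space ?\<mu> = mat_app k T' -` half_open_cube k \<inter> space ?\<mu>"
    by auto
  moreover have "emeasure ?\<mu> Q' = 1" "emeasure ?\<mu> (half_open_cube k) = 1"
    unfolding Q'_def half_open_cube_def by (subst emeasure_box[where c=1]; simp)+
  ultimately show ?thesis
    using emeasure_inverse_images[OF assms Q' half_open_cube_measurable]
    by (simp add: preimage_volume_def mult.commute)
qed

text \<open>Each point of \<open>\<Gamma>\<close> owns a grid cell of volume L^(-k). The cells are
  disjoint and lie in the preimages under \<open>T\<close> of the cubes of side \<open>c\<close>
  with corners \<open>c * z\<close>; each such preimage has volume at most c^k.\<close>

lemma card_grid_points_le:
  assumes inv: "mutually_inverse k T T'" and vol: "preimage_volume k T \<le> 1"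
    and c: "c > 0" and L: "L > 0" and Z: "finite Z" and \<Gamma>: "\<Gamma> \<subseteq> {..<k} \<rightarrow>\<^sub>E grid L"
    and cover: "\<And>g x. g \<in> \<Gamma> \<Longrightarrow> x \<in> space (lborel_power k) \<Longrightarrow> (\<And>i. i < k \<Longrightarrow> g i \<le> x i \<and> x i < g i + 1 / L) \<Longrightarrow>
      \<exists>z\<in>Z. \<forall>i<k. c * of_int (z i) \<le> mat_vec k T x i \<and> mat_vec k T x i < c * (of_int (z i) + 1)"
  shows "real (card \<Gamma>) \<le> real L ^ k * c ^ k * card (Z :: (nat \<Rightarrow> int) set)"
proof -
  let ?\<mu> = "lborel_power k"
  define U where "U z = {x \<in> space ?\<mu>. \<forall>i\<in>{..<k}. c * of_int (z i) \<le> mat_vec k T x i \<and> mat_vec k T x i < c * (of_int (z i) + 1)}" for z :: "nat \<Rightarrow> int"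
  define cube where "cube g = (\<Pi>\<^sub>E i\<in>{..<k}. {g i..<g i + 1 / real L})" for g :: "nat \<Rightarrow> real"
  have Um: "U z \<in> sets ?\<mu>" for z unfolding U_def mat_vec_def by measurable
  have eU: "emeasure ?\<mu> (U z) \<le> ennreal (c ^ k)" for z
  proof -
    \<comment> \<open>\<open>t\<close> is the preimage of the corner of the cube, so substituting t
      + c * x turns \<open>U z\<close> into the preimage of the unit cube.\<close>
    define t where "t = mat_vec k T' (\<lambda>i. c * of_int (z i))"
    have "(\<lambda>x. \<lambda>i\<in>{..<k}. t i + c * x i) -` U z \<inter> space ?\<mu> = mat_app k T -` half_open_cube k \<inter> space ?\<mu>"
    proof -
      have "(\<lambda>i\<in>{..<k}. t i + c * x i) \<in> U z \<longleftrightarrow> mat_app k T x \<in> half_open_cube k" for x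
      proof -
        have "mat_vec k T (\<lambda>i\<in>{..<k}. t i + c * x i) i = mat_vec k T t i + c * mat_vec k T x i" for i
          by (simp add: mat_vec_def distrib_left sum.distrib sum_distrib_left mult_ac)
        then have eq: "mat_vec k T (\<lambda>i\<in>{..<k}. t i + c * x i) i = c * of_int (z i) + c * mat_vec k T x i" if "i < k" for i
          using inv that by (simp add: t_def mutually_inverse_def)
        have "c * of_int (z i) \<le> mat_vec k T (\<lambda>i\<in>{..<k}. t i + c * x i) i \<and> mat_vec k T (\<lambda>i\<in>{..<k}. t i + c * x i) i < c * (of_int (z i) + 1)
            \<longleftrightarrow> mat_vec k T x i \<in> {0..<1}" if "i < k" for i
          unfolding eq[OF that] using c by (auto simp: distrib_left zero_le_mult_iff)
        then show ?thesis
          by (auto simp: U_def mat_app_def half_open_cube_def space_PiM PiE_iff)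
      qed
      then show ?thesis by auto
    qed
    then have "emeasure ?\<mu> (U z) = ennreal (c ^ k) * preimage_volume k T"
      using emeasure_affine_vimage[OF c Um, of z t] by (simp add: preimage_volume_def)
    also have "\<dots> \<le> ennreal (c ^ k) * 1" using vol by (intro mult_left_mono) auto
    finally show ?thesis by simp
  qed
  have fin: "finite \<Gamma>" by (rule finite_subset[OF \<Gamma> finite_PiE]) auto
  have cm: "cube g \<in> sets ?\<mu>" for g unfolding cube_def by (intro sets_PiM_I_finite) auto
  have ec: "emeasure ?\<mu> (cube g) = ennreal ((1 / real L) ^ k)" for g
    unfolding cube_def by (rule emeasure_box) auto
  have disj: "disjoint_family_on cube \<Gamma>"
    unfolding disjoint_family_on_def
  proof (intro ballI impI)
    fix g h assume gh: "g \<in> \<Gamma>" "h \<in> \<Gamma>" "g \<noteq> h"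
    then have gP: "g \<in> {..<k} \<rightarrow>\<^sub>E grid L" and hP: "h \<in> {..<k} \<rightarrow>\<^sub>E grid L" using \<Gamma> by auto
    have "\<exists>i\<in>{..<k}. g i \<noteq> h i"
    proof (rule ccontr)
      assume "\<not> ?thesis"
      then have "g = h" by (intro PiE_ext[OF gP hP]) blast
      then show False using gh(3) by simp
    qed
    then obtain i where i: "i < k" "g i \<noteq> h i" by auto
    have "g i \<in> grid L" "h i \<in> grid L" using gP hP i(1) by (auto simp: PiE_iff)
    then obtain a b where ab: "g i = of_int a / L" "h i = of_int b / L" unfolding grid_def by blast
    then have "a \<noteq> b" using i by auto
    then consider "a + 1 \<le> b" | "b + 1 \<le> a" by linarith
    then have "g i + 1 / L \<le> h i \<or> h i + 1 / L \<le> g i"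
    proof cases
      case 1
      then have "real_of_int a + 1 \<le> of_int b" by linarith
      then show ?thesis using L ab by (simp add: divide_right_mono flip: add_divide_distrib)
    next
      case 2
      then have "real_of_int b + 1 \<le> of_int a" by linarith
      then show ?thesis using L ab by (simp add: divide_right_mono flip: add_divide_distrib)
    qed
    note sep = this
    have in_cube: "g i \<le> x i \<and> x i < g i + 1 / L" if "x \<in> cube g" for x g
      using i(1) that by (auto simp: cube_def PiE_iff)
    have False if "x \<in> cube g" "x \<in> cube h" for x
      using in_cube[OF that(1)] in_cube[OF that(2)] sep by linarith
    then show "cube g \<inter> cube h = {}" by blast
  qed
  have sub: "(\<Union>g\<in>\<Gamma>. cube g) \<subseteq> (\<Union>z\<in>Z. U z)"
  proof
    fix x assume "x \<in> (\<Union>g\<in>\<Gamma>. cube g)"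
    then obtain g where g: "g \<in> \<Gamma>" "x \<in> cube g" by blast
    have xs: "x \<in> space ?\<mu>" using g(2) by (auto simp: cube_def space_PiM PiE_iff)
    have "\<exists>z\<in>Z. \<forall>i<k. c * of_int (z i) \<le> mat_vec k T x i \<and> mat_vec k T x i < c * (of_int (z i) + 1)"
      by (rule cover[OF g(1) xs]) (use g(2) in \<open>auto simp: cube_def PiE_iff\<close>)
    then show "x \<in> (\<Union>z\<in>Z. U z)" using xs by (auto simp: U_def)
  qed
  have "ennreal (card \<Gamma> * (1 / real L) ^ k) = (\<Sum>g\<in>\<Gamma>. emeasure ?\<mu> (cube g))"
    by (simp add: ec ennreal_of_nat_eq_real_of_nat ennreal_mult')
  also have "\<dots> = emeasure ?\<mu> (\<Union>g\<in>\<Gamma>. cube g)"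
    using fin cm disj by (intro sum_emeasure) auto
  also have "\<dots> \<le> emeasure ?\<mu> (\<Union>z\<in>Z. U z)"
    using sub Um Z by (intro emeasure_mono) auto
  also have "\<dots> \<le> (\<Sum>z\<in>Z. emeasure ?\<mu> (U z))"
    using Z Um by (intro emeasure_subadditive_finite) auto
  also have "\<dots> \<le> (\<Sum>z\<in>Z. ennreal (c ^ k))" by (intro sum_mono eU)
  also have "\<dots> = ennreal (card Z * c ^ k)" using c by (simp add: ennreal_of_nat_eq_real_of_nat ennreal_mult')
  finally have "card \<Gamma> * (1 / real L) ^ k \<le> card Z * c ^ k" using c by simp
  then show ?thesis using L by (simp add: power_divide field_simps)
qed

section \<open>Entropy and rounding\<close>

definition unit_hull :: "nat \<Rightarrow> nat \<Rightarrow> (nat \<Rightarrow> nat \<Rightarrow> real) \<Rightarrow> (nat \<Rightarrow> real) set"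
  where "unit_hull k l B = {x. \<exists>u y. (\<Sum>i<k. \<bar>u i\<bar>) + (\<Sum>j<l. \<bar>y j\<bar>) \<le> 1 \<and> (\<forall>i<k. x i = sqrt k * u i + mat_vec l B y i)}"

text \<open>The strict inequality provides a lift of cost below 1 without knowing that the infimum
  is attained.\<close>

lemma quot_norm_less_imp_unit_hull:
  assumes k: "k \<ge> 1" and "quot_norm k l B x < 1" shows "x \<in> unit_hull k l B"
proof -
  obtain y where y: "quot_cost k l B x y < 1" using quot_norm_less_imp_cost assms(2) by blast
  have sk: "sqrt (real k) > 0" using k by simp
  define u where "u i = (x i - mat_vec l B y i) / sqrt k" for i
  have "(\<Sum>i<k. \<bar>u i\<bar>) + (\<Sum>j<l. \<bar>y j\<bar>) \<le> 1"
    using y by (simp add: quot_cost_def u_def mat_vec_def sum_divide_distrib)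
  moreover have "\<forall>i<k. x i = sqrt k * u i + mat_vec l B y i" using sk by (simp add: u_def)
  ultimately show ?thesis unfolding unit_hull_def by blast
qed

lemma unit_hull_coord:
  assumes ent: "entries_le_1 k l B" and x: "x \<in> unit_hull k l B" and i: "i < k"
  shows "\<bar>x i\<bar> \<le> sqrt k"
proof -
  obtain u y where uy: "(\<Sum>i<k. \<bar>u i\<bar>) + (\<Sum>j<l. \<bar>y j\<bar>) \<le> 1" "\<forall>i<k. x i = sqrt k * u i + mat_vec l B y i"
    using x unfolding unit_hull_def by blast
  have k: "sqrt (real k) \<ge> 1" using i by simp
  have "\<bar>mat_vec l B y i\<bar> \<le> (\<Sum>j<l. \<bar>B i j * y j\<bar>)" unfolding mat_vec_def by (rule sum_abs)
  also have "\<dots> \<le> (\<Sum>j<l. \<bar>y j\<bar>)"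
    using ent i by (intro sum_mono) (auto simp: abs_mult entries_le_1_def intro!: mult_left_le_one_le)
  also have "\<dots> \<le> sqrt k * (\<Sum>j<l. \<bar>y j\<bar>)"
    using mult_right_mono[OF k, of "\<Sum>j<l. \<bar>y j\<bar>"] by (simp add: sum_nonneg)
  finally have 1: "\<bar>mat_vec l B y i\<bar> \<le> sqrt k * (\<Sum>j<l. \<bar>y j\<bar>)" .
  have "\<bar>u i\<bar> \<le> (\<Sum>i<k. \<bar>u i\<bar>)" using i by (intro member_le_sum) auto
  then have 2: "\<bar>sqrt k * u i\<bar> \<le> sqrt k * (\<Sum>i<k. \<bar>u i\<bar>)" by (simp add: abs_mult mult_left_mono)
  have "\<bar>x i\<bar> \<le> sqrt k * (\<Sum>i<k. \<bar>u i\<bar>) + sqrt k * (\<Sum>j<l. \<bar>y j\<bar>)"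
    using uy(2) i 1 2 by (simp add: order_trans[OF abs_triangle_ineq])
  also have "\<dots> = sqrt k * ((\<Sum>i<k. \<bar>u i\<bar>) + (\<Sum>j<l. \<bar>y j\<bar>))" by (simp add: distrib_left)
  also have "\<dots> \<le> sqrt k * 1" using uy(1) by (intro mult_left_mono) auto
  finally show ?thesis by simp
qed

text \<open>Integer points near the unit ball dilated by \<open>sqrt k\<close>, up to an error
  \<open>w\<close> that is small on average and an error \<open>\<tau>\<close> in each coordinate.
  The case (0, 1) contains the rounded columns of operators; the case (6, 2) contains the corners of
  the cubes that meet images of matrix columns.\<close>

definition near_hull :: "nat \<Rightarrow> nat \<Rightarrow> (nat \<Rightarrow> nat \<Rightarrow> real) \<Rightarrow> nat \<Rightarrow> nat \<Rightarrow> (nat \<Rightarrow> int) set"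
  where "near_hull k l B \<sigma> \<tau> = {z \<in> {..<k} \<rightarrow>\<^sub>E UNIV. \<exists>x\<in>unit_hull k l B. \<exists>w. (\<Sum>i<k. \<bar>w i\<bar>) \<le> real \<sigma> * real k \<and>
    (\<forall>i<k. \<bar>of_int (z i) - sqrt k * x i - w i\<bar> \<le> real \<tau>)}"

text \<open>A point is encoded by the integer parts \<open>p\<close> of \<open>k * u\<close> and
  \<open>q\<close> of \<open>k * y\<close> and a remainder \<open>v\<close>. Per coordinate, 18 = 16
  + 2: one for rounding \<open>u\<close>, one for the inner floor, and 16 because the rounding
  residue \<open>r\<close> of \<open>k * y\<close> has Euclidean norm at most \<open>sqrt k\<close>,
  so that the l1 norm of \<open>B r / sqrt k\<close> is at most \<open>16 * k\<close>.\<close>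

lemma near_hull_subset:
  assumes lk: "l \<le> k" and k: "k \<ge> 1" and euc: "l1_euclidean a 16 k l B"
  shows "near_hull k l B \<sigma> \<tau> \<subseteq> (\<lambda>(p, q, v). \<lambda>i\<in>{..<k}. \<lfloor>of_int (p i) + mat_vec l B (\<lambda>j. of_int (q j)) i / sqrt k\<rfloor> + v i)
    ` (lattice_l1_ball k (2 * k) \<times> lattice_l1_ball l (2 * k) \<times> lattice_l1_ball k ((\<tau> + \<sigma> + 18) * k))"
proof
  fix z assume "z \<in> near_hull k l B \<sigma> \<tau>"
  then obtain x w where zP: "z \<in> {..<k} \<rightarrow>\<^sub>E UNIV" and w: "(\<Sum>i<k. \<bar>w i\<bar>) \<le> real \<sigma> * real k"
    and z: "\<And>i. i < k \<Longrightarrow> \<bar>of_int (z i) - sqrt k * x i - w i\<bar> \<le> real \<tau>"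
    and xh: "x \<in> unit_hull k l B"
    unfolding near_hull_def by blast
  obtain u y where uy: "(\<Sum>i<k. \<bar>u i\<bar>) + (\<Sum>j<l. \<bar>y j\<bar>) \<le> 1" and x: "\<And>i. i < k \<Longrightarrow> x i = sqrt k * u i + mat_vec l B y i"
    using xh unfolding unit_hull_def by blast
  have sk: "sqrt (real k) > 0" "sqrt (real k) * sqrt (real k) = real k" using k by auto
  have u1: "(\<Sum>i<k. \<bar>u i\<bar>) \<le> 1" and y1: "(\<Sum>j<l. \<bar>y j\<bar>) \<le> 1"
  proof -
    have "0 \<le> (\<Sum>i<k. \<bar>u i\<bar>)" "0 \<le> (\<Sum>j<l. \<bar>y j\<bar>)" by (simp_all add: sum_nonneg)
    then show "(\<Sum>i<k. \<bar>u i\<bar>) \<le> 1" "(\<Sum>j<l. \<bar>y j\<bar>) \<le> 1" using uy by linarith+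
  qed
  have round: "(\<Sum>i<n. \<bar>\<lfloor>real k * f i\<rfloor>\<bar>) \<le> int (2 * k)" if f: "(\<Sum>i<n. \<bar>f i\<bar>) \<le> 1" and n: "n \<le> k" for n and f :: "nat \<Rightarrow> real"
  proof -
    have "real_of_int (\<Sum>i<n. \<bar>\<lfloor>real k * f i\<rfloor>\<bar>) \<le> (\<Sum>i<n. real k * \<bar>f i\<bar> + 1)"
      unfolding of_int_sum
    proof (rule sum_mono)
      fix i
      have "real_of_int \<bar>\<lfloor>real k * f i\<rfloor>\<bar> \<le> \<bar>real k * f i\<bar> + 1" by linarith
      then show "real_of_int \<bar>\<lfloor>real k * f i\<rfloor>\<bar> \<le> real k * \<bar>f i\<bar> + 1" by (simp add: abs_mult)
    qed
    also have "\<dots> = real k * (\<Sum>i<n. \<bar>f i\<bar>) + real n" by (simp add: sum.distrib sum_distrib_left)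
    also have "\<dots> \<le> real k * 1 + real k" using f n by (intro add_mono mult_left_mono) auto
    also have "\<dots> = real_of_int (int (2 * k))" by simp
    finally show ?thesis by (simp only: of_int_le_iff)
  qed
  define p where "p = restrict (\<lambda>i. \<lfloor>real k * u i\<rfloor>) {..<k}"
  define q where "q = restrict (\<lambda>j. \<lfloor>real k * y j\<rfloor>) {..<l}"
  define \<Phi> where "\<Phi> i = of_int (p i) + mat_vec l B (\<lambda>j. of_int (q j)) i / sqrt k" for i
  define v where "v = restrict (\<lambda>i. z i - \<lfloor>\<Phi> i\<rfloor>) {..<k}"
  have p: "p \<in> lattice_l1_ball k (2 * k)" unfolding p_def by (rule restrict_in_lattice_l1_ball[OF round[OF u1 order_refl]])
  have q: "q \<in> lattice_l1_ball l (2 * k)" unfolding q_def by (rule restrict_in_lattice_l1_ball[OF round[OF y1 lk]])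
  define r where "r j = real k * y j - of_int (q j)" for j
  have r1: "\<bar>r j\<bar> \<le> 1" if "j < l" for j using that by (simp add: r_def q_def) linarith
  have "l2 l r \<le> sqrt l"
  proof -
    have "(r j)\<^sup>2 \<le> 1" if "j < l" for j using r1[OF that] by (simp add: abs_square_le_1)
    then have "(\<Sum>j<l. (r j)\<^sup>2) \<le> (\<Sum>j<l. 1)" by (intro sum_mono) auto
    then show ?thesis by (simp add: l2_def)
  qed
  also have "\<dots> \<le> sqrt k" using lk by simp
  finally have l2r: "l2 l r \<le> sqrt k" .
  have Br: "(\<Sum>i<k. \<bar>mat_vec l B r i / sqrt k\<bar>) \<le> 16 * real k"
  proof -
    have "(\<Sum>i<k. \<bar>mat_vec l B r i\<bar>) \<le> 16 * real k * l2 l r" using euc by (simp add: l1_euclidean_def)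
    also have "\<dots> \<le> 16 * real k * sqrt k" using l2r by (intro mult_left_mono) auto
    finally have "(\<Sum>i<k. \<bar>mat_vec l B r i\<bar>) / sqrt k \<le> 16 * real k" using sk(1) by (simp add: pos_divide_le_eq)
    then show ?thesis by (simp add: sum_divide_distrib)
  qed
  have e: "sqrt k * x i - \<Phi> i = (real k * u i - of_int (p i)) + mat_vec l B r i / sqrt k" if "i < k" for i
  proof -
    have "mat_vec l B r i = real k * mat_vec l B y i - mat_vec l B (\<lambda>j. of_int (q j)) i"
      by (simp add: mat_vec_def r_def right_diff_distrib sum_subtractf sum_distrib_left mult_ac)
    moreover have "sqrt k * (sqrt k * u i) = real k * u i" using sk by (simp add: mult.assoc[symmetric])
    moreover have "real k * mat_vec l B y i / sqrt k = sqrt k * mat_vec l B y i"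
      using k by (simp add: real_div_sqrt mult.commute flip: times_divide_eq_left)
    ultimately show ?thesis using x[OF that]
      by (simp add: \<Phi>_def distrib_left diff_divide_distrib)
  qed
  have "real_of_int (\<Sum>i<k. \<bar>z i - \<lfloor>\<Phi> i\<rfloor>\<bar>) \<le> (\<Sum>i<k. (real \<tau> + 2) + \<bar>w i\<bar> + \<bar>mat_vec l B r i / sqrt k\<bar>)"
    unfolding of_int_sum
  proof (rule sum_mono)
    fix i assume "i \<in> {..<k}"
    then have i: "i < k" by simp
    have "\<bar>real k * u i - of_int (p i)\<bar> \<le> 1" using i by (simp add: p_def) linarith
    then have "\<bar>sqrt k * x i - \<Phi> i\<bar> \<le> 1 + \<bar>mat_vec l B r i / sqrt k\<bar>" unfolding e[OF i] by linarith
    moreover have "\<bar>\<Phi> i - of_int \<lfloor>\<Phi> i\<rfloor>\<bar> \<le> 1" by linarith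
    moreover have "real_of_int \<bar>z i - \<lfloor>\<Phi> i\<rfloor>\<bar> \<le> \<bar>of_int (z i) - sqrt k * x i - w i\<bar> + \<bar>w i\<bar> + \<bar>sqrt k * x i - \<Phi> i\<bar> + \<bar>\<Phi> i - of_int \<lfloor>\<Phi> i\<rfloor>\<bar>"
      unfolding of_int_abs of_int_diff by linarith
    ultimately show "real_of_int \<bar>z i - \<lfloor>\<Phi> i\<rfloor>\<bar> \<le> (real \<tau> + 2) + \<bar>w i\<bar> + \<bar>mat_vec l B r i / sqrt k\<bar>"
      using z[OF i] by linarith
  qed
  also have "\<dots> = real k * (real \<tau> + 2) + (\<Sum>i<k. \<bar>w i\<bar>) + (\<Sum>i<k. \<bar>mat_vec l B r i / sqrt k\<bar>)"
    by (simp add: sum.distrib)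
  also have "\<dots> \<le> real k * (real \<tau> + 2) + real \<sigma> * real k + 16 * real k" using w Br by linarith
  also have "\<dots> = real_of_int (int ((\<tau> + \<sigma> + 18) * k))" by (simp add: algebra_simps)
  finally have v: "v \<in> lattice_l1_ball k ((\<tau> + \<sigma> + 18) * k)"
    unfolding v_def by (intro restrict_in_lattice_l1_ball) (simp only: of_int_le_iff)
  have "z = (\<lambda>i\<in>{..<k}. \<lfloor>\<Phi> i\<rfloor> + v i)"
    using zP by (intro extensionalityI[of _ "{..<k}"]) (auto simp: v_def PiE_iff)
  then show "z \<in> (\<lambda>(p, q, v). \<lambda>i\<in>{..<k}. \<lfloor>of_int (p i) + mat_vec l B (\<lambda>j. of_int (q j)) i / sqrt k\<rfloor> + v i)
    ` (lattice_l1_ball k (2 * k) \<times> lattice_l1_ball l (2 * k) \<times> lattice_l1_ball k ((\<tau> + \<sigma> + 18) * k))"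
    using p q v unfolding \<Phi>_def by (intro image_eqI[of _ _ "(p, q, v)"]) auto
qed

text \<open>In the base, 22 = 18 + 2 + 2 collects the radii of the three lattice balls and 27 = 3^3
  their dimension factors.\<close>

lemma card_near_hull:
  assumes "l \<le> k" "k \<ge> 1" "l1_euclidean a 16 k l B"
  shows "finite (near_hull k l B \<sigma> \<tau>)" "card (near_hull k l B \<sigma> \<tau>) \<le> (2 ^ (\<tau> + \<sigma> + 22) * 27) ^ k"
proof -
  let ?X = "lattice_l1_ball k (2 * k) \<times> lattice_l1_ball l (2 * k) \<times> lattice_l1_ball k ((\<tau> + \<sigma> + 18) * k)"
  have fin: "finite ?X" by simp
  show "finite (near_hull k l B \<sigma> \<tau>)"
    by (rule finite_subset[OF near_hull_subset[OF assms] finite_imageI[OF fin]])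
  have "card (near_hull k l B \<sigma> \<tau>) \<le> card ?X"
    by (rule surj_card_le[OF fin near_hull_subset[OF assms]])
  also have "\<dots> = card (lattice_l1_ball k (2 * k)) * (card (lattice_l1_ball l (2 * k)) * card (lattice_l1_ball k ((\<tau> + \<sigma> + 18) * k)))"
    by (simp add: card_cartesian_product)
  also have "\<dots> \<le> (2 ^ (2 * k) * 3 ^ k) * ((2 ^ (2 * k) * 3 ^ k) * (2 ^ ((\<tau> + \<sigma> + 18) * k) * 3 ^ k))"
  proof (intro mult_le_mono card_lattice_l1_ball)
    have "card (lattice_l1_ball l (2 * k)) \<le> 2 ^ (2 * k) * 3 ^ l" by (rule card_lattice_l1_ball)
    also have "\<dots> \<le> 2 ^ (2 * k) * 3 ^ k" using assms(1) by (intro mult_le_mono power_increasing) auto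
    finally show "card (lattice_l1_ball l (2 * k)) \<le> 2 ^ (2 * k) * 3 ^ k" .
  qed
  also have "\<dots> = (2 ^ 2 * 3 * (2 ^ 2 * 3 * (2 ^ (\<tau> + \<sigma> + 18) * 3))) ^ k"
    by (simp only: power_mult_distrib power_mult)
  also have "2 ^ 2 * 3 * (2 ^ 2 * 3 * (2 ^ (\<tau> + \<sigma> + 18) * 3)) = (2 ^ (\<tau> + \<sigma> + 22) * 27 :: nat)"
    by (simp add: power_add)
  finally show "card (near_hull k l B \<sigma> \<tau>) \<le> (2 ^ (\<tau> + \<sigma> + 22) * 27) ^ k" .
qed

text \<open>Derandomized rounding by the method of conditional expectations.\<close>

lemma rounding_potential:
  fixes a :: "'w \<Rightarrow> 'e \<Rightarrow> real" and W :: "'e \<Rightarrow> real" and h :: real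
  assumes I: "finite I" and a: "\<And>\<omega> e. \<omega> \<in> \<Omega> \<Longrightarrow> e \<in> I \<Longrightarrow> \<bar>a \<omega> e\<bar> \<le> 1" and l: "0 \<le> h" "h \<le> 1"
  shows "\<exists>\<zeta>. (\<forall>e\<in>I. \<zeta> e \<in> {\<lfloor>W e\<rfloor>, \<lfloor>W e\<rfloor> + 1}) \<and>
    (\<Sum>\<omega>\<in>\<Omega>. exp (h * (\<Sum>e\<in>I. a \<omega> e * (of_int (\<zeta> e) - W e)))) \<le> card \<Omega> * exp (h\<^sup>2 * card I)"
  using I a
proof (induction I)
  case empty
  show ?case by simp
next
  case (insert e I)
  from insert obtain \<zeta> where \<zeta>: "\<forall>e\<in>I. \<zeta> e \<in> {\<lfloor>W e\<rfloor>, \<lfloor>W e\<rfloor> + 1}"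
    "(\<Sum>\<omega>\<in>\<Omega>. exp (h * (\<Sum>e\<in>I. a \<omega> e * (of_int (\<zeta> e) - W e)))) \<le> card \<Omega> * exp (h\<^sup>2 * card I)" by auto
  define S where "S \<omega> = exp (h * (\<Sum>e\<in>I. a \<omega> e * (of_int (\<zeta> e) - W e)))" for \<omega>
  \<comment> \<open>Rounding up with probability \<open>p\<close> has mean \<open>W e\<close>, so
    the first-order term cancels and the average potential grows by at most the factor
    \<open>exp (h\<^sup>2)\<close>. One of the two choices does no worse than the average.\<close>
  define p where "p = W e - of_int \<lfloor>W e\<rfloor>"
  have p: "0 \<le> p" "p \<le> 1" unfolding p_def by linarith+
  define Q where "Q d = (\<Sum>\<omega>\<in>\<Omega>. S \<omega> * exp (h * a \<omega> e * d))" for d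
  have "(1 - p) * Q (- p) + p * Q (1 - p) \<le> (\<Sum>\<omega>\<in>\<Omega>. S \<omega> * exp (h\<^sup>2))"
    unfolding Q_def sum_distrib_left sum.distrib[symmetric]
  proof (rule sum_mono)
    fix \<omega> assume w: "\<omega> \<in> \<Omega>"
    define x where "x = h * a \<omega> e"
    have x1: "\<bar>x\<bar> \<le> h" using l insert.prems[of \<omega> e] w by (simp add: x_def abs_mult mult_left_le)
    have b1: "exp (x * (- p)) \<le> 1 + x * (- p) + (x * (- p))\<^sup>2"
      using x1 l p by (intro exp_le_quadratic) (auto simp: abs_mult intro!: mult_le_one)
    have b2: "exp (x * (1 - p)) \<le> 1 + x * (1 - p) + (x * (1 - p))\<^sup>2"
      using x1 l p by (intro exp_le_quadratic) (auto simp: abs_mult intro!: mult_le_one)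
    have "(1 - p) * exp (x * (- p)) + p * exp (x * (1 - p))
        \<le> (1 - p) * (1 + x * (- p) + (x * (- p))\<^sup>2) + p * (1 + x * (1 - p) + (x * (1 - p))\<^sup>2)"
      using p by (intro add_mono mult_left_mono b1 b2) auto
    also have "\<dots> = 1 + x\<^sup>2 * (p * (1 - p))" by (simp add: power2_eq_square algebra_simps)
    also have "\<dots> \<le> 1 + h\<^sup>2 * 1"
    proof -
      have "\<bar>x\<bar>\<^sup>2 \<le> h\<^sup>2" using x1 by (intro power_mono) auto
      then have "x\<^sup>2 * (p * (1 - p)) \<le> h\<^sup>2 * 1" using p by (intro mult_mono mult_le_one) auto
      then show ?thesis by simp
    qed
    also have "\<dots> \<le> exp (h\<^sup>2)" using exp_ge_add_one_self[of "h\<^sup>2"] by simp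
    finally have "S \<omega> * ((1 - p) * exp (x * (- p)) + p * exp (x * (1 - p))) \<le> S \<omega> * exp (h\<^sup>2)"
      by (intro mult_left_mono) (auto simp: S_def)
    then show "(1 - p) * (S \<omega> * exp (h * a \<omega> e * - p)) + p * (S \<omega> * exp (h * a \<omega> e * (1 - p))) \<le> S \<omega> * exp (h\<^sup>2)"
      by (simp add: x_def algebra_simps)
  qed
  also have "\<dots> = (\<Sum>\<omega>\<in>\<Omega>. S \<omega>) * exp (h\<^sup>2)" by (simp add: sum_distrib_right)
  also have "\<dots> \<le> (card \<Omega> * exp (h\<^sup>2 * card I)) * exp (h\<^sup>2)"
    using \<zeta>(2) unfolding S_def by (intro mult_right_mono) auto
  also have "\<dots> = card \<Omega> * exp (h\<^sup>2 * card (insert e I))"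
    using insert.hyps by (simp add: exp_add[symmetric] distrib_left mult.assoc add.commute)
  finally have avg: "(1 - p) * Q (- p) + p * Q (1 - p) \<le> card \<Omega> * exp (h\<^sup>2 * card (insert e I))" .
  have "\<exists>n\<in>{\<lfloor>W e\<rfloor>, \<lfloor>W e\<rfloor> + 1}. Q (of_int n - W e) \<le> card \<Omega> * exp (h\<^sup>2 * card (insert e I))"
  proof (rule ccontr)
    assume "\<not> ?thesis"
    then have g: "card \<Omega> * exp (h\<^sup>2 * card (insert e I)) < Q (- p)" "card \<Omega> * exp (h\<^sup>2 * card (insert e I)) < Q (1 - p)"
      by (auto simp: p_def not_le algebra_simps)
    define m where "m = min (Q (- p)) (Q (1 - p))"
    have "(1 - p) * m + p * m \<le> (1 - p) * Q (- p) + p * Q (1 - p)"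
      using p by (intro add_mono mult_left_mono) (auto simp: m_def)
    then have "m \<le> (1 - p) * Q (- p) + p * Q (1 - p)" by (simp add: algebra_simps)
    then show False using g avg by (simp add: m_def min_def split: if_splits)
  qed
  then obtain n where n: "n \<in> {\<lfloor>W e\<rfloor>, \<lfloor>W e\<rfloor> + 1}" "Q (of_int n - W e) \<le> card \<Omega> * exp (h\<^sup>2 * card (insert e I))" by blast
  have "(\<Sum>e'\<in>insert e I. a \<omega> e' * (of_int ((\<zeta>(e := n)) e') - W e')) = a \<omega> e * (of_int n - W e) + (\<Sum>e\<in>I. a \<omega> e * (of_int (\<zeta> e) - W e))" for \<omega>
  proof -
    have "(\<Sum>e'\<in>I. a \<omega> e' * (of_int ((\<zeta>(e := n)) e') - W e')) = (\<Sum>e\<in>I. a \<omega> e * (of_int (\<zeta> e) - W e))"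
      using insert.hyps by (intro sum.cong) auto
    then show ?thesis using insert.hyps by simp
  qed
  then have "(\<Sum>\<omega>\<in>\<Omega>. exp (h * (\<Sum>e'\<in>insert e I. a \<omega> e' * (of_int ((\<zeta>(e := n)) e') - W e')))) = Q (of_int n - W e)"
    unfolding Q_def S_def by (simp add: distrib_left exp_add mult_ac)
  then show ?case using n \<zeta>(1) insert.hyps by (intro exI[of _ "\<zeta>(e := n)"]) auto
qed

text \<open>The potential runs over all pairs of sign vectors, so each bilinear form satisfies exp
  (h * form) <= 4^k * exp k <= exp (3 * k). With h = 1 / sqrt k the form is at most 3 * k * sqrt k,
  where entrywise rounding alone would only give k^2.\<close>

lemma rounding_matrix:
  fixes W :: "nat \<Rightarrow> nat \<Rightarrow> real"
  assumes k: "k \<ge> 1"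
  obtains \<zeta> :: "nat \<Rightarrow> nat \<Rightarrow> int" where "\<And>i j. i < k \<Longrightarrow> j < k \<Longrightarrow> \<bar>of_int (\<zeta> i j) - W i j\<bar> \<le> 1"
    "\<And>g. (\<And>j. j < k \<Longrightarrow> \<bar>g j\<bar> \<le> 1) \<Longrightarrow> (\<Sum>i<k. \<bar>\<Sum>j<k. (of_int (\<zeta> i j) - W i j) * g j\<bar>) \<le> 3 * real k * sqrt k"
proof -
  let ?I = "{..<k} \<times> {..<k}"
  define h where "h = 1 / sqrt (real k)"
  have l: "0 \<le> h" "h \<le> 1" "h > 0" using k by (auto simp: h_def)
  have "\<bar>fst \<omega> (fst e) * snd \<omega> (snd e)\<bar> \<le> 1" if "\<omega> \<in> signs k \<times> signs k" "e \<in> ?I" for \<omega> :: "(nat \<Rightarrow> real) \<times> (nat \<Rightarrow> real)" and e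
  proof -
    have "fst \<omega> (fst e) \<in> {-1,1}" "snd \<omega> (snd e) \<in> {-1,1}" using that sign_cases[of _ k] by (auto simp: mem_Times_iff)
    then show ?thesis by auto
  qed
  from rounding_potential[of ?I "signs k \<times> signs k" "\<lambda>\<omega> e. fst \<omega> (fst e) * snd \<omega> (snd e)" h "\<lambda>e. W (fst e) (snd e)", OF _ this l(1,2)]
  obtain \<zeta>0 where \<zeta>0: "\<forall>e\<in>?I. \<zeta>0 e \<in> {\<lfloor>W (fst e) (snd e)\<rfloor>, \<lfloor>W (fst e) (snd e)\<rfloor> + 1}"
    and pot: "(\<Sum>\<omega>\<in>signs k \<times> signs k. exp (h * (\<Sum>e\<in>?I. fst \<omega> (fst e) * snd \<omega> (snd e) * (of_int (\<zeta>0 e) - W (fst e) (snd e)))))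
      \<le> card (signs k \<times> signs k) * exp (h\<^sup>2 * card ?I)" by auto
  define \<zeta> where "\<zeta> i j = \<zeta>0 (i, j)" for i j
  define D where "D i j = of_int (\<zeta> i j) - W i j" for i j
  have small: "\<bar>D i j\<bar> \<le> 1" if "i < k" "j < k" for i j
  proof -
    have "\<zeta> i j \<in> {\<lfloor>W i j\<rfloor>, \<lfloor>W i j\<rfloor> + 1}" using \<zeta>0 that by (auto simp: \<zeta>_def)
    then show ?thesis unfolding D_def by (elim insertE emptyE; simp; linarith)
  qed
  have bil: "(\<Sum>i<k. \<Sum>j<k. s i * t j * D i j) \<le> 3 * real k * sqrt k" if s: "s \<in> signs k" and t: "t \<in> signs k" for s t
  proof -
    have "exp (h * (\<Sum>i<k. \<Sum>j<k. s i * t j * D i j)) \<le> (\<Sum>\<omega>\<in>signs k \<times> signs k. exp (h * (\<Sum>e\<in>?I. fst \<omega> (fst e) * snd \<omega> (snd e) * (of_int (\<zeta>0 e) - W (fst e) (snd e)))))"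
    proof -
      have "(\<Sum>i<k. \<Sum>j<k. s i * t j * D i j) = (\<Sum>e\<in>?I. s (fst e) * t (snd e) * (of_int (\<zeta>0 e) - W (fst e) (snd e)))"
        by (simp add: sum.cartesian_product D_def \<zeta>_def split_beta)
      moreover have "exp (h * (\<Sum>e\<in>?I. fst (s, t) (fst e) * snd (s, t) (snd e) * (of_int (\<zeta>0 e) - W (fst e) (snd e))))
        \<le> (\<Sum>\<omega>\<in>signs k \<times> signs k. exp (h * (\<Sum>e\<in>?I. fst \<omega> (fst e) * snd \<omega> (snd e) * (of_int (\<zeta>0 e) - W (fst e) (snd e)))))"
        by (rule member_le_sum[of "(s, t)"]) (use s t in auto)
      ultimately show ?thesis by simp
    qed
    also have "\<dots> \<le> 4 ^ k * exp (real k)"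
    proof -
      have hk: "h\<^sup>2 * card ?I = real k" using k by (simp add: h_def power_divide)
      have ck: "real (card (signs k \<times> signs k)) = 4 ^ k"
        by (simp add: card_cartesian_product card_signs flip: power_mult_distrib)
      show ?thesis using pot unfolding hk ck .
    qed
    also have "\<dots> \<le> exp 2 ^ k * exp (real k)"
    proof (intro mult_right_mono power_mono)
      have "(4::real) \<le> (exp 1)\<^sup>2" using power_mono[OF exp_ge_add_one_self[of 1], of 2] by simp
      then show "(4::real) \<le> exp 2" by (simp add: exp_of_nat_mult[symmetric])
    qed auto
    also have "\<dots> = exp (3 * real k)" by (simp add: exp_of_nat_mult[symmetric] exp_add[symmetric])
    finally have "h * (\<Sum>i<k. \<Sum>j<k. s i * t j * D i j) \<le> 3 * real k" by simp
    then show ?thesis using k by (simp add: h_def field_simps)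
  qed
  have "(\<Sum>i<k. \<bar>\<Sum>j<k. D i j * g j\<bar>) \<le> 3 * real k * sqrt k" if g: "\<And>j. j < k \<Longrightarrow> \<bar>g j\<bar> \<le> 1" for g
  proof -
    \<comment> \<open>Signs \<open>s\<close> remove the absolute values over \<open>i\<close>; signs
      \<open>t\<close> then replace \<open>g\<close>, since a linear form on the cube is largest at
      a vertex.\<close>
    define sg where "sg f = (\<lambda>i\<in>{..<k}. if f i \<ge> 0 then 1 else - 1 :: real)" for f :: "nat \<Rightarrow> real"
    have sgs: "sg f \<in> signs k" for f by (auto simp: sg_def)
    have sga: "\<bar>f i\<bar> = sg f i * f i" if "i < k" for f i using that by (auto simp: sg_def)
    define s where "s = sg (\<lambda>i. \<Sum>j<k. D i j * g j)"
    define t where "t = sg (\<lambda>j. \<Sum>i<k. s i * D i j)"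
    have "(\<Sum>i<k. \<bar>\<Sum>j<k. D i j * g j\<bar>) = (\<Sum>i<k. s i * (\<Sum>j<k. D i j * g j))"
      by (intro sum.cong refl) (simp add: s_def sga[of _ "\<lambda>i. \<Sum>j<k. D i j * g j"])
    also have "\<dots> = (\<Sum>j<k. g j * (\<Sum>i<k. s i * D i j))"
      unfolding sum_distrib_left by (subst sum.swap) (simp add: mult_ac)
    also have "\<dots> \<le> (\<Sum>j<k. \<bar>\<Sum>i<k. s i * D i j\<bar>)"
    proof (rule sum_mono)
      fix j assume "j \<in> {..<k}"
      then have "\<bar>g j\<bar> * \<bar>\<Sum>i<k. s i * D i j\<bar> \<le> 1 * \<bar>\<Sum>i<k. s i * D i j\<bar>" using g by (intro mult_right_mono) auto
      then show "g j * (\<Sum>i<k. s i * D i j) \<le> \<bar>\<Sum>i<k. s i * D i j\<bar>"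
        using abs_ge_self[of "g j * (\<Sum>i<k. s i * D i j)"] by (simp add: abs_mult)
    qed
    also have "\<dots> = (\<Sum>j<k. t j * (\<Sum>i<k. s i * D i j))"
      by (intro sum.cong refl) (simp add: t_def sga[of _ "\<lambda>j. \<Sum>i<k. s i * D i j"])
    also have "\<dots> = (\<Sum>i<k. \<Sum>j<k. s i * t j * D i j)"
      unfolding sum_distrib_left by (subst sum.swap) (simp add: mult_ac)
    also have "\<dots> \<le> 3 * real k * sqrt k" by (rule bil) (auto simp: s_def t_def sgs)
    finally show ?thesis .
  qed
  then show ?thesis using small unfolding D_def by (intro that[of \<zeta>]) auto
qed

section \<open>Gluskin's argument\<close>

text \<open>The matrices \<open>A\<close> for which some volume-controlled operator maps the unit ball of the quotient
  given by \<open>A\<close> into \<open>c \<surd>k\<close> times that of the quotient given by \<open>B\<close>.\<close>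

definition absorbed :: "nat \<Rightarrow> nat \<Rightarrow> nat \<Rightarrow> real \<Rightarrow> (nat \<Rightarrow> nat \<Rightarrow> real) \<Rightarrow> (nat \<Rightarrow> nat \<Rightarrow> real) set"
  where "absorbed k l L c B = {A \<in> grid_matrices k l L. \<exists>T T'. mutually_inverse k T T' \<and> preimage_volume k T \<le> 1 \<and>
    (\<forall>j<k. (\<lambda>i. T i j / c) \<in> unit_hull k l B) \<and>
    (\<forall>j<l. (\<lambda>i. mat_vec k T (\<lambda>i. A i j) i / (c * sqrt k)) \<in> unit_hull k l B)}"

lemma card_grid_matrices_columns_le:
  assumes \<Gamma>: "finite \<Gamma>"
  shows "card {A \<in> grid_matrices k l L. \<forall>j<l. (\<lambda>i\<in>{..<k}. A i j) \<in> \<Gamma>} \<le> card \<Gamma> ^ l" (is "card ?S \<le> _")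
proof -
  define F where "F A = (\<lambda>j\<in>{..<l}. \<lambda>i\<in>{..<k}. A i j)" for A :: "nat \<Rightarrow> nat \<Rightarrow> real"
  have "inj_on F ?S"
  proof (rule inj_onI)
    fix A B assume A: "A \<in> ?S" and B: "B \<in> ?S" and eq: "F A = F B"
    have "A i j = B i j" if "i < k" "j < l" for i j
    proof -
      have "F A j i = F B j i" using eq by simp
      then show ?thesis using that by (simp add: F_def)
    qed
    note ent = this
    have A': "A \<in> {..<k} \<rightarrow>\<^sub>E ({..<l} \<rightarrow>\<^sub>E grid L)" and B': "B \<in> {..<k} \<rightarrow>\<^sub>E ({..<l} \<rightarrow>\<^sub>E grid L)"
      using A B by (simp_all add: grid_matrices_def)
    show "A = B"
    proof (rule PiE_ext[OF A' B'], rule ext)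
      fix i j assume i: "i \<in> {..<k}"
      have Ai: "A i \<in> {..<l} \<rightarrow>\<^sub>E grid L" by (rule PiE_mem[OF A' i])
      have Bi: "B i \<in> {..<l} \<rightarrow>\<^sub>E grid L" by (rule PiE_mem[OF B' i])
      show "A i j = B i j"
      proof (cases "j < l")
        case False
        then have "A i j = undefined" "B i j = undefined" using PiE_arb[OF Ai, of j] PiE_arb[OF Bi, of j] by simp_all
        then show ?thesis by simp
      qed (use ent i in simp)
    qed
  qed
  moreover have "F ` ?S \<subseteq> {..<l} \<rightarrow>\<^sub>E \<Gamma>" by (auto simp: F_def)
  moreover have "finite ({..<l} \<rightarrow>\<^sub>E \<Gamma>)" using \<Gamma> by (intro finite_PiE) auto
  ultimately have "card ?S \<le> card ({..<l} \<rightarrow>\<^sub>E \<Gamma>)" by (rule card_inj_on_le)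
  then show ?thesis by (simp add: card_PiE)
qed

text \<open>The operator belonging to \<open>A\<close> is rounded to an integer matrix
  \<open>\<eta>\<close>, with at most card (near_hull 0 1)^k values. Once \<open>\<eta>\<close> is
  fixed, a representative operator \<open>R \<eta>\<close> that no longer depends on
  \<open>A\<close> sends every column of \<open>A\<close> close to the dilated ball of
  \<open>B\<close>, and \<open>card_grid_points_le\<close> bounds the number of such
  columns.\<close>

lemma card_absorbed_le:
  assumes k: "k \<ge> 1" and lk: "l \<le> k" and L: "L \<ge> k\<^sup>2" and c: "c > 0"
    and ent: "entries_le_1 k l B" and euc: "l1_euclidean a 16 k l B"
  shows "real (card (absorbed k l L c B)) \<le>
    real (card (near_hull k l B 0 1)) ^ k * ((c ^ k * real (card (near_hull k l B 6 2))) ^ l * card (grid_matrices k l L))"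
proof -
  have L0: "L > 0" using k L by (metis gr0I le_zero_eq not_one_le_zero power_eq_0_iff zero_neq_numeral)
  have sk: "sqrt (real k) > 0" "sqrt (real k) * sqrt (real k) = real k" using k by auto
  define \<N> where "\<N> = {..<k} \<rightarrow>\<^sub>E near_hull k l B 0 1"
  \<comment> \<open>\<open>P \<eta> T\<close> says that \<open>T\<close> is admissible and rounds to
    \<open>\<eta>\<close> with a small error from l-infinity to l1.\<close>
  define P where "P \<eta> T \<longleftrightarrow> (\<exists>T'. mutually_inverse k T T') \<and> preimage_volume k T \<le> 1 \<and>
    (\<forall>j<k. (\<lambda>i. T i j / c) \<in> unit_hull k l B) \<and>
    (\<forall>g. (\<forall>j<k. \<bar>g j\<bar> \<le> 1) \<longrightarrow> (\<Sum>i<k. \<bar>\<Sum>j<k. (of_int (\<eta> j i) - sqrt k * (T i j / c)) * g j\<bar>) \<le> 3 * real k * sqrt k)"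
    for \<eta> :: "nat \<Rightarrow> nat \<Rightarrow> int" and T
  define R where "R \<eta> = (SOME T. P \<eta> T)" for \<eta>
  define \<N>' where "\<N>' = {\<eta> \<in> \<N>. \<exists>T. P \<eta> T}"
  have R: "P \<eta> (R \<eta>)" if "\<eta> \<in> \<N>'" for \<eta> using that someI_ex[of "P \<eta>"] by (auto simp: \<N>'_def R_def)
  define \<Gamma> where "\<Gamma> \<eta> = {g \<in> {..<k} \<rightarrow>\<^sub>E grid L. \<exists>x\<in>unit_hull k l B. \<exists>w. (\<Sum>i<k. \<bar>w i\<bar>) \<le> 6 * real k \<and>
    (\<forall>i<k. mat_vec k (R \<eta>) g i / c = sqrt k * x i + w i)}" for \<eta>
  have fin1: "finite (near_hull k l B 0 1)" and fin2: "finite (near_hull k l B 6 2)"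
    using card_near_hull(1)[OF lk k euc] by auto
  have finN: "finite \<N>" unfolding \<N>_def using fin1 by (intro finite_PiE) auto
  have finG: "finite (\<Gamma> \<eta>)" for \<eta>
  proof -
    have "finite ({..<k} \<rightarrow>\<^sub>E grid L)" by (intro finite_PiE) auto
    then show ?thesis unfolding \<Gamma>_def by simp
  qed
  have gr1: "\<bar>g j\<bar> \<le> 1" if "g \<in> {..<k} \<rightarrow>\<^sub>E grid L" "j < k" for g j
  proof -
    have "g j \<in> grid L" using that by (auto simp: PiE_iff)
    then show ?thesis using grid_subset[OF L0] by (auto simp: abs_le_iff)
  qed
  have cover: "absorbed k l L c B \<subseteq> (\<Union>\<eta>\<in>\<N>'. {A \<in> grid_matrices k l L. \<forall>j<l. (\<lambda>i\<in>{..<k}. A i j) \<in> \<Gamma> \<eta>})"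
  proof
    fix A assume "A \<in> absorbed k l L c B"
    then obtain T T' where A: "A \<in> grid_matrices k l L" and T: "mutually_inverse k T T'" "preimage_volume k T \<le> 1"
      and col: "\<And>j. j < k \<Longrightarrow> (\<lambda>i. T i j / c) \<in> unit_hull k l B"
      and img: "\<And>j. j < l \<Longrightarrow> (\<lambda>i. mat_vec k T (\<lambda>i. A i j) i / (c * sqrt k)) \<in> unit_hull k l B"
      unfolding absorbed_def by blast
    define W where "W i j = sqrt k * (T i j / c)" for i j
    obtain \<zeta> :: "nat \<Rightarrow> nat \<Rightarrow> int" where z1: "\<And>i j. i < k \<Longrightarrow> j < k \<Longrightarrow> \<bar>of_int (\<zeta> i j) - W i j\<bar> \<le> 1"
      and z2: "\<And>g. (\<And>j. j < k \<Longrightarrow> \<bar>g j\<bar> \<le> 1) \<Longrightarrow> (\<Sum>i<k. \<bar>\<Sum>j<k. (of_int (\<zeta> i j) - W i j) * g j\<bar>) \<le> 3 * real k * sqrt k"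
      using rounding_matrix[OF k, of W] by blast
    \<comment> \<open>Transposed on purpose: \<open>\<eta> j\<close> is a rounded column, so
      \<open>\<eta>\<close> lies in a product of \<open>k\<close> copies of
      \<open>near_hull\<close>.\<close>
    define \<eta> where "\<eta> = (\<lambda>j\<in>{..<k}. \<lambda>i\<in>{..<k}. \<zeta> i j)"
    have \<eta>: "\<eta> j i = \<zeta> i j" if "i < k" "j < k" for i j using that by (simp add: \<eta>_def)
    have "\<eta> \<in> \<N>"
      unfolding \<N>_def
    proof (rule PiE_I)
      fix j assume j: "j \<in> {..<k}"
      show "\<eta> j \<in> near_hull k l B 0 1"
        unfolding near_hull_def
      proof (intro CollectI conjI bexI[of _ "\<lambda>i. T i j / c"] exI[of _ "\<lambda>_. 0"])
        show "\<eta> j \<in> {..<k} \<rightarrow>\<^sub>E UNIV" using j by (simp add: \<eta>_def)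
        show "\<forall>i<k. \<bar>real_of_int (\<eta> j i) - sqrt (real k) * (T i j / c) - 0\<bar> \<le> real 1"
          using z1 j by (simp add: \<eta> W_def)
      qed (use col j in auto)
    qed (simp add: \<eta>_def)
    moreover have PT: "P \<eta> T"
      unfolding P_def
    proof (intro conjI allI impI)
      fix g :: "nat \<Rightarrow> real" assume g: "\<forall>j<k. \<bar>g j\<bar> \<le> 1"
      have "(\<Sum>i<k. \<bar>\<Sum>j<k. (of_int (\<eta> j i) - sqrt k * (T i j / c)) * g j\<bar>) = (\<Sum>i<k. \<bar>\<Sum>j<k. (of_int (\<zeta> i j) - W i j) * g j\<bar>)"
        by (intro sum.cong refl arg_cong[where f=abs]) (simp add: \<eta> W_def)
      also have "\<dots> \<le> 3 * real k * sqrt k" using g by (intro z2) auto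
      finally show "(\<Sum>i<k. \<bar>\<Sum>j<k. (of_int (\<eta> j i) - sqrt k * (T i j / c)) * g j\<bar>) \<le> 3 * real k * sqrt k" .
    qed (use T col in auto)
    ultimately have \<eta>': "\<eta> \<in> \<N>'" by (auto simp: \<N>'_def)
    have "(\<lambda>i\<in>{..<k}. A i j) \<in> \<Gamma> \<eta>" if j: "j < l" for j
    proof -
      define g where "g = (\<lambda>i\<in>{..<k}. A i j)"
      have gP: "g \<in> {..<k} \<rightarrow>\<^sub>E grid L"
        using A j by (auto simp: g_def grid_matrices_def PiE_iff)
      define x where "x i = mat_vec k T (\<lambda>i. A i j) i / (c * sqrt k)" for i
      have x: "x \<in> unit_hull k l B" using img[OF j] by (simp add: x_def[abs_def])
      have Tg: "mat_vec k T g i / c = sqrt k * x i" for i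
      proof -
        have "mat_vec k T g i = mat_vec k T (\<lambda>i. A i j) i" by (rule mat_vec_cong) (simp add: g_def)
        then show ?thesis using sk(1) by (simp add: x_def)
      qed
      \<comment> \<open>\<open>T\<close> and \<open>R \<eta>\<close> have the same rounding, each
        with error at most 3 * k * sqrt k on \<open>g\<close>. In the scale of \<open>w\<close> this
        is divided by \<open>sqrt k\<close>, which explains the parameter 6.\<close>
      define w where "w i = mat_vec k (R \<eta>) g i / c - mat_vec k T g i / c" for i
      define e where "e M i = (\<Sum>j<k. (of_int (\<eta> j i) - sqrt k * (M i j / c)) * g j)" for M i
      have "w i * sqrt k = e T i - e (R \<eta>) i" for i
        unfolding w_def e_def mat_vec_def sum_divide_distrib sum_subtractf[symmetric] sum_distrib_right
        by (intro sum.cong refl) (simp add: algebra_simps)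
      then have "\<bar>w i\<bar> * sqrt k \<le> \<bar>e T i\<bar> + \<bar>e (R \<eta>) i\<bar>" for i
      proof -
        fix i
        assume w: "\<And>i. w i * sqrt k = e T i - e (R \<eta>) i"
        have "\<bar>w i\<bar> * sqrt k = \<bar>w i * sqrt k\<bar>" by (simp add: abs_mult)
        then show "\<bar>w i\<bar> * sqrt k \<le> \<bar>e T i\<bar> + \<bar>e (R \<eta>) i\<bar>" unfolding w by linarith
      qed
      then have "(\<Sum>i<k. \<bar>w i\<bar>) * sqrt k \<le> (\<Sum>i<k. \<bar>e T i\<bar>) + (\<Sum>i<k. \<bar>e (R \<eta>) i\<bar>)"
        unfolding sum_distrib_right sum.distrib[symmetric] by (intro sum_mono) auto
      also have "\<dots> \<le> 3 * real k * sqrt k + 3 * real k * sqrt k"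
        using PT R[OF \<eta>'] gr1[OF gP] unfolding P_def e_def by (intro add_mono) blast+
      also have "\<dots> = (6 * real k) * sqrt k" by simp
      finally have w6: "(\<Sum>i<k. \<bar>w i\<bar>) \<le> 6 * real k" using sk(1) by (simp only: mult_le_cancel_right_pos)
      have "g \<in> \<Gamma> \<eta>"
        unfolding \<Gamma>_def using gP x w6 Tg
        by (intro CollectI conjI bexI[of _ x] exI[of _ w]) (auto simp: w_def)
      then show ?thesis by (simp add: g_def)
    qed
    then show "A \<in> (\<Union>\<eta>\<in>\<N>'. {A \<in> grid_matrices k l L. \<forall>j<l. (\<lambda>i\<in>{..<k}. A i j) \<in> \<Gamma> \<eta>})"
      using \<eta>' A by blast
  qed
  have card\<Gamma>: "real (card (\<Gamma> \<eta>)) \<le> real L ^ k * c ^ k * card (near_hull k l B 6 2)" if \<eta>: "\<eta> \<in> \<N>'" for \<eta>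
  proof -
    obtain T' where T': "mutually_inverse k (R \<eta>) T'" "preimage_volume k (R \<eta>) \<le> 1"
      and col: "\<And>j. j < k \<Longrightarrow> (\<lambda>i. R \<eta> i j / c) \<in> unit_hull k l B"
      using R[OF \<eta>] unfolding P_def by blast
    have entR: "\<bar>R \<eta> i j\<bar> \<le> c * sqrt k" if "i < k" "j < k" for i j
      using unit_hull_coord[OF ent col[OF that(2)] that(1)] c by (simp add: abs_mult pos_divide_le_eq mult.commute)
    show ?thesis
    proof (rule card_grid_points_le[OF T' c L0 fin2])
      show "\<Gamma> \<eta> \<subseteq> {..<k} \<rightarrow>\<^sub>E grid L" by (auto simp: \<Gamma>_def)
      fix g x assume g: "g \<in> \<Gamma> \<eta>" and xs: "x \<in> space (lborel_power k)"
        and near: "\<And>i. i < k \<Longrightarrow> g i \<le> x i \<and> x i < g i + 1 / real L"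
      obtain b w where b: "b \<in> unit_hull k l B" and w: "(\<Sum>i<k. \<bar>w i\<bar>) \<le> 6 * real k"
        and gb: "\<And>i. i < k \<Longrightarrow> mat_vec k (R \<eta>) g i / c = sqrt k * b i + w i"
        using g unfolding \<Gamma>_def by blast
      define z where "z = (\<lambda>i\<in>{..<k}. \<lfloor>mat_vec k (R \<eta>) x i / c\<rfloor>)"
      have "z \<in> near_hull k l B 6 2"
        unfolding near_hull_def
      proof (intro CollectI conjI bexI[OF _ b] exI[of _ w])
        show "z \<in> {..<k} \<rightarrow>\<^sub>E UNIV" by (simp add: z_def)
        show "(\<Sum>i<k. \<bar>w i\<bar>) \<le> real 6 * real k" using w by simp
        show "\<forall>i<k. \<bar>real_of_int (z i) - sqrt (real k) * b i - w i\<bar> \<le> real 2"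
        proof (intro allI impI)
          fix i assume i: "i < k"
          have "mat_vec k (R \<eta>) x i - mat_vec k (R \<eta>) g i = (\<Sum>j<k. R \<eta> i j * (x j - g j))"
            by (simp add: mat_vec_def right_diff_distrib sum_subtractf)
          also have "\<bar>\<dots>\<bar> \<le> (\<Sum>j<k. (c * sqrt k) * (1 / real L))"
          proof (rule order_trans[OF sum_abs sum_mono])
            fix j assume "j \<in> {..<k}"
            then have j: "j < k" by simp
            have "\<bar>x j - g j\<bar> \<le> 1 / real L" using near[OF j] by auto
            then show "\<bar>R \<eta> i j * (x j - g j)\<bar> \<le> (c * sqrt k) * (1 / real L)"
              unfolding abs_mult using entR[OF i j] c by (intro mult_mono) auto
          qed
          also have "\<dots> = c * ((real k * sqrt k) / real L)" by simp
          \<comment> \<open>Here L >= k^2 enters: within a grid cell the image moves by at most one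
            cube side. This and the floor make up the parameter 2.\<close>
          also have "\<dots> \<le> c * 1"
          proof (intro mult_left_mono)
            have "sqrt (real k) \<le> real k" using k by (simp add: real_le_lsqrt real_sqrt_le_iff sqrt_le_D self_le_power power2_eq_square real_sqrt_le_mono)
            then have "real k * sqrt k \<le> real k * real k" by (intro mult_left_mono) auto
            also have "\<dots> \<le> real L" using L by (metis of_nat_le_iff of_nat_mult power2_eq_square)
            finally show "real k * sqrt k / real L \<le> 1" using L0 by (simp add: pos_divide_le_eq)
          qed (use c in auto)
          finally have "\<bar>mat_vec k (R \<eta>) x i / c - mat_vec k (R \<eta>) g i / c\<bar> \<le> 1"
            using c by (simp add: abs_mult pos_divide_le_eq flip: diff_divide_distrib)
          moreover have "\<bar>real_of_int \<lfloor>mat_vec k (R \<eta>) x i / c\<rfloor> - mat_vec k (R \<eta>) x i / c\<bar> \<le> 1" by linarith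
          moreover have "real_of_int (z i) = of_int \<lfloor>mat_vec k (R \<eta>) x i / c\<rfloor>" using i by (simp add: z_def)
          ultimately have "\<bar>real_of_int (z i) - sqrt (real k) * b i - w i\<bar> \<le> 2" using gb[OF i] by linarith
          then show "\<bar>real_of_int (z i) - sqrt (real k) * b i - w i\<bar> \<le> real 2" by simp
        qed
      qed
      moreover have "\<forall>i<k. c * of_int (z i) \<le> mat_vec k (R \<eta>) x i \<and> mat_vec k (R \<eta>) x i < c * (of_int (z i) + 1)"
      proof (intro allI impI)
        fix i assume i: "i < k"
        have "of_int (z i) \<le> mat_vec k (R \<eta>) x i / c" "mat_vec k (R \<eta>) x i / c < of_int (z i) + 1"
          using i by (auto simp: z_def)
        then show "c * of_int (z i) \<le> mat_vec k (R \<eta>) x i \<and> mat_vec k (R \<eta>) x i < c * (of_int (z i) + 1)"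
          using c by (simp add: pos_le_divide_eq pos_divide_less_eq mult.commute)
      qed
      ultimately show "\<exists>z\<in>near_hull k l B 6 2. \<forall>i<k. c * of_int (z i) \<le> mat_vec k (R \<eta>) x i \<and> mat_vec k (R \<eta>) x i < c * (of_int (z i) + 1)"
        by blast
    qed
  qed
  let ?n1 = "real (card (near_hull k l B 0 1))" and ?n2 = "real (card (near_hull k l B 6 2))"
  let ?col = "\<lambda>\<eta>. {A \<in> grid_matrices k l L. \<forall>j<l. (\<lambda>i\<in>{..<k}. A i j) \<in> \<Gamma> \<eta>}"
  have colc: "real (card (?col \<eta>)) \<le> (c ^ k * ?n2) ^ l * card (grid_matrices k l L)" if \<eta>: "\<eta> \<in> \<N>'" for \<eta>
  proof -
    have "real (card (?col \<eta>)) \<le> real (card (\<Gamma> \<eta>) ^ l)"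
      using card_grid_matrices_columns_le[OF finG] by (simp only: of_nat_le_iff)
    also have "\<dots> = real (card (\<Gamma> \<eta>)) ^ l" by simp
    also have "\<dots> \<le> (real L ^ k * c ^ k * ?n2) ^ l" using card\<Gamma>[OF \<eta>] by (intro power_mono) auto
    also have "\<dots> = (c ^ k * ?n2) ^ l * (real L ^ k) ^ l" by (simp add: power_mult_distrib mult_ac)
    also have "\<dots> \<le> (c ^ k * ?n2) ^ l * (real (card (grid L)) ^ k) ^ l"
      using c L0 by (intro mult_left_mono power_mono) (auto simp: card_grid)
    also have "(real (card (grid L)) ^ k) ^ l = card (grid_matrices k l L)"
      by (simp add: card_grid_matrices power_mult)
    finally show ?thesis .
  qed
  have "card (absorbed k l L c B) \<le> card (\<Union>\<eta>\<in>\<N>'. ?col \<eta>)"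
    using finN by (intro card_mono cover) (auto simp: \<N>'_def)
  also have "\<dots> \<le> (\<Sum>\<eta>\<in>\<N>'. card (?col \<eta>))" using finN by (intro card_UN_le) (auto simp: \<N>'_def)
  finally have "real (card (absorbed k l L c B)) \<le> real (\<Sum>\<eta>\<in>\<N>'. card (?col \<eta>))" by (simp only: of_nat_le_iff)
  also have "\<dots> = (\<Sum>\<eta>\<in>\<N>'. real (card (?col \<eta>)))" by (rule of_nat_sum)
  also have "\<dots> \<le> (\<Sum>\<eta>\<in>\<N>'. (c ^ k * ?n2) ^ l * card (grid_matrices k l L))" by (intro sum_mono colc)
  also have "\<dots> = card \<N>' * ((c ^ k * ?n2) ^ l * card (grid_matrices k l L))" by simp
  also have "\<dots> \<le> ?n1 ^ k * ((c ^ k * ?n2) ^ l * card (grid_matrices k l L))"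
  proof (rule mult_right_mono)
    have "card \<N>' \<le> card \<N>" unfolding \<N>'_def by (intro card_mono finN) auto
    also have "\<dots> = card (near_hull k l B 0 1) ^ k" by (simp add: \<N>_def card_PiE)
    finally have "real (card \<N>') \<le> real (card (near_hull k l B 0 1) ^ k)" by (simp only: of_nat_le_iff)
    then show "real (card \<N>') \<le> ?n1 ^ k" by simp
  qed (use c in auto)
  finally show ?thesis .
qed

text \<open>The bound is strict to fit \<open>quot_norm_less_imp_unit_hull\<close>.\<close>

definition contracts :: "nat \<Rightarrow> nat \<Rightarrow> real \<Rightarrow> (nat \<Rightarrow> nat \<Rightarrow> real) \<Rightarrow> (nat \<Rightarrow> nat \<Rightarrow> real) \<Rightarrow> (nat \<Rightarrow> nat \<Rightarrow> real) \<Rightarrow> bool"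
  where "contracts k l r A B T \<longleftrightarrow> (\<forall>x. quot_norm k l A x \<le> 1 \<longrightarrow> quot_norm k l B (mat_vec k T x) < r)"

text \<open>The vectors \<open>sqrt k\<close> times a unit vector and the columns of
  \<open>A\<close> have norm at most 1, so both kinds of generators are mapped into the dilated hull
  of \<open>B\<close>.\<close>

lemma contracts_imp_absorbed:
  assumes k: "k \<ge> 1" and c: "c > 0" and A: "A \<in> grid_matrices k l L"
    and T: "mutually_inverse k T T'" "preimage_volume k T \<le> 1" "contracts k l (c * sqrt k) A B T"
  shows "A \<in> absorbed k l L c B"
proof -
  have sk: "sqrt (real k) > 0" using k by simp
  have hull: "(\<lambda>i. mat_vec k T x i / (c * sqrt k)) \<in> unit_hull k l B" if "quot_norm k l A x \<le> 1" for x
  proof (rule quot_norm_less_imp_unit_hull[OF k])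
    have "quot_norm k l B (\<lambda>i. mat_vec k T x i / (c * sqrt k)) = \<bar>inverse (c * sqrt k)\<bar> * quot_norm k l B (mat_vec k T x)"
      unfolding quot_norm_scale[symmetric] by (simp add: divide_inverse mult.commute)
    also have "\<dots> < 1"
      using T(3) that c sk by (simp add: contracts_def field_simps)
    finally show "quot_norm k l B (\<lambda>i. mat_vec k T x i / (c * sqrt k)) < 1" .
  qed
  have "(\<lambda>i. T i j / c) \<in> unit_hull k l B" if j: "j < k" for j
  proof -
    define x where "x i = (if i = j then sqrt (real k) else 0)" for i
    have "(\<Sum>i<k. \<bar>x i\<bar>) = (\<Sum>i<k. if i = j then sqrt (real k) else 0)" by (intro sum.cong) (auto simp: x_def)
    then have "quot_norm k l A x \<le> 1" using quot_norm_le_l1[of k l A x] j sk by simp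
    moreover have "mat_vec k T x i = T i j * sqrt k" for i
    proof -
      have "mat_vec k T x i = (\<Sum>m<k. if m = j then T i j * sqrt k else 0)"
        unfolding mat_vec_def by (intro sum.cong) (auto simp: x_def)
      then show ?thesis using j by simp
    qed
    ultimately show ?thesis using hull[of x] sk by simp
  qed
  moreover have "(\<lambda>i. mat_vec k T (\<lambda>i. A i j) i / (c * sqrt k)) \<in> unit_hull k l B" if j: "j < l" for j
  proof (rule hull)
    define y where "y m = (if m = j then 1 else 0 :: real)" for m
    have "(\<Sum>m<l. A i m * y m) = (\<Sum>m<l. if m = j then A i j else 0)" for i
      by (intro sum.cong) (auto simp: y_def)
    then have "(\<Sum>m<l. A i m * y m) = A i j" for i using j by simp
    moreover have "(\<Sum>m<l. \<bar>y m\<bar>) = (\<Sum>m<l. if m = j then 1 else 0)" by (intro sum.cong) (auto simp: y_def)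
    ultimately have "quot_cost k l A (\<lambda>i. A i j) y = 1" using j by (simp add: quot_cost_def)
    then show "quot_norm k l A (\<lambda>i. A i j) \<le> 1" using quot_norm_le_cost[of k l A "\<lambda>i. A i j" y] by simp
  qed
  ultimately show ?thesis using A T(1,2) unfolding absorbed_def by blast
qed

definition far_apart :: "nat \<Rightarrow> nat \<Rightarrow> real \<Rightarrow> (nat \<Rightarrow> nat \<Rightarrow> real) \<Rightarrow> (nat \<Rightarrow> nat \<Rightarrow> real) \<Rightarrow> bool"
  where "far_apart k l r A B \<longleftrightarrow> \<not> (\<exists>T T'. mutually_inverse k T T' \<and> contracts k l r A B T \<and> contracts k l r B A T')"

text \<open>The preimage volumes of \<open>T\<close> and \<open>T'\<close> have product 1, so one of
  them is at most 1 and that operator would witness absorption.\<close>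

lemma far_apart_of_not_absorbed:
  assumes k: "k \<ge> 1" and c: "c > 0" and AB: "A \<in> grid_matrices k l L" "B \<in> grid_matrices k l L"
    and na: "A \<notin> absorbed k l L c B" "B \<notin> absorbed k l L c A"
  shows "far_apart k l (c * sqrt k) A B"
  unfolding far_apart_def
proof
  assume "\<exists>T T'. mutually_inverse k T T' \<and> contracts k l (c * sqrt k) A B T \<and> contracts k l (c * sqrt k) B A T'"
  then obtain T T' where T: "mutually_inverse k T T'" "contracts k l (c * sqrt k) A B T" "contracts k l (c * sqrt k) B A T'" by blast
  have T': "mutually_inverse k T' T" using T(1) by (auto simp: mutually_inverse_def)
  have vol: "preimage_volume k T * preimage_volume k T' = 1" by (rule preimage_volume_mult[OF T(1)])
  have "preimage_volume k T \<le> 1 \<or> preimage_volume k T' \<le> 1"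
  proof (rule ccontr)
    assume "\<not> ?thesis"
    then have g: "1 < preimage_volume k T" "1 < preimage_volume k T'" by auto
    have "1 * preimage_volume k T' \<le> preimage_volume k T * preimage_volume k T'" using g by (intro mult_right_mono) auto
    then show False using g vol by simp
  qed
  then show False
    using contracts_imp_absorbed[OF k c AB(1) T(1) _ T(2)] contracts_imp_absorbed[OF k c AB(2) T' _ T(3)] na by blast
qed

text \<open>Two maps that shrink the unit ball strictly cannot compose to the identity. This serves
  the dimensions below \<open>M\<close>.\<close>

lemma far_apart_small:
  assumes k: "k \<ge> 1" and r: "r < 1" and A: "entries_le_1 k l A" shows "far_apart k l r A B"
  unfolding far_apart_def
proof
  assume "\<exists>T T'. mutually_inverse k T T' \<and> contracts k l r A B T \<and> contracts k l r B A T'"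
  then obtain T T' where T: "mutually_inverse k T T'" "contracts k l r A B T" "contracts k l r B A T'" by blast
  define e where "e i = (if i = 0 then 1 else 0 :: real)" for i :: nat
  have "\<bar>e 0\<bar> \<le> sqrt k * quot_norm k l A e" using k by (intro quot_norm_coord[OF A]) auto
  then have "0 \<noteq> quot_norm k l A e" by (auto simp: e_def)
  then have pos: "quot_norm k l A e > 0" using quot_norm_nonneg[of k l A e] by linarith
  define x where "x i = inverse (quot_norm k l A e) * e i" for i
  have x1: "quot_norm k l A x = 1" unfolding x_def quot_norm_scale using pos by simp
  then have "quot_norm k l B (mat_vec k T x) < r" using T(2) by (simp add: contracts_def)
  then have "quot_norm k l A (mat_vec k T' (mat_vec k T x)) < r" using T(3) r by (simp add: contracts_def)
  moreover have "quot_norm k l A (mat_vec k T' (mat_vec k T x)) = quot_norm k l A x"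
    using T(1) by (intro quot_norm_cong) (simp add: mutually_inverse_def)
  ultimately show False using x1 r by simp
qed

lemma gluskin_pairs:
  obtains a c :: real where "a > 0" "c > 0"
    "\<And>k. k \<ge> 1 \<Longrightarrow> \<exists>l A B. l \<le> k \<and> entries_le_1 k l A \<and> entries_le_1 k l B \<and>
      l1_euclidean a 16 k l A \<and> l1_euclidean a 16 k l B \<and> far_apart k l (c * sqrt k) A B"
proof -
  obtain a :: real and M :: nat where a: "a > 0" and M: "M \<ge> 1"
    and good: "\<And>k l L. L > 0 \<Longrightarrow> M * l \<le> k \<Longrightarrow>
      8 * real (card {G \<in> grid_matrices k l L. \<not> l1_euclidean a 16 k l G}) \<le> card (grid_matrices k l L)"
    using most_matrices_l1_euclidean by blast
  define C1 :: nat where "C1 = 2 ^ 23 * 27"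
  define C2 :: nat where "C2 = 2 ^ 30 * 27"
  have C: "C1 \<ge> 1" "C2 \<ge> 1" by (simp_all add: C1_def C2_def)
  \<comment> \<open>As \<open>k * k\<close> is at most \<open>2 * M * (k * l)\<close>, the number of
    operators is at most \<open>C1 ^ (2 * M)\<close> to the power \<open>k * l\<close>, and
    \<open>c\<close> makes its product with \<open>c * C2\<close> at most 1/8. The extra
    \<open>M\<close> ensures \<open>c * sqrt k < 1\<close> for \<open>k < M\<close>.\<close>
  define c :: real where "c = 1 / (8 * real M * real C1 ^ (2 * M) * real C2)"
  have den: "8 * real M * real C1 ^ (2 * M) * real C2 > 0" using M C by simp
  have c: "c > 0" unfolding c_def using den by simp
  have cC: "real C1 ^ (2 * M) * (c * real C2) \<le> 1/8"
  proof -
    have "real C1 ^ (2 * M) * (c * real C2) = 1 / (8 * real M)" using M C by (simp add: c_def)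
    also have "\<dots> \<le> 1/8" using M by (simp add: field_simps)
    finally show ?thesis .
  qed
  have main: "\<exists>l A B. l \<le> k \<and> entries_le_1 k l A \<and> entries_le_1 k l B \<and>
      l1_euclidean a 16 k l A \<and> l1_euclidean a 16 k l B \<and> far_apart k l (c * sqrt k) A B"
    if k: "k \<ge> 1" for k
  proof (cases "k < M")
    case True
    have "c * sqrt k < 1"
    proof -
      have "sqrt (real k) \<le> real k" using k by (simp add: real_le_lsqrt power2_eq_square)
      also have "\<dots> < real M" using True by simp
      finally have "c * sqrt k < c * real M" using c by (intro mult_strict_left_mono)
      also have "c * real M = 1 / (8 * real C1 ^ (2 * M) * real C2)" using M by (simp add: c_def)
      also have "\<dots> \<le> 1"
      proof -
        have "1 * 1 \<le> real C1 ^ (2 * M) * real C2" using C by (intro mult_mono one_le_power) auto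
        then have "1 \<le> 8 * real C1 ^ (2 * M) * real C2" by simp
        moreover have "0 < 8 * real C1 ^ (2 * M) * real C2" using C by simp
        ultimately show ?thesis by (simp only: pos_divide_le_eq mult_1)
      qed
      finally show ?thesis .
    qed
    \<comment> \<open>In low dimension no columns are used: the two spaces coincide, and a radius
      below 1 asks for nothing more.\<close>
    then have "far_apart k 0 (c * sqrt k) (\<lambda>_ _. 0) (\<lambda>_ _. 0)"
      using far_apart_small[OF k] by (simp add: entries_le_1_def)
    moreover have "l1_euclidean a 16 k 0 (\<lambda>_ _. 0)" by (simp add: l1_euclidean_def l2_def mat_vec_def)
    ultimately show ?thesis by (intro exI[of _ 0] exI[of _ "\<lambda>_ _. 0"]) (simp add: entries_le_1_def)
  next
    case False
    \<comment> \<open>Small enough for \<open>good\<close>, yet at least \<open>k / (2 * M)\<close>,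
      so the exponents \<open>k * l\<close> and \<open>k * k\<close> are comparable.\<close>
    define l where "l = k div M"
    have Ml: "M * l \<le> k" by (simp add: l_def)
    have l1: "l \<ge> 1" using False M by (simp add: l_def div_greater_zero_iff Suc_le_eq)
    have lk: "l \<le> k" by (simp add: l_def)
    have "k < M * l + M" using M dividend_less_times_div[of M k] by (simp add: l_def)
    also have "\<dots> \<le> 2 * M * l" using l1 by simp
    finally have k2: "k \<le> 2 * M * l" by simp
    define L where "L = k\<^sup>2"
    have L: "L > 0" using k by (simp add: L_def)
    define S where "S = grid_matrices k l L"
    define ok where "ok = {G \<in> S. l1_euclidean a 16 k l G}"
    have finS: "finite S" by (simp add: S_def)
    have S0: "card S > 0" using L by (simp add: S_def card_grid_matrices card_grid)
    have nok: "8 * real (card (S - ok)) \<le> card S"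
    proof -
      have "S - ok = {G \<in> grid_matrices k l L. \<not> l1_euclidean a 16 k l G}" by (auto simp: ok_def S_def)
      then show ?thesis using good[OF L Ml] by (simp add: S_def)
    qed
    have abs8: "8 * real (card (absorbed k l L c B)) \<le> card S" if B: "B \<in> ok" for B
    proof -
      have entB: "entries_le_1 k l B" and eucB: "l1_euclidean a 16 k l B"
        using B grid_matrix_entries[OF _ L] by (auto simp: ok_def S_def)
      have "real (card (near_hull k l B 0 1)) \<le> real (C1 ^ k)"
        using card_near_hull(2)[OF lk k eucB, of 0 1] by (simp only: of_nat_le_iff) (simp add: C1_def)
      then have n1: "real (card (near_hull k l B 0 1)) \<le> real C1 ^ k" by simp
      have "real (card (near_hull k l B 6 2)) \<le> real (C2 ^ k)"
        using card_near_hull(2)[OF lk k eucB, of 6 2] by (simp only: of_nat_le_iff) (simp add: C2_def)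
      then have n2: "real (card (near_hull k l B 6 2)) \<le> real C2 ^ k" by simp
      have "real (card (absorbed k l L c B)) \<le> real (card (near_hull k l B 0 1)) ^ k * ((c ^ k * real (card (near_hull k l B 6 2))) ^ l * card S)"
        unfolding S_def by (rule card_absorbed_le[OF k lk _ c entB eucB]) (simp add: L_def)
      also have "\<dots> \<le> (real C1 ^ k) ^ k * ((c ^ k * real C2 ^ k) ^ l * card S)"
        using n1 n2 c by (intro mult_mono power_mono mult_nonneg_nonneg zero_le_power mult_left_mono) auto
      also have "(real C1 ^ k) ^ k \<le> (real C1 ^ (2 * M)) ^ (k * l)"
        unfolding power_mult[symmetric]
      proof (intro power_increasing)
        have "k * k \<le> k * (2 * M * l)" by (intro mult_left_mono k2) simp
        then show "k * k \<le> 2 * M * (k * l)" by (simp add: mult_ac)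
      qed (use C in simp)
      also have "(c ^ k * real C2 ^ k) ^ l = (c * real C2) ^ (k * l)" by (simp add: power_mult power_mult_distrib)
      finally have "real (card (absorbed k l L c B)) \<le> (real C1 ^ (2 * M)) ^ (k * l) * ((c * real C2) ^ (k * l) * card S)"
        using c by (simp add: mult_right_mono)
      also have "\<dots> = (real C1 ^ (2 * M) * (c * real C2)) ^ (k * l) * card S" by (simp add: power_mult_distrib mult.assoc)
      also have "\<dots> \<le> (1/8) ^ 1 * card S"
      proof (intro mult_right_mono)
        have "(real C1 ^ (2 * M) * (c * real C2)) ^ (k * l) \<le> (1/8) ^ (k * l)" using cC c by (intro power_mono) auto
        also have "\<dots> \<le> (1/8) ^ 1" using k l1 by (intro power_decreasing) auto
        finally show "(real C1 ^ (2 * M) * (c * real C2)) ^ (k * l) \<le> (1/8) ^ 1" .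
      qed auto
      finally show ?thesis by simp
    qed
    have absS: "absorbed k l L c B \<subseteq> S" for B by (auto simp: absorbed_def S_def)
    have "\<exists>A\<in>ok. \<exists>B\<in>ok. A \<notin> absorbed k l L c B \<and> B \<notin> absorbed k l L c A"
    proof (rule ccontr)
      assume neg: "\<not> ?thesis"
      define X where "X = (SIGMA B:ok. absorbed k l L c B)"
      have finX: "finite X" unfolding X_def ok_def using finS absS by (intro finite_SigmaI) (auto intro: finite_subset)
      \<comment> \<open>If every pair failed, either a matrix would not be \<open>ok\<close> (at
        most 1/8 of the pairs for each position) or one would be absorbed by the other (again 1/8
        for each order): at most half of all pairs.\<close>
      have "S \<times> S \<subseteq> ((S - ok) \<times> S \<union> S \<times> (S - ok)) \<union> (X \<union> prod.swap ` X)"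
        using neg absS by (fastforce simp: X_def image_iff)
      then have "card (S \<times> S) \<le> card (((S - ok) \<times> S \<union> S \<times> (S - ok)) \<union> (X \<union> prod.swap ` X))"
        using finS finX by (intro card_mono) auto
      also have "\<dots> \<le> (card ((S - ok) \<times> S) + card (S \<times> (S - ok))) + (card X + card (prod.swap ` X))"
        by (intro order_trans[OF card_Un_le] add_mono card_Un_le)
      also have "\<dots> \<le> (card (S - ok) * card S + card S * card (S - ok)) + (card X + card X)"
        using finX by (intro add_mono card_image_le) (auto simp: card_cartesian_product)
      finally have le: "card S * card S \<le> 2 * (card (S - ok) * card S) + 2 * card X"
        by (simp add: card_cartesian_product mult.commute)
      have "real (card X) = (\<Sum>B\<in>ok. real (card (absorbed k l L c B)))"
        unfolding X_def using finS absS by (subst card_SigmaI) (auto simp: ok_def intro: finite_subset)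
      also have "\<dots> \<le> (\<Sum>B\<in>ok. card S / 8)" using abs8 by (intro sum_mono) (simp add: field_simps)
      also have "\<dots> \<le> card S * (card S / 8)"
        using finS by (simp, intro divide_right_mono mult_right_mono) (auto simp: ok_def intro: card_mono)
      finally have X8: "8 * real (card X) \<le> real (card S) * card S" by simp
      have ok8: "8 * (real (card (S - ok)) * card S) \<le> real (card S) * card S"
        using mult_right_mono[OF nok, of "real (card S)"] by (simp add: mult.assoc)
      have "real (card S * card S) \<le> real (2 * (card (S - ok) * card S) + 2 * card X)"
        using le by (simp only: of_nat_le_iff)
      then have "real (card S) * card S \<le> 2 * (real (card (S - ok)) * card S) + 2 * real (card X)" by simp
      then have "real (card S) * card S \<le> 0" using X8 ok8 by linarith
      moreover have "real (card S) * card S > 0" using S0 by simp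
      ultimately show False by linarith
    qed
    then obtain A B where AB: "A \<in> ok" "B \<in> ok" "A \<notin> absorbed k l L c B" "B \<notin> absorbed k l L c A" by blast
    have "far_apart k l (c * sqrt k) A B"
      by (rule far_apart_of_not_absorbed[OF k c _ _ AB(3,4)]) (use AB in \<open>auto simp: ok_def S_def\<close>)
    moreover have "entries_le_1 k l A" "entries_le_1 k l B" "l1_euclidean a 16 k l A" "l1_euclidean a 16 k l B"
      using AB grid_matrix_entries[OF _ L] by (auto simp: ok_def S_def)
    ultimately show ?thesis using lk by blast
  qed
  show ?thesis by (rule that[OF a c main])
qed

section \<open>Banach--Mazur distances in the direct sum\<close>

lemma linear_between_zero: "linear_between E F T \<Longrightarrow> 0 \<in> E \<Longrightarrow> T 0 = 0"
  unfolding linear_between_def by (metis scaleR_zero_left)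

lemma linear_between_sum:
  assumes T: "linear_between E F T" and E: "subspace E" and "finite I" and "\<And>i. i \<in> I \<Longrightarrow> x i \<in> E"
  shows "T (\<Sum>i\<in>I. c i *\<^sub>R x i) = (\<Sum>i\<in>I. c i *\<^sub>R T (x i))"
  using assms(3,4)
proof (induction I)
  case empty
  then show ?case using linear_between_zero[OF T subspace_0[OF E]] by simp
next
  case (insert i I)
  have "c i *\<^sub>R x i \<in> E" "(\<Sum>i\<in>I. c i *\<^sub>R x i) \<in> E"
    using insert E by (auto intro!: subspace_scale subspace_sum)
  then have "T (c i *\<^sub>R x i + (\<Sum>i\<in>I. c i *\<^sub>R x i)) = T (c i *\<^sub>R x i) + T (\<Sum>i\<in>I. c i *\<^sub>R x i)"
    using T unfolding linear_between_def by blast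
  moreover have "T (c i *\<^sub>R x i) = c i *\<^sub>R T (x i)" using T insert.prems unfolding linear_between_def by blast
  ultimately show ?case using insert by simp
qed

lemma linear_between_inv_into:
  assumes T: "linear_between E F T" and bij: "bij_betw T E F" and E: "subspace E"
  shows "linear_between F E (inv_into E T)"
proof -
  let ?S = "inv_into E T"
  have S: "?S z \<in> E" "T (?S z) = z" if "z \<in> F" for z
    using bij that by (auto simp: bij_betw_def inv_into_into f_inv_into_f)
  have inv: "?S (T x) = x" if "x \<in> E" for x using bij that by (auto simp: bij_betw_def)
  have add: "T (x + y) = T x + T y" if "x \<in> E" "y \<in> E" for x y using T that unfolding linear_between_def by blast
  have scale: "T (c *\<^sub>R x) = c *\<^sub>R T x" if "x \<in> E" for x c using T that unfolding linear_between_def by blast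
  show ?thesis
    unfolding linear_between_def
  proof (intro conjI ballI allI)
    show "?S ` F \<subseteq> E" using S by auto
    fix z z' assume z: "z \<in> F" "z' \<in> F"
    have "T (?S z + ?S z') = z + z'" using add S z by simp
    then show "?S (z + z') = ?S z + ?S z'" using inv[of "?S z + ?S z'"] S z E by (simp add: subspace_add)
  next
    fix c z assume z: "z \<in> F"
    have "T (c *\<^sub>R ?S z) = c *\<^sub>R z" using scale S z by simp
    then show "?S (c *\<^sub>R z) = c *\<^sub>R ?S z" using inv[of "c *\<^sub>R ?S z"] S z E by (simp add: subspace_scale)
  qed
qed

context normed_space_on
begin

lemma op_norm_bound:
  assumes T: "linear_between E F T" and E: "subspace E" "E \<subseteq> V" and F: "F \<subseteq> V"
    and le: "op_norm N E T \<le> ereal \<alpha>" and x: "x \<in> E"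
  shows "N (T x) \<le> \<alpha> * N x"
proof (cases "x = 0")
  case True
  have "N 0 = 0" using norm_eq_zero_iff[OF subspace_0[OF subspace_carrier]] by simp
  then show ?thesis using True linear_between_zero[OF T subspace_0[OF E(1)]] by simp
next
  case False
  have "x \<in> V" using x E by blast
  then have pos: "N x > 0" using False norm_nonneg[of x] norm_eq_zero_iff[of x] by linarith
  define y where "y = inverse (N x) *\<^sub>R x"
  have yE: "y \<in> E" unfolding y_def using E x by (simp add: subspace_scale)
  have "N y = 1" unfolding y_def using norm_scale[OF \<open>x \<in> V\<close>, of "inverse (N x)"] pos by simp
  then have "ereal (N (T y)) \<le> op_norm N E T"
    unfolding op_norm_def using yE by (intro SUP_upper) auto
  then have "N (T y) \<le> \<alpha>" using le order_trans by fastforce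
  moreover have "T y = inverse (N x) *\<^sub>R T x" unfolding y_def using T x unfolding linear_between_def by blast
  moreover have "T x \<in> V" using T F x unfolding linear_between_def by blast
  ultimately have "inverse (N x) * N (T x) \<le> \<alpha>" using norm_scale[of "T x" "inverse (N x)"] pos by simp
  then show ?thesis using pos by (simp add: field_simps)
qed

lemma op_norm_pos:
  assumes T: "linear_between E F T" and bij: "bij_betw T E F" and E: "subspace E" "E \<subseteq> V" and F: "F \<subseteq> V"
    and x: "x \<in> E" "x \<noteq> 0"
  shows "0 < op_norm N E T"
proof (rule ccontr)
  assume "\<not> ?thesis"
  then have le: "op_norm N E T \<le> ereal 0" by (simp add: not_less zero_ereal_def)
  have "N (T x) \<le> 0" using op_norm_bound[OF T E F le x(1)] by simp
  moreover have TxV: "T x \<in> V" using T F x unfolding linear_between_def by blast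
  ultimately have "N (T x) = 0" using norm_nonneg[OF TxV] by linarith
  then have "T x = T 0" using norm_eq_zero_iff[OF TxV] linear_between_zero[OF T subspace_0[OF E(1)]] by simp
  then have "x = 0" using bij x subspace_0[OF E(1)] unfolding bij_betw_def inj_on_def by blast
  then show False using x by simp
qed

text \<open>An isomorphism whose norm and inverse norm have product below r^2 can be multiplied by a
  scalar so that both norms fall below \<open>r\<close>; \<open>far\<close> excludes this.\<close>

lemma banach_mazur_dist_ge:
  assumes E: "subspace E" "E \<subseteq> V" "x \<in> E" "x \<noteq> 0" and F: "subspace F" "F \<subseteq> V" and r: "r > 0"
    and far: "\<And>T S. linear_between E F T \<Longrightarrow> linear_between F E S \<Longrightarrow>
      (\<And>x. x \<in> E \<Longrightarrow> S (T x) = x) \<Longrightarrow> (\<And>z. z \<in> F \<Longrightarrow> T (S z) = z) \<Longrightarrow>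
      (\<And>x. x \<in> E \<Longrightarrow> N x \<le> 1 \<Longrightarrow> N (T x) < r) \<Longrightarrow> (\<And>z. z \<in> F \<Longrightarrow> N z \<le> 1 \<Longrightarrow> N (S z) < r) \<Longrightarrow> False"
  shows "ereal (r\<^sup>2) \<le> banach_mazur_dist N E F"
  unfolding banach_mazur_dist_def
proof (rule INF_greatest)
  fix T assume "T \<in> {T. linear_between E F T \<and> bij_betw T E F}"
  then have T: "linear_between E F T" and bij: "bij_betw T E F" by auto
  define S where "S = inv_into E T"
  have S: "linear_between F E S" unfolding S_def by (rule linear_between_inv_into[OF T bij E(1)])
  have bijS: "bij_betw S F E" unfolding S_def by (rule bij_betw_inv_into[OF bij])
  have ST: "S (T x) = x" if "x \<in> E" for x using bij that by (auto simp: S_def bij_betw_def)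
  have TS: "T (S z) = z" if "z \<in> F" for z using bij that by (auto simp: S_def bij_betw_def f_inv_into_f)
  have TF: "T x \<in> F" if "x \<in> E" for x using T that unfolding linear_between_def by blast
  have SE: "S z \<in> E" if "z \<in> F" for z using S that unfolding linear_between_def by blast
  have "T x \<noteq> 0"
    using ST[OF E(3)] linear_between_zero[OF S subspace_0[OF F(1)]] E(4) by auto
  \<comment> \<open>In \<open>ereal\<close>, 0 * \<infinity> = 0. Positivity of both norms makes a
    finite product force both of them to be finite; the nonzero vector \<open>x\<close> is there for
    this.\<close>
  then have posT: "0 < op_norm N E T" and posS: "0 < op_norm N F S"
    using op_norm_pos[OF T bij E(1,2) F(2) E(3,4)] op_norm_pos[OF S bijS F(1,2) E(2) TF[OF E(3)]] by auto
  show "ereal (r\<^sup>2) \<le> op_norm N E T * op_norm N F (inv_into E T)"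
  proof (rule ccontr)
    assume "\<not> ?thesis"
    then have lt: "op_norm N E T * op_norm N F S < ereal (r\<^sup>2)" by (simp add: S_def)
    have "op_norm N E T \<noteq> \<infinity>" "op_norm N F S \<noteq> \<infinity>" using lt posT posS by (auto split: if_splits)
    then obtain \<alpha> \<beta> where ab: "op_norm N E T = ereal \<alpha>" "op_norm N F S = ereal \<beta>"
      using posT posS by (metis abs_ereal_ge0 ereal_infinity_cases less_imp_le MInfty_neq_ereal(1) ereal_cases not_MInfty_nonneg)
    then have pos: "\<alpha> > 0" "\<beta> > 0" "\<alpha> * \<beta> < r\<^sup>2" using posT posS lt by auto
    \<comment> \<open>A scalar \<open>s\<close> in this gap satisfies
      \<open>s * \<alpha> < r\<close> and \<open>\<beta> / s < r\<close>.\<close>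
    have "\<beta> / r < r / \<alpha>" using pos r by (simp add: field_simps power2_eq_square)
    then obtain s where s: "\<beta> / r < s" "s < r / \<alpha>" using dense by blast
    have s0: "s > 0" using s(1) pos r by (meson divide_pos_pos order_less_trans)
    define T1 where "T1 x = s *\<^sub>R T x" for x
    define S1 where "S1 z = inverse s *\<^sub>R S z" for z
    have T1: "linear_between E F T1"
      using T F(1) unfolding linear_between_def T1_def
      by (auto simp: scaleR_add_right subspace_scale image_subset_iff)
    have S1: "linear_between F E S1"
      using S E(1) unfolding linear_between_def S1_def
      by (auto simp: scaleR_add_right subspace_scale image_subset_iff)
    show False
    proof (rule far[OF T1 S1])
      show "S1 (T1 x) = x" if x: "x \<in> E" for x
      proof -
        have "S (s *\<^sub>R T x) = s *\<^sub>R S (T x)" using S TF[OF x] unfolding linear_between_def by blast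
        then show ?thesis using ST[OF x] s0 by (simp add: S1_def T1_def)
      qed
      show "T1 (S1 z) = z" if z: "z \<in> F" for z
      proof -
        have "T (inverse s *\<^sub>R S z) = inverse s *\<^sub>R T (S z)" using T SE[OF z] unfolding linear_between_def by blast
        then show ?thesis using TS[OF z] s0 by (simp add: S1_def T1_def)
      qed
      show "N (T1 x) < r" if x: "x \<in> E" "N x \<le> 1" for x
      proof -
        have "N (T x) \<le> \<alpha> * N x" using op_norm_bound[OF T E(1,2) F(2) _ x(1)] ab by simp
        also have "\<dots> \<le> \<alpha> * 1" using pos x by (intro mult_left_mono) auto
        finally have "s * N (T x) \<le> s * \<alpha>" using s0 by simp
        also have "\<dots> < r" using s pos by (simp add: pos_less_divide_eq)
        finally show ?thesis using norm_scale[of "T x" s] TF[OF x(1)] F(2) s0 by (auto simp: T1_def)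
      qed
      show "N (S1 z) < r" if z: "z \<in> F" "N z \<le> 1" for z
      proof -
        have "N (S z) \<le> \<beta> * N z" using op_norm_bound[OF S F(1,2) E(2) _ z(1)] ab by simp
        also have "\<dots> \<le> \<beta> * 1" using pos z by (intro mult_left_mono) auto
        also have "\<dots> < s * r" using s r by (simp add: pos_divide_less_eq)
        finally have "inverse s * N (S z) < r" using s0 by (simp add: field_simps)
        then show ?thesis using norm_scale[of "S z" "inverse s"] SE[OF z(1)] E(2) s0 by (auto simp: S1_def)
      qed
    qed
  qed
qed

end

context l2_sum
begin

section \<open>Operators between blocks as matrices\<close>

definition embed :: "nat \<Rightarrow> (nat \<Rightarrow> real) \<Rightarrow> nat \<Rightarrow> real"
  where "embed n v = (\<lambda>m. if fst (prod_decode m) = n \<and> snd (prod_decode m) < d n then v (snd (prod_decode m)) else 0)"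

lemma embed_in_block_space: "embed n v \<in> block_space n"
proof -
  have "embed n v m = 0" if "m \<notin> (\<lambda>i. prod_encode (n, i)) ` {..<d n}" for m
  proof -
    obtain a i where m: "m = prod_encode (a, i)" by (metis prod_decode_inverse surj_pair)
    then have "\<not> (a = n \<and> i < d n)" using that by auto
    then show ?thesis by (auto simp: embed_def m)
  qed
  then show ?thesis by (simp add: block_space_def)
qed

lemma block_embed: "i < d n \<Longrightarrow> block n (embed n v) i = v i"
  by (simp add: block_def embed_def)

lemma nrm_embed: "nrm (embed n v) = p n v"
  using block_space_nrm(2)[OF embed_in_block_space] by (simp add: block_embed cong: p_cong)

lemma embed_block:
  assumes "x \<in> block_space n" shows "embed n (block n x) = x"
proof
  fix m
  obtain a i where m: "m = prod_encode (a, i)" by (metis prod_decode_inverse surj_pair)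
  have "block a x i = (if a = n \<and> i < d n then block n x i else 0)" by (rule block_of_block_space[OF assms])
  then show "embed n (block n x) m = x m" by (simp add: embed_def m block_def)
qed

definition op_matrix :: "nat \<Rightarrow> nat \<Rightarrow> ((nat \<Rightarrow> real) \<Rightarrow> nat \<Rightarrow> real) \<Rightarrow> nat \<Rightarrow> nat \<Rightarrow> real"
  where "op_matrix n n' T i j = block n' (T (embed n (\<lambda>m. if m = j then 1 else 0))) i"

lemma mat_vec_op_matrix:
  assumes T: "linear_between (block_space n) F T"
  shows "mat_vec (d n) (op_matrix n n' T) v i = block n' (T (embed n v)) i"
proof -
  let ?u = "\<lambda>j. embed n (\<lambda>m. if m = j then 1 else 0)"
  have "embed n v = (\<Sum>j<d n. v j *\<^sub>R ?u j)"
  proof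
    fix m
    have "(\<Sum>j<d n. v j *\<^sub>R ?u j) m = (\<Sum>j<d n. v j * ?u j m)" by (simp add: sum_fun_apply scaleR_fun_def)
    also have "\<dots> = (\<Sum>j<d n. if j = snd (prod_decode m) then (if fst (prod_decode m) = n then v j else 0) else 0)"
      by (intro sum.cong refl) (auto simp: embed_def)
    also have "\<dots> = embed n v m" by (simp add: embed_def)
    finally show "embed n v m = (\<Sum>j<d n. v j *\<^sub>R ?u j) m" by simp
  qed
  then have "T (embed n v) = (\<Sum>j<d n. v j *\<^sub>R T (?u j))"
    using linear_between_sum[OF T subspace_block_space, of "{..<d n}" ?u v] embed_in_block_space by simp
  then show ?thesis
    by (simp add: mat_vec_def op_matrix_def block_sum block_scale mult.commute)
qed

end

theorem theoremC:
  shows "\<exists>(V :: (nat \<Rightarrow> real) set) (N :: (nat \<Rightarrow> real) \<Rightarrow> real).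
    banach_space_on V N \<and> separable_norm V N \<and> infinite_dim V \<and> finite_cotype V N \<and>
    (\<exists>c>0. \<exists>C>0. \<forall>k\<ge>1.
       ereal (c * real k) \<le> subspace_diameter V N k \<and>
       subspace_diameter V N k \<le> ereal (C * real k))"
proof -
  obtain a c :: real where ac: "a > 0" "c > 0"
    and pairs: "\<And>k. k \<ge> 1 \<Longrightarrow> \<exists>l A B. l \<le> k \<and> entries_le_1 k l A \<and> entries_le_1 k l B \<and>
      l1_euclidean a 16 k l A \<and> l1_euclidean a 16 k l B \<and> far_apart k l (c * sqrt k) A B"
    using gluskin_pairs by blast
  from pairs obtain l A B where lAB: "\<And>k. k \<ge> 1 \<Longrightarrow> l k \<le> k \<and> entries_le_1 k (l k) (A k) \<and> entries_le_1 k (l k) (B k) \<and>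
      l1_euclidean a 16 k (l k) (A k) \<and> l1_euclidean a 16 k (l k) (B k) \<and> far_apart k (l k) (c * sqrt k) (A k) (B k)"
    by metis
  \<comment> \<open>Each dimension occurs twice: blocks \<open>2 * (k - 1)\<close> and
    \<open>2 * (k - 1) + 1\<close> have dimension \<open>k\<close> and carry the quotients given by
    \<open>A k\<close> and \<open>B k\<close>.\<close>
  define d where "d n = n div 2 + 1" for n :: nat
  define G where "G n = (if even n then A (d n) else B (d n))" for n
  define p where "p n = quot_norm (d n) (l (d n)) (G n)" for n
  have d1: "d n \<ge> 1" for n by (simp add: d_def)
  have G: "l (d n) \<le> d n" "entries_le_1 (d n) (l (d n)) (G n)" "l1_euclidean a 16 (d n) (l (d n)) (G n)" for n
    using lAB[OF d1[of n]] by (auto simp: G_def)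
  interpret X: l2_sum d p "\<lambda>n. sqrt (d n)" "\<lambda>n. 1 / sqrt (d n)"
  proof
    show "p n x = p n x'" if "\<And>i. i < d n \<Longrightarrow> x i = x' i" for n x x'
      unfolding p_def using that by (rule quot_norm_cong)
    show "0 \<le> p n x" for n x by (simp add: p_def quot_norm_nonneg)
    show "p n (\<lambda>i. x i + x' i) \<le> p n x + p n x'" for n x x' by (simp add: p_def quot_norm_add)
    show "p n (\<lambda>i. s * x i) = \<bar>s\<bar> * p n x" for n s x by (simp add: p_def quot_norm_scale)
    show "\<bar>x i\<bar> \<le> sqrt (d n) * p n x" if "i < d n" for n i x
      unfolding p_def by (rule quot_norm_coord[OF G(2) that])
    show "p n x \<le> 1 / sqrt (d n) * (\<Sum>i<d n. \<bar>x i\<bar>)" for n x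
      using quot_norm_le_l1[of "d n" "l (d n)" "G n" x] by (simp add: p_def)
  qed
  obtain C :: real where C: "C > 0"
    "\<And>k l G n x. l \<le> k \<Longrightarrow> entries_le_1 k l G \<Longrightarrow> l1_euclidean a 16 k l G \<Longrightarrow>
      2 ^ n * (\<Sum>i<n. (quot_norm k l G (x i))\<^sup>2)
      \<le> C * (\<Sum>\<epsilon>\<in>signs n. (quot_norm k l G (\<lambda>m. \<Sum>i<n. \<epsilon> i * x i m))\<^sup>2)"
    using quot_norm_cotype[of a 16] ac by auto
  have "has_cotype X.carrier X.nrm 2 (sqrt C)"
    by (rule X.cotype[OF C(1)]) (unfold p_def, rule C(2)[OF G])
  then have cot: "finite_cotype X.carrier X.nrm" unfolding finite_cotype_def by blast
  have inf: "infinite_dim X.carrier"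
  proof (rule X.infinite_dim)
    show "\<exists>n. b < d n" for b by (rule exI[of _ "2 * b"]) (simp add: d_def)
  qed
  have lower: "ereal (c\<^sup>2 * real k) \<le> subspace_diameter X.carrier X.nrm k" if k: "k \<ge> 1" for k
  proof -
    define n where "n = 2 * (k - 1)"
    define n' where "n' = Suc n"
    have dn: "d n = k" "d n' = k" using k by (simp_all add: d_def n_def n'_def)
    have pn: "p n = quot_norm k (l k) (A k)" "p n' = quot_norm k (l k) (B k)"
      unfolding p_def G_def dn by (simp_all add: n_def n'_def)
    let ?E = "X.block_space n" and ?F = "X.block_space n'"
    have E: "subspace ?E" "?E \<subseteq> X.carrier" "dim ?E = k" and F: "subspace ?F" "?F \<subseteq> X.carrier" "dim ?F = k"
      using X.subspace_block_space X.block_space_nrm(1) X.dim_block_space[of n] X.dim_block_space[of n'] dn by auto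
    \<comment> \<open>The distance bound is quadratic in \<open>r\<close>, so a radius of order
      \<open>sqrt k\<close> yields the linear lower bound c^2 * k.\<close>
    define r where "r = c * sqrt k"
    have r: "r > 0" using ac k by (simp add: r_def)
    have far: "far_apart k (l k) r (A k) (B k)" using lAB[OF k] by (simp add: r_def)
    let ?x = "X.embed n (\<lambda>_. 1)"
    have "block n ?x 0 = 1" using k dn by (intro X.block_embed) simp
    then have x0: "?x \<noteq> 0" by (auto simp: block_def)
    have "ereal (r\<^sup>2) \<le> banach_mazur_dist X.nrm ?E ?F"
    proof (rule X.banach_mazur_dist_ge[OF E(1,2) X.embed_in_block_space x0 F(1,2) r])
      fix T S
      assume T: "linear_between ?E ?F T" and S: "linear_between ?F ?E S"
        and ST: "\<And>x. x \<in> ?E \<Longrightarrow> S (T x) = x" and TS: "\<And>z. z \<in> ?F \<Longrightarrow> T (S z) = z"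
        and Tr: "\<And>x. x \<in> ?E \<Longrightarrow> X.nrm x \<le> 1 \<Longrightarrow> X.nrm (T x) < r"
        and Sr: "\<And>z. z \<in> ?F \<Longrightarrow> X.nrm z \<le> 1 \<Longrightarrow> X.nrm (S z) < r"
      have TF: "T x \<in> ?F" if "x \<in> ?E" for x using T that unfolding linear_between_def by blast
      have SE: "S z \<in> ?E" if "z \<in> ?F" for z using S that unfolding linear_between_def by blast
      define Tm where "Tm = X.op_matrix n n' T"
      define Sm where "Sm = X.op_matrix n' n S"
      have Tm: "mat_vec k Tm v = block n' (T (X.embed n v))" for v
        using X.mat_vec_op_matrix[OF T, of n' v] by (simp add: Tm_def dn fun_eq_iff)
      have Sm: "mat_vec k Sm v = block n (S (X.embed n' v))" for v
        using X.mat_vec_op_matrix[OF S, of n v] by (simp add: Sm_def dn fun_eq_iff)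
      have "mutually_inverse k Tm Sm"
        unfolding mutually_inverse_def
      proof (intro allI impI conjI)
        fix v i assume i: "i < k"
        show "mat_vec k Tm (mat_vec k Sm v) i = v i"
          using i dn unfolding Tm Sm
          by (simp add: X.embed_block[OF SE[OF X.embed_in_block_space]] TS[OF X.embed_in_block_space] X.block_embed)
        show "mat_vec k Sm (mat_vec k Tm v) i = v i"
          using i dn unfolding Tm Sm
          by (simp add: X.embed_block[OF TF[OF X.embed_in_block_space]] ST[OF X.embed_in_block_space] X.block_embed)
      qed
      moreover have "contracts k (l k) r (A k) (B k) Tm"
        unfolding contracts_def Tm
      proof (intro allI impI)
        fix v assume "quot_norm k (l k) (A k) v \<le> 1"
        then have "X.nrm (X.embed n v) \<le> 1" by (simp add: X.nrm_embed pn)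
        then have "X.nrm (T (X.embed n v)) < r" by (intro Tr X.embed_in_block_space)
        then show "quot_norm k (l k) (B k) (block n' (T (X.embed n v))) < r"
          using X.block_space_nrm(2)[OF TF[OF X.embed_in_block_space]] by (simp add: pn)
      qed
      moreover have "contracts k (l k) r (B k) (A k) Sm"
        unfolding contracts_def Sm
      proof (intro allI impI)
        fix v assume "quot_norm k (l k) (B k) v \<le> 1"
        then have "X.nrm (X.embed n' v) \<le> 1" by (simp add: X.nrm_embed pn)
        then have "X.nrm (S (X.embed n' v)) < r" by (intro Sr X.embed_in_block_space)
        then show "quot_norm k (l k) (A k) (block n (S (X.embed n' v))) < r"
          using X.block_space_nrm(2)[OF SE[OF X.embed_in_block_space]] by (simp add: pn)
      qed
      ultimately show False using far unfolding far_apart_def by blast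
    qed
    also have "\<dots> \<le> subspace_diameter X.carrier X.nrm k"
      unfolding subspace_diameter_def using E F by (intro SUP_upper2[of "(?E, ?F)"]) auto
    finally show ?thesis using k by (simp add: r_def power_mult_distrib)
  qed
  have c2: "c\<^sup>2 > 0" using ac by simp
  have "\<forall>k\<ge>1. ereal (c\<^sup>2 * real k) \<le> subspace_diameter X.carrier X.nrm k \<and>
      subspace_diameter X.carrier X.nrm k \<le> ereal (8 * real k)"
    using lower X.subspace_diameter_le by blast
  then have "\<exists>c>0. \<exists>C>0. \<forall>k\<ge>1. ereal (c * real k) \<le> subspace_diameter X.carrier X.nrm k \<and>
      subspace_diameter X.carrier X.nrm k \<le> ereal (C * real k)"
    using c2 by (intro exI[of _ "c\<^sup>2"] conjI exI[of _ "8::real"]) auto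
  then show ?thesis using X.banach X.separable inf cot by blast
qed

end
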